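(* Let $h:\mathbb{C}\to\mathbb{R}$ be a smooth map and $E_h:=\{x+iy\in\mathbb{C} : h(x,y)=0\}$. If $dh\neq 0$ on $E_h$, then every $C^2$-smooth totally real disc contained in $M:=E_h\times\mathbb{C}\subset\mathbb{C}^2$ is polynomially convex.
   Context: For a compact $K\subset\mathbb{C}^n$, $\widehat{K}:=\{z\in\mathbb{C}^n : |p(z)|\le \sup_K|p| \text{ for all holomorphic polynomials } p\}$, and $K$ is polynomially convex if $\widehat{K}=K$. A submanifold $N\subset\mathbb{C}^n$ is totally real if $T_pN\cap iT_pN=\{0\}$ for all $p\in N$. A $C^2$-smooth totally real disc is a compact subset of a $C^2$-smooth totally real submanifold of $\mathbb{C}^2$ which is $C^2$-diffeomorphic to the closed unit disc in the plane. *)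

theory Defs
  imports "HOL-Analysis.Analysis"
begin

primrec Ck_plane :: "nat \<Rightarrow> (complex \<Rightarrow> real) \<Rightarrow> bool" where
  "Ck_plane 0 f \<longleftrightarrow> continuous_on UNIV f"
| "Ck_plane (Suc k) f \<longleftrightarrow> (\<exists>fx fy. (\<forall>z. (f has_derivative (\<lambda>v. Re v * fx z + Im v * fy z)) (at z))
        \<and> Ck_plane k fx \<and> Ck_plane k fy)"

definition smooth_plane :: "(complex \<Rightarrow> real) \<Rightarrow> bool" where
  "smooth_plane f \<longleftrightarrow> (\<forall>k. Ck_plane k f)"

definition C1_on :: "'a::real_normed_vector set \<Rightarrow> ('a \<Rightarrow> 'b::real_normed_vector) \<Rightarrow> bool" where
  "C1_on U f \<longleftrightarrow> (\<exists>Df. (\<forall>x\<in>U. (f has_derivative blinfun_apply (Df x)) (at x)) \<and> continuous_on U Df)"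

definition C2_on :: "'a::real_normed_vector set \<Rightarrow> ('a \<Rightarrow> 'b::real_normed_vector) \<Rightarrow> bool" where
  "C2_on U f \<longleftrightarrow> (\<exists>Df. (\<forall>x\<in>U. (f has_derivative blinfun_apply (Df x)) (at x)) \<and> C1_on U Df)"

definition C2_submanifold :: "(complex \<times> complex) set \<Rightarrow> bool" where
  "C2_submanifold N \<longleftrightarrow> (\<forall>p\<in>N. \<exists>U V L (\<Phi>::complex \<times> complex \<Rightarrow> complex \<times> complex) \<Psi>.
      open U \<and> p \<in> U \<and> open V \<and> subspace L \<and> C2_on U \<Phi> \<and> C2_on V \<Psi> \<and>
      \<Phi> ` U = V \<and> (\<forall>x\<in>U. \<Psi> (\<Phi> x) = x) \<and> (\<forall>y\<in>V. \<Phi> (\<Psi> y) = y) \<and>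
      \<Phi> ` (U \<inter> N) = V \<inter> L)"

definition tangent_space :: "(complex \<times> complex) set \<Rightarrow> complex \<times> complex \<Rightarrow> (complex \<times> complex) set" where
  "tangent_space N p = {v. \<exists>e>0. \<exists>\<gamma>::real \<Rightarrow> complex \<times> complex. \<gamma> 0 = p \<and> \<gamma> ` ball 0 e \<subseteq> N \<and>
      (\<gamma> has_vector_derivative v) (at 0)}"

definition mult_i :: "complex \<times> complex \<Rightarrow> complex \<times> complex" where
  "mult_i v = (\<i> * fst v, \<i> * snd v)"

definition totally_real :: "(complex \<times> complex) set \<Rightarrow> bool" where
  "totally_real N \<longleftrightarrow> (\<forall>p\<in>N. tangent_space N p \<inter> mult_i ` tangent_space N p = {0})"

definition C2_disc_image :: "(complex \<times> complex) set \<Rightarrow> bool" where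
  "C2_disc_image D \<longleftrightarrow> (\<exists>U (\<phi>::complex \<Rightarrow> complex \<times> complex).
      open U \<and> cball 0 1 \<subseteq> U \<and> C2_on U \<phi> \<and> inj_on \<phi> (cball 0 1) \<and>
      (\<forall>x\<in>cball 0 1. inj (frechet_derivative \<phi> (at x))) \<and> \<phi> ` cball 0 1 = D)"

definition C2_totally_real_disc :: "(complex \<times> complex) set \<Rightarrow> bool" where
  "C2_totally_real_disc D \<longleftrightarrow> (\<exists>N. C2_submanifold N \<and> totally_real N \<and> compact D \<and> D \<subseteq> N \<and> C2_disc_image D)"

definition hol_polys2 :: "(complex \<times> complex \<Rightarrow> complex) set" where
  "hol_polys2 = {p. \<exists>n (c::nat \<Rightarrow> nat \<Rightarrow> complex). \<forall>z w. p (z, w) = (\<Sum>j\<le>n. \<Sum>k\<le>n. c j k * z ^ j * w ^ k)}"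

definition poly_hull :: "(complex \<times> complex) set \<Rightarrow> (complex \<times> complex) set" where
  "poly_hull K = {z. \<forall>p\<in>hol_polys2. norm (p z) \<le> Sup ((\<lambda>y. norm (p y)) ` K)}"

definition polynomially_convex :: "(complex \<times> complex) set \<Rightarrow> bool" where
  "polynomially_convex K \<longleftrightarrow> poly_hull K = K"

end

theory Submission
  imports Defs "HOL-Complex_Analysis.Complex_Analysis"
begin

text \<open>Let \<open>F\<close> be the projection of the disc \<open>D\<close> to the first coordinate, a compact connected subset of
the curve \<open>h = 0\<close>. Since \<open>D\<close> is totally real, this projection has rank one on \<open>D\<close>, so a nonvanishing
\<open>1\<close>-form along the curve pulls back to a locally exact, hence exact, form on the disc. Its primitive \<open>g\<close>
unwinds the curve and has no critical points. By the extremum principle the level sets of \<open>g\<close>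
in a fibre of \<open>D\<close> do not separate the plane, and therefore neither do the fibres.

Exterior tangent discs of the curve provide peak functions \<open>1 / (z - e)\<close>. If all points outside \<open>F\<close> are
resolvent points of \<open>z\<close> in the uniform closure of the polynomials on \<open>D\<close>, the hull of \<open>D\<close> can be computed
fibrewise and equals \<open>D\<close>. Otherwise some functional \<open>l\<close> annihilates the polynomials but not all
\<open>1 / (z - a)\<close>. Near \<open>F\<close> its Cauchy transform splits into holomorphic contributions of the sheets
of \<open>D\<close> cut out by the values of \<open>g\<close>. A sheet ends where \<open>g\<close> exceeds its maximum, so its contribution
vanishes there; by the identity theorem this propagates downwards along \<open>g\<close>, all contributions vanish,
and so does the Cauchy transform, a contradiction.\<close>

section \<open>Hahn--Banach separation\<close>

text \<open>A sheet exists only over a neighbourhood of a point of \<open>F\<close>. Its indicator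
  is a limit of polynomials near one fibre, and these polynomials may grow exponentially on the rest
  of \<open>D\<close>, so the functional cannot simply be applied to a sheet. Its contribution is
  instead the limit of the Cauchy transforms of these polynomials. Convergence rests on the peak
  functions: for a resolvent point \<open>e\<close> the function \<open>1 / (z - e)\<close> can be
  pulled out of the transform as its value at the argument, so a high power may be inserted to damp
  the growth and then divided off again. This needs resolvent points on one side of the curve near
  every point of \<open>F\<close>, while the transform lives on the other side. Hence
  \<open>F\<close> is first shown to be open in the curve, with the two kinds of complementary
  points on opposite sides. The projection has rank at most one because it maps into a curve; rank
  zero would make the tangent plane of \<open>D\<close> the complex line of the second
  coordinate.\<close>

lemma hahn_banach_dominated:
  fixes R0 :: "('a::real_normed_vector \<times> real) set"
  assumes "subspace R0" and dom0: "\<And>v c. (v, c) \<in> R0 \<Longrightarrow> c \<le> norm v"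
  shows "\<exists>f. linear f \<and> (\<forall>v. \<bar>f v\<bar> \<le> norm v) \<and> (\<forall>(v, c) \<in> R0. f v = c)"
proof -
  \<comment> \<open>Functionals are represented by their graphs, so the union of a chain is again a
    candidate. Single-valuedness follows from domination, applied to \<open>(0, c - c')\<close> and
    its negative.\<close>
  define \<G> where "\<G> = {R. subspace R \<and> R0 \<subseteq> R \<and> (\<forall>v c. (v, c) \<in> R \<longrightarrow> c \<le> norm (v::'a))}"
  have "\<exists>M\<in>\<G>. \<forall>X\<in>\<G>. M \<subseteq> X \<longrightarrow> X = M"
  proof (rule subset_Zorn_nonempty)
    show "\<G> \<noteq> {}" using assms by (auto simp: \<G>_def)
    fix \<C> assume ne: "\<C> \<noteq> {}" and ch: "subset.chain \<G> \<C>"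
    have sub: "\<And>R. R \<in> \<C> \<Longrightarrow> R \<in> \<G>" using ch by (auto simp: subset.chain_def)
    have cmp: "\<And>R R'. R \<in> \<C> \<Longrightarrow> R' \<in> \<C> \<Longrightarrow> R \<subseteq> R' \<or> R' \<subseteq> R"
      using ch by (auto simp: subset.chain_def)
    have "subspace (\<Union>\<C>)"
    proof (rule subspaceI)
      show "0 \<in> \<Union>\<C>" using ne sub by (auto simp: \<G>_def subspace_0)
      show "x + y \<in> \<Union>\<C>" if xy: "x \<in> \<Union>\<C>" "y \<in> \<Union>\<C>" for x y
      proof -
        obtain X Y where XY: "X \<in> \<C>" "Y \<in> \<C>" "x \<in> X" "y \<in> Y" using xy by auto
        then obtain W where "W \<in> \<C>" "x \<in> W" "y \<in> W" using cmp[of X Y] by blast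
        then show ?thesis using sub[of W] subspace_add[of W x y] by (auto simp: \<G>_def)
      qed
      show "c *\<^sub>R x \<in> \<Union>\<C>" if "x \<in> \<Union>\<C>" for c x
        using that sub by (auto simp: \<G>_def intro: subspace_scale)
    qed
    then show "\<Union>\<C> \<in> \<G>" using ne sub by (auto simp: \<G>_def)
  qed
  then obtain M where M: "M \<in> \<G>" and max: "\<And>X. X \<in> \<G> \<Longrightarrow> M \<subseteq> X \<Longrightarrow> X = M" by blast
  have sM: "subspace M" and dM: "\<And>v c. (v, c) \<in> M \<Longrightarrow> c \<le> norm v" and R0M: "R0 \<subseteq> M"
    using M by (auto simp: \<G>_def)
  have total: "\<exists>c. (v0, c) \<in> M" for v0
  proof -
    define L where "L = {c - norm (u - v0) | u c. (u, c) \<in> M}"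
    have z: "(0, 0) \<in> M" using subspace_0[OF sM] by (simp add: zero_prod_def)
    have le: "c - norm (u - v0) \<le> norm (u' + v0) - c'" if "(u, c) \<in> M" "(u', c') \<in> M" for u c u' c'
    proof -
      have "(u + u', c + c') \<in> M" using subspace_add[OF sM that] by simp
      then have "c + c' \<le> norm (u + u')" by (rule dM)
      also have "\<dots> = norm ((u - v0) + (u' + v0))" by simp
      also have "\<dots> \<le> norm (u - v0) + norm (u' + v0)" by (rule norm_triangle_ineq)
      finally show ?thesis by simp
    qed
    \<comment> \<open>Any dominated extension takes at \<open>v0\<close> a value between the lower
      bounds in \<open>L\<close> and the upper bounds \<open>norm (u' + v0) - c'\<close>. After
      scaling to \<open>t = 1\<close> or \<open>t = -1\<close> these two families of bounds are
      domination on the enlarged graph.\<close>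
    define a where "a = Sup L"
    have a1: "c - norm (u - v0) \<le> a" if "(u, c) \<in> M" for u c
      unfolding a_def
    proof (rule cSup_upper)
      show "c - norm (u - v0) \<in> L" using that by (auto simp: L_def)
      show "bdd_above L" using le[OF _ z] by (intro bdd_aboveI[of _ "norm (0 + v0) - 0"]) (auto simp: L_def)
    qed
    have a2: "a \<le> norm (u' + v0) - c'" if "(u', c') \<in> M" for u' c'
      unfolding a_def
    proof (rule cSup_least)
      show "L \<noteq> {}" using z by (auto simp: L_def)
      show "\<And>x. x \<in> L \<Longrightarrow> x \<le> norm (u' + v0) - c'" using le[OF _ that] by (auto simp: L_def)
    qed
    have key: "c + t * a \<le> norm (u + t *\<^sub>R v0)" if uc: "(u, c) \<in> M" for u c t
    proof -
      consider "t = 0" | "t > 0" | "t < 0" by linarith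
      then show ?thesis
      proof cases
        case 1 then show ?thesis using dM[OF uc] by simp
      next
        case 2
        have "((1/t) *\<^sub>R u, (1/t) * c) \<in> M" using subspace_scale[OF sM uc, of "1/t"] by simp
        from a2[OF this] have "t * a \<le> t * (norm ((1/t) *\<^sub>R u + v0) - (1/t) * c)" using 2 by simp
        also have "\<dots> = norm (t *\<^sub>R ((1/t) *\<^sub>R u + v0)) - c" using 2 by (simp add: right_diff_distrib)
        also have "\<dots> = norm (u + t *\<^sub>R v0) - c" using 2 by (simp add: scaleR_add_right)
        finally show ?thesis by simp
      next
        case 3
        define s where "s = - t"
        have s: "s > 0" using 3 by (simp add: s_def)
        have "((1/s) *\<^sub>R u, (1/s) * c) \<in> M" using subspace_scale[OF sM uc, of "1/s"] by simp
        from a1[OF this] have "s * ((1/s) * c - norm ((1/s) *\<^sub>R u - v0)) \<le> s * a" using s by simp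
        moreover have "s * ((1/s) * c - norm ((1/s) *\<^sub>R u - v0)) = c - norm (s *\<^sub>R ((1/s) *\<^sub>R u - v0))"
          using s by (simp add: right_diff_distrib)
        moreover have "s *\<^sub>R ((1/s) *\<^sub>R u - v0) = u + t *\<^sub>R v0" using s by (simp add: s_def scaleR_diff_right)
        ultimately have "c - norm (u + t *\<^sub>R v0) \<le> s * a" by metis
        then show ?thesis by (simp add: s_def)
      qed
    qed
    define M' where "M' = {x + y |x y. x \<in> M \<and> y \<in> span {(v0, a)}}"
    have MM': "M \<subseteq> M'"
    proof
      fix x assume "x \<in> M"
      then show "x \<in> M'" unfolding M'_def using span_zero[of "{(v0,a)}"]
        by (intro CollectI exI[of _ x] exI[of _ 0]) auto
    qed
    have "M' \<in> \<G>"
    proof -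
      have "subspace M'" unfolding M'_def by (intro subspace_sums sM subspace_span)
      moreover have "c \<le> norm v" if "(v, c) \<in> M'" for v c
        using that key unfolding M'_def span_singleton by auto
      ultimately show ?thesis using R0M MM' by (auto simp: \<G>_def)
    qed
    then have "M' = M" using MM' by (rule max)
    moreover have "(v0, a) \<in> M'" unfolding M'_def using z span_base[of "(v0,a)" "{(v0,a)}"]
      by (intro CollectI exI[of _ 0] exI[of _ "(v0, a)"]) (auto simp: zero_prod_def)
    ultimately show ?thesis by auto
  qed
  have uniq: "c = c'" if "(v, c) \<in> M" "(v, c') \<in> M" for v c c'
    using dM[of 0 "c - c'"] dM[of 0 "c' - c"] subspace_diff[OF sM that] subspace_diff[OF sM that(2) that(1)]
    by simp
  define f where "f v = (THE c. (v, c) \<in> M)" for v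
  have fM: "(v, f v) \<in> M" for v
    unfolding f_def using total[of v] uniq by (metis (mono_tags, lifting) theI)
  have "linear f"
  proof (rule linearI)
    show "f (x + y) = f x + f y" for x y
      using uniq[OF fM[of "x+y"]] subspace_add[OF sM fM fM] by simp
    show "f (r *\<^sub>R x) = r *\<^sub>R f x" for r x
      using uniq[OF fM[of "r *\<^sub>R x"]] subspace_scale[OF sM fM] by simp
  qed
  moreover have "\<bar>f v\<bar> \<le> norm v" for v
    using dM[OF fM[of v]] dM[OF fM[of "-v"]] linear_neg[OF \<open>linear f\<close>, of v] by auto
  moreover have "\<forall>(v, c) \<in> R0. f v = c" using R0M fM uniq by blast
  ultimately show ?thesis by blast
qed

text \<open>The set \<open>R0\<close> is the graph of the functional with value \<open>a * d\<close>
  at \<open>s + a x\<close>. It is dominated by the norm because for \<open>a \<noteq> 0\<close>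
  this vector is \<open>a\<close> times a difference \<open>x - s'\<close> with \<open>s'\<close> in
  \<open>S\<close>, whose norm is at least \<open>d\<close>.\<close>

lemma hahn_banach_separation:
  fixes S :: "'a::real_normed_vector set"
  assumes S: "subspace S" and d: "d > 0" "\<And>s. s \<in> S \<Longrightarrow> d \<le> norm (x - s)"
  shows "\<exists>f. linear f \<and> (\<forall>v. \<bar>f v\<bar> \<le> norm v) \<and> (\<forall>s\<in>S. f s = 0) \<and> f x = d"
proof -
  define R0 where "R0 = {u + w |u w. u \<in> S \<times> {0::real} \<and> w \<in> span {(x, d)}}"
  have s0: "subspace ({0::real})" by simp
  have "subspace R0" unfolding R0_def by (intro subspace_sums subspace_Times S s0 subspace_span)
  moreover have "c \<le> norm v" if "(v, c) \<in> R0" for v c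
  proof -
    obtain s a where sa: "s \<in> S" "v = s + a *\<^sub>R x" "c = a * d"
      using \<open>(v,c) \<in> R0\<close> unfolding R0_def span_singleton by auto
    show ?thesis
    proof (cases "a = 0")
      case True then show ?thesis using sa by simp
    next
      case False
      have "- (1/a) *\<^sub>R s \<in> S" using S sa(1) by (simp add: subspace_scale subspace_neg)
      from d(2)[OF this] have "\<bar>a\<bar> * d \<le> \<bar>a\<bar> * norm (x + (1/a) *\<^sub>R s)"
        by (simp add: mult_left_mono)
      also have "\<dots> = norm (a *\<^sub>R (x + (1/a) *\<^sub>R s))" by simp
      also have "a *\<^sub>R (x + (1/a) *\<^sub>R s) = v" using False sa by (simp add: scaleR_add_right)
      finally have "\<bar>a\<bar> * d \<le> norm v" .
      moreover have "a * d \<le> \<bar>a\<bar> * d" using d by (simp add: mult_right_mono)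
      ultimately show ?thesis using sa by linarith
    qed
  qed
  ultimately obtain f where f: "linear f" "\<forall>v. \<bar>f v\<bar> \<le> norm v" "\<forall>(v, c) \<in> R0. f v = c"
    using hahn_banach_dominated[of R0] by blast
  have "(s, 0) \<in> R0" if "s \<in> S" for s
    unfolding R0_def using that span_zero[of "{(x,d)}"] by (force simp: zero_prod_def)
  moreover have "(x, d) \<in> R0"
    unfolding R0_def using subspace_0[OF S] span_base[of "(x,d)" "{(x,d)}"]
    by (force simp: zero_prod_def[symmetric])
  moreover have "\<And>v c. (v, c) \<in> R0 \<Longrightarrow> f v = c" using f(3) by auto
  ultimately have "\<forall>s\<in>S. f s = 0" "f x = d" by blast+
  then show ?thesis using f(1,2) by auto
qed

section \<open>Uniform approximation by polynomials\<close>

text \<open>Sums and products of polynomials arise as sums over disjoint unions and products of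
  index sets, with repeated exponents; this rule brings them back to the square form of
  \<open>hol_polys2\<close>.\<close>

lemma hol_polys2I:
  assumes "finite I" "\<And>z w. p (z, w) = (\<Sum>i\<in>I. c i * z ^ a i * w ^ b i)"
  shows "p \<in> hol_polys2"
proof -
  \<comment> \<open>The inserted \<open>0\<close> keeps the maximum defined for an empty index
    set.\<close>
  define n where "n = Max (insert 0 (a ` I \<union> b ` I))"
  have n: "a i \<le> n" "b i \<le> n" if "i \<in> I" for i
    using that assms(1) by (auto simp: n_def intro!: Max_ge)
  define C where "C j k = (\<Sum>i\<in>{i\<in>I. a i = j \<and> b i = k}. c i)" for j k
  have "p (z, w) = (\<Sum>j\<le>n. \<Sum>k\<le>n. C j k * z ^ j * w ^ k)" for z w
  proof -
    have "(\<Sum>j\<le>n. \<Sum>k\<le>n. C j k * z ^ j * w ^ k) =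
      (\<Sum>j\<le>n. \<Sum>k\<le>n. \<Sum>i\<in>I. if a i = j \<and> b i = k then c i * z ^ j * w ^ k else 0)"
      unfolding C_def using assms(1)
      by (intro sum.cong refl) (simp add: sum_distrib_right sum.If_cases Int_def)
    also have "\<dots> = (\<Sum>i\<in>I. \<Sum>j\<le>n. \<Sum>k\<le>n. if a i = j \<and> b i = k then c i * z ^ j * w ^ k else 0)"
      by (rule trans[OF sum.cong[OF refl sum.swap] sum.swap])
    also have "\<dots> = (\<Sum>i\<in>I. \<Sum>j\<le>n. \<Sum>k\<le>n. if j = a i then (if k = b i then c i * z ^ a i * w ^ b i else 0) else 0)"
      by (intro sum.cong refl) auto
    also have "\<dots> = (\<Sum>i\<in>I. \<Sum>j\<le>n. if j = a i then (\<Sum>k\<le>n. if k = b i then c i * z ^ a i * w ^ b i else 0) else 0)"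
      by (intro sum.cong refl) auto
    also have "\<dots> = (\<Sum>i\<in>I. c i * z ^ a i * w ^ b i)"
      using n by (intro sum.cong refl) (auto simp: sum.delta)
    finally show ?thesis using assms(2) by simp
  qed
  then show ?thesis unfolding hol_polys2_def by blast
qed

lemma hol_polys2E:
  assumes "p \<in> hol_polys2"
  obtains I :: "(nat \<times> nat) set" and c where "finite I" "\<And>z w. p (z, w) = (\<Sum>i\<in>I. c i * z ^ fst i * w ^ snd i)"
proof -
  obtain n c where c: "\<forall>z w. p (z, w) = (\<Sum>j\<le>n. \<Sum>k\<le>n. c j k * z ^ j * w ^ k)"
    using assms unfolding hol_polys2_def by auto
  show ?thesis
    by (rule that[of "{..n} \<times> {..n}" "\<lambda>(j, k). c j k"])
       (auto simp: c sum.cartesian_product intro!: sum.cong)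
qed

lemma hol_polys2_const: "(\<lambda>_. k) \<in> hol_polys2"
  by (rule hol_polys2I[of "{()}" _ "\<lambda>_. k" "\<lambda>_. 0" "\<lambda>_. 0"]) auto

lemma hol_polys2_fst: "fst \<in> hol_polys2"
  by (rule hol_polys2I[of "{()}" _ "\<lambda>_. 1" "\<lambda>_. 1" "\<lambda>_. 0"]) auto

lemma hol_polys2_snd: "snd \<in> hol_polys2"
  by (rule hol_polys2I[of "{()}" _ "\<lambda>_. 1" "\<lambda>_. 0" "\<lambda>_. 1"]) auto

lemma hol_polys2_add:
  assumes "p \<in> hol_polys2" "q \<in> hol_polys2"
  shows "(\<lambda>y. p y + q y) \<in> hol_polys2"
proof -
  obtain I c where I: "finite I" "\<And>z w. p (z, w) = (\<Sum>i\<in>I. c i * z ^ fst i * w ^ snd i)"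
    using hol_polys2E[OF assms(1)] by metis
  obtain J d where J: "finite J" "\<And>z w. q (z, w) = (\<Sum>i\<in>J. d i * z ^ fst i * w ^ snd i)"
    using hol_polys2E[OF assms(2)] by metis
  show ?thesis
    by (rule hol_polys2I[of "I <+> J" _ "case_sum c d" "case_sum fst fst" "case_sum snd snd"])
       (auto simp: I J sum.Plus)
qed

lemma hol_polys2_mult:
  assumes "p \<in> hol_polys2" "q \<in> hol_polys2"
  shows "(\<lambda>y. p y * q y) \<in> hol_polys2"
proof -
  obtain I c where I: "finite I" "\<And>z w. p (z, w) = (\<Sum>i\<in>I. c i * z ^ fst i * w ^ snd i)"
    using hol_polys2E[OF assms(1)] by metis
  obtain J d where J: "finite J" "\<And>z w. q (z, w) = (\<Sum>i\<in>J. d i * z ^ fst i * w ^ snd i)"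
    using hol_polys2E[OF assms(2)] by metis
  show ?thesis
    by (rule hol_polys2I[of "I \<times> J" _ "\<lambda>(i,j). c i * d j" "\<lambda>(i,j). fst i + fst j" "\<lambda>(i,j). snd i + snd j"])
       (auto simp: I J sum_product sum.cartesian_product power_add mult_ac intro!: sum.cong)
qed

lemma hol_polys2_sum:
  assumes "\<And>i. i \<in> I \<Longrightarrow> p i \<in> hol_polys2"
  shows "(\<lambda>y. \<Sum>i\<in>I. p i y) \<in> hol_polys2"
  using assms by (induction I rule: infinite_finite_induct) (auto intro: hol_polys2_const hol_polys2_add)

lemma hol_polys2_power:
  assumes "p \<in> hol_polys2" shows "(\<lambda>y. p y ^ n) \<in> hol_polys2"
  using assms by (induction n) (auto intro: hol_polys2_const hol_polys2_mult)

lemma hol_polys2_diff: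
  assumes "p \<in> hol_polys2" "q \<in> hol_polys2"
  shows "(\<lambda>y. p y - q y) \<in> hol_polys2"
  using hol_polys2_add[OF assms(1) hol_polys2_mult[OF hol_polys2_const[of "-1"] assms(2)]] by simp

lemmas hol_polys2_intros = hol_polys2_const hol_polys2_fst hol_polys2_snd hol_polys2_add
  hol_polys2_mult hol_polys2_sum hol_polys2_power hol_polys2_diff

lemma continuous_on_hol_polys2:
  assumes "p \<in> hol_polys2" shows "continuous_on S p"
proof -
  obtain I c where I: "finite I" "\<And>z w. p (z, w) = (\<Sum>i\<in>I. c i * z ^ fst i * w ^ snd i)"
    using hol_polys2E[OF assms(1)] by metis
  have "p = (\<lambda>y. \<Sum>i\<in>I. c i * fst y ^ fst i * snd y ^ snd i)"
    using I(2) by (auto simp: fun_eq_iff)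
  then show ?thesis by (simp add: continuous_intros)
qed

section \<open>The uniform closure of the polynomials on a set\<close>

definition papprox :: "(complex \<times> complex) set \<Rightarrow> (complex \<times> complex \<Rightarrow> complex) \<Rightarrow> bool" where
  "papprox X u \<longleftrightarrow> (\<forall>e>0. \<exists>p\<in>hol_polys2. \<forall>y\<in>X. norm (p y - u y) < e)"

lemma papprox_poly: "p \<in> hol_polys2 \<Longrightarrow> papprox X p"
  unfolding papprox_def by force

lemma papprox_cong: "(\<And>y. y \<in> X \<Longrightarrow> u y = v y) \<Longrightarrow> papprox X u \<longleftrightarrow> papprox X v"
  unfolding papprox_def by auto

lemma papprox_closed:
  assumes "\<And>e. e > 0 \<Longrightarrow> \<exists>v. papprox X v \<and> (\<forall>y\<in>X. norm (v y - u y) < e)"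
  shows "papprox X u"
  unfolding papprox_def
proof (intro allI impI)
  fix e :: real assume "e > 0"
  then obtain v where v: "papprox X v" "\<And>y. y \<in> X \<Longrightarrow> norm (v y - u y) < e / 2" using assms[of "e/2"] by auto
  then obtain p where p: "p \<in> hol_polys2" "\<And>y. y \<in> X \<Longrightarrow> norm (p y - v y) < e / 2"
    unfolding papprox_def using \<open>e > 0\<close> by (meson half_gt_zero)
  show "\<exists>p\<in>hol_polys2. \<forall>y\<in>X. norm (p y - u y) < e"
    using p v norm_triangle_half_l by (metis norm_minus_commute)
qed

lemma papprox_add:
  assumes "papprox X u" "papprox X v" shows "papprox X (\<lambda>y. u y + v y)"
  unfolding papprox_def
proof (intro allI impI)
  fix e :: real assume "e > 0"
  then obtain p q where pq: "p \<in> hol_polys2" "q \<in> hol_polys2"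
    "\<And>y. y \<in> X \<Longrightarrow> norm (p y - u y) < e / 2" "\<And>y. y \<in> X \<Longrightarrow> norm (q y - v y) < e / 2"
    using assms unfolding papprox_def by (meson half_gt_zero)
  show "\<exists>p\<in>hol_polys2. \<forall>y\<in>X. norm (p y - (u y + v y)) < e"
  proof (intro bexI ballI)
    show "(\<lambda>y. p y + q y) \<in> hol_polys2" by (intro hol_polys2_intros pq)
    show "norm (p y + q y - (u y + v y)) < e" if "y \<in> X" for y
      using pq(3,4)[OF that] norm_add_less[of "p y - u y" "e/2" "q y - v y" "e/2"] by (simp add: algebra_simps)
  qed
qed

lemma papprox_bounded:
  assumes "compact X" "papprox X u"
  shows "\<exists>B>0. \<forall>y\<in>X. norm (u y) \<le> B"
proof -
  obtain p where p: "p \<in> hol_polys2" "\<And>y. y \<in> X \<Longrightarrow> norm (p y - u y) < 1"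
    using assms(2) unfolding papprox_def by (meson zero_less_one)
  have "bounded (p ` X)"
    by (intro compact_imp_bounded compact_continuous_image continuous_on_hol_polys2 p assms)
  then obtain B where B: "B > 0" "\<And>y. y \<in> X \<Longrightarrow> norm (p y) \<le> B" by (auto simp: bounded_pos)
  have "norm (u y) \<le> B + 1" if "y \<in> X" for y
    using B(2)[OF that] p(2)[OF that] norm_triangle_ineq2[of "u y" "p y"] by (simp add: norm_minus_commute)
  then show ?thesis using B(1) by (intro exI[of _ "B+1"]) auto
qed

lemma papprox_mult:
  assumes X: "compact X" and "papprox X u" "papprox X v" shows "papprox X (\<lambda>y. u y * v y)"
  unfolding papprox_def
proof (intro allI impI)
  fix e :: real assume e: "e > 0"
  obtain B where B: "B > 0" "\<And>y. y \<in> X \<Longrightarrow> norm (u y) \<le> B" using papprox_bounded[OF X assms(2)] by auto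
  \<comment> \<open>The order of choice matters: the accuracy required of \<open>p\<close> depends
    on a bound for the polynomial \<open>q\<close> already chosen.\<close>
  obtain q where q: "q \<in> hol_polys2" "\<And>y. y \<in> X \<Longrightarrow> norm (q y - v y) < e / (2 * B)"
    using assms(3)[unfolded papprox_def, rule_format, of "e / (2 * B)"] B(1) e by auto
  obtain B' where B': "B' > 0" "\<And>y. y \<in> X \<Longrightarrow> norm (q y) \<le> B'"
    using papprox_bounded[OF X papprox_poly[OF q(1)]] by auto
  obtain p where p: "p \<in> hol_polys2" "\<And>y. y \<in> X \<Longrightarrow> norm (p y - u y) < e / (2 * B')"
    using assms(2)[unfolded papprox_def, rule_format, of "e / (2 * B')"] B'(1) e by auto
  show "\<exists>p\<in>hol_polys2. \<forall>y\<in>X. norm (p y - (u y * v y)) < e"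
  proof (intro bexI ballI)
    show "(\<lambda>y. p y * q y) \<in> hol_polys2" by (intro hol_polys2_intros p q)
    fix y assume y: "y \<in> X"
    have "norm (p y - u y) * norm (q y) < e / 2"
    proof -
      have "norm (p y - u y) * norm (q y) \<le> norm (p y - u y) * B'" using B'(2)[OF y] by (simp add: mult_left_mono)
      also have "\<dots> < e / (2 * B') * B'" using p(2)[OF y] B'(1) by (intro mult_strict_right_mono) auto
      finally show ?thesis using B'(1) by simp
    qed
    moreover have "norm (u y) * norm (q y - v y) < e / 2"
    proof -
      have "norm (u y) * norm (q y - v y) \<le> B * norm (q y - v y)" using B(2)[OF y] by (simp add: mult_right_mono)
      also have "\<dots> < B * (e / (2 * B))" using q(2)[OF y] B(1) by (intro mult_strict_left_mono) auto
      finally show ?thesis using B(1) by simp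
    qed
    moreover have "p y * q y - u y * v y = (p y - u y) * q y + u y * (q y - v y)" by (simp add: algebra_simps)
    ultimately show "norm (p y * q y - u y * v y) < e"
      using norm_triangle_ineq[of "(p y - u y) * q y" "u y * (q y - v y)"] by (simp add: norm_mult)
  qed
qed

lemma papprox_sum:
  assumes "\<And>i. i \<in> I \<Longrightarrow> papprox X (u i)" shows "papprox X (\<lambda>y. \<Sum>i\<in>I. u i y)"
  using assms by (induction I rule: infinite_finite_induct)
    (auto intro: papprox_poly[OF hol_polys2_const] papprox_add)

lemma papprox_power:
  assumes "compact X" "papprox X u" shows "papprox X (\<lambda>y. u y ^ n)"
  using assms by (induction n) (auto intro: papprox_poly[OF hol_polys2_const] papprox_mult)

lemma papprox_const: "papprox X (\<lambda>_. k)"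
  by (intro papprox_poly hol_polys2_const)

text \<open>The partial sums of the geometric series in \<open>q\<close> converge uniformly on
  \<open>X\<close>, with remainder at most \<open>B * r ^ N / (1 - r)\<close>. The two resolvent
  lemmas below are instances.\<close>

lemma papprox_geometric:
  assumes X: "compact X" and s: "papprox X s" and q: "papprox X q"
    and r: "r < 1" "\<And>y. y \<in> X \<Longrightarrow> norm (q y) \<le> r"
  shows "papprox X (\<lambda>y. s y / (1 - q y))"
proof (rule papprox_closed)
  fix e :: real assume e: "e > 0"
  obtain B where B: "B > 0" "\<And>y. y \<in> X \<Longrightarrow> norm (s y) \<le> B" using papprox_bounded[OF X s] by auto
  \<comment> \<open>For empty \<open>X\<close> the bound \<open>r\<close> may be negative.\<close>
  have r0: "0 \<le> r \<or> X = {}" using r(2) norm_ge_zero order_trans by blast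
  have "\<exists>N. B * r ^ N / (1 - r) < e \<or> X = {}"
  proof (cases "X = {}")
    case False
    have "(\<lambda>N. B * r ^ N / (1 - r)) \<longlonglongrightarrow> B * 0 / (1 - r)"
      using r0 r(1) False by (intro tendsto_intros LIMSEQ_power_zero) auto
    then have "\<forall>\<^sub>F N in sequentially. B * r ^ N / (1 - r) < e" using e by (intro order_tendstoD(2)) auto
    then show ?thesis using eventually_happens'[OF sequentially_bot] by blast
  qed auto
  then obtain N where N: "B * r ^ N / (1 - r) < e \<or> X = {}" by auto
  show "\<exists>v. papprox X v \<and> (\<forall>y\<in>X. norm (v y - s y / (1 - q y)) < e)"
  proof (intro exI conjI ballI)
    show "papprox X (\<lambda>y. s y * (\<Sum>n<N. q y ^ n))"
      by (intro papprox_mult X s papprox_sum papprox_power q)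
    fix y assume y: "y \<in> X"
    have q1: "1 - r \<le> norm (1 - q y)" using r(2)[OF y] norm_triangle_ineq2[of 1 "q y"] by simp
    have ne: "1 - q y \<noteq> 0" using q1 r(1) by auto
    have "(\<Sum>n<N. q y ^ n) = (1 - q y ^ N) / (1 - q y)" using sum_gp_strict[of "q y" N] ne by auto
    then have "s y * (\<Sum>n<N. q y ^ n) - s y / (1 - q y) = - (s y * q y ^ N / (1 - q y))"
      by (simp add: right_diff_distrib diff_divide_distrib)
    then have "norm (s y * (\<Sum>n<N. q y ^ n) - s y / (1 - q y)) = norm (s y) * norm (q y) ^ N / norm (1 - q y)"
      by (simp add: norm_mult norm_divide norm_power)
    also have "\<dots> \<le> B * r ^ N / (1 - r)"
      using B(2)[OF y] r(2)[OF y] q1 r(1) B(1) r0 y by (intro frac_le mult_mono power_mono) auto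
    also have "\<dots> < e" using N y by auto
    finally show "norm (s y * (\<Sum>n<N. q y ^ n) - s y / (1 - q y)) < e" .
  qed
qed

text \<open>Neumann series about \<open>a\<close>: \<open>1 / (v - b)\<close> is
  \<open>1 / (v - a)\<close> divided by \<open>1 - (b - a) / (v - a)\<close>.\<close>

lemma papprox_resolvent_near:
  assumes X: "compact X" and s: "papprox X (\<lambda>y. 1 / (v y - a))"
    and d: "\<And>y. y \<in> X \<Longrightarrow> d \<le> norm (v y - a)" and b: "norm (b - a) < d"
  shows "papprox X (\<lambda>y. 1 / (v y - b))"
proof -
  have d0: "d > 0" using b norm_ge_zero[of "b-a"] by linarith
  have "papprox X (\<lambda>y. (1 / (v y - a)) / (1 - (b - a) * (1 / (v y - a))))"
  proof (rule papprox_geometric[OF X s])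
    show "papprox X (\<lambda>y. (b - a) * (1 / (v y - a)))" by (intro papprox_mult X s papprox_const)
    show "norm (b - a) / d < 1" using b d0 by simp
    show "norm ((b - a) * (1 / (v y - a))) \<le> norm (b - a) / d" if "y \<in> X" for y
      using d[OF that] d0 by (simp add: norm_mult norm_divide frac_le)
  qed
  moreover have "(1 / (v y - a)) / (1 - (b - a) * (1 / (v y - a))) = 1 / (v y - b)" if "y \<in> X" for y
  proof -
    have "v y - a \<noteq> 0" using d[OF that] d0 by auto
    moreover have "1 - (b - a) * (1 / (v y - a)) = (v y - b) / (v y - a)" using calculation by (simp add: field_simps)
    ultimately show ?thesis by simp
  qed
  ultimately show ?thesis using papprox_cong[of X] by (metis (no_types, lifting))
qed

text \<open>Neumann series at infinity: \<open>1 / (v - b)\<close> is \<open>- 1 / b\<close> divided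
  by \<open>1 - v / b\<close>.\<close>

lemma papprox_resolvent_far:
  assumes X: "compact X" and v: "papprox X v"
    and d: "\<And>y. y \<in> X \<Longrightarrow> norm (v y) \<le> B" and b: "B < norm b"
  shows "papprox X (\<lambda>y. 1 / (v y - b))"
proof (cases "X = {}")
  case False
  then have B0: "B \<ge> 0" using d norm_ge_zero order_trans by blast
  then have b0: "b \<noteq> 0" using b by auto
  have "papprox X (\<lambda>y. (- 1 / b) / (1 - (1 / b) * v y))"
  proof (rule papprox_geometric[OF X papprox_const])
    show "papprox X (\<lambda>y. (1 / b) * v y)" by (intro papprox_mult X v papprox_const)
    show "B / norm b < 1" using b B0 b0 by (simp add: divide_less_eq)
    show "norm ((1 / b) * v y) \<le> B / norm b" if "y \<in> X" for y
      using d[OF that] by (simp add: norm_mult norm_divide divide_right_mono)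
  qed
  moreover have "(- 1 / b) / (1 - (1 / b) * v y) = 1 / (v y - b)" if "y \<in> X" for y
    using b0 by (simp add: field_simps) (metis minus_diff_eq minus_divide_right)
  ultimately show ?thesis using papprox_cong[of X] by (metis (no_types, lifting))
qed (simp add: papprox_def hol_polys2_const exI[of _ "\<lambda>_. 0"] bexI[of _ "\<lambda>_. 0"])

text \<open>For \<open>v\<close> in the uniform closure of the polynomials on \<open>X\<close>,
  these are the points \<open>a\<close> at which \<open>v - a\<close> is invertible in that algebra.
  Values of \<open>v\<close> are excluded explicitly, since the convention \<open>1 / 0 = 0\<close>
  gives the quotient a meaning there too.\<close>

definition resolv :: "(complex \<times> complex) set \<Rightarrow> (complex \<times> complex \<Rightarrow> complex) \<Rightarrow> complex set" where
  "resolv X v = {a. a \<notin> v ` X \<and> papprox X (\<lambda>y. 1 / (v y - a))}"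

text \<open>All points of a small ball about \<open>b\<close> have distance at least
  \<open>d / 2\<close> from the image, and any two differ by less than \<open>d / 2\<close>, so one
  resolvent point in the ball makes the others resolvent. Hence the points off the image split into
  two open sets, and a connected set off the image lies in one of them.\<close>

lemma resolv_near:
  assumes "compact X" "continuous_on X v" "b \<notin> v ` X"
  shows "\<exists>e>0. ball b e \<inter> v ` X = {} \<and> (ball b e \<subseteq> resolv X v \<or> ball b e \<inter> resolv X v = {})"
proof -
  have "open (- (v ` X))" using assms by (intro open_Compl compact_imp_closed compact_continuous_image)
  then obtain d where d: "d > 0" "ball b d \<subseteq> - (v ` X)" using assms(3) by (meson ComplI openE)
  have far: "d / 2 \<le> norm (v y - a)" if "y \<in> X" "a \<in> ball b (d/4)" for y a
  proof -
    have "d \<le> dist b (v y)" using d that(1) by force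
    then show ?thesis using that(2) dist_triangle[of b "v y" a] d(1)
      by (simp add: dist_norm norm_minus_commute)
  qed
  have "a' \<in> resolv X v" if "a \<in> resolv X v" "a \<in> ball b (d/4)" "a' \<in> ball b (d/4)" for a a'
  proof -
    have "norm (a' - a) < d / 2" using that(2,3) dist_triangle2[of a' a b] by (simp add: dist_norm norm_minus_commute)
    moreover have "ball b (d/4) \<subseteq> ball b d" using d(1) by (intro subset_ball) simp
    then have "a' \<notin> v ` X" using d(2) that(3) by blast
    ultimately show ?thesis
      using papprox_resolvent_near[OF assms(1) _ far, where a=a and b=a'] that by (simp add: resolv_def)
  qed
  moreover have "ball b (d/4) \<inter> v ` X = {}"
    using d(2) subset_ball[of "d/4" d b] d(1) by auto
  ultimately show ?thesis using d(1) by (intro exI[of _ "d/4"] conjI) (simp, blast+)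
qed

lemma open_resolv:
  assumes "compact X" "continuous_on X v" shows "open (resolv X v)"
proof (rule openI)
  fix b assume b: "b \<in> resolv X v"
  then have "b \<notin> v ` X" by (simp add: resolv_def)
  from resolv_near[OF assms this] show "\<exists>e>0. ball b e \<subseteq> resolv X v" using b by force
qed

lemma open_Compl_resolv:
  assumes "compact X" "continuous_on X v" shows "open (- (v ` X) - resolv X v)"
proof (rule openI)
  fix b assume b: "b \<in> - (v ` X) - resolv X v"
  then have "b \<notin> v ` X" by simp
  from resolv_near[OF assms this] obtain e where "e > 0" "ball b e \<inter> v ` X = {}" "ball b e \<subseteq> resolv X v \<or> ball b e \<inter> resolv X v = {}" by blast
  then show "\<exists>e>0. ball b e \<subseteq> - (v ` X) - resolv X v" using b by (intro exI[of _ e] conjI) (use centre_in_ball[of b e] in blast)+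
qed

lemma connected_resolv:
  assumes "compact X" "continuous_on X v" "connected C" "C \<inter> v ` X = {}"
  shows "C \<subseteq> resolv X v \<or> C \<inter> resolv X v = {}"
  using connectedD[OF assms(3) open_resolv[OF assms(1,2)] open_Compl_resolv[OF assms(1,2)]] assms(4)
  by blast

lemma resolv_far:
  assumes "compact X" "continuous_on X v" "papprox X v"
  shows "\<exists>B. \<forall>b. norm b > B \<longrightarrow> b \<in> resolv X v"
proof -
  obtain B where "B > 0" "\<And>y. y \<in> X \<Longrightarrow> norm (v y) \<le> B" using papprox_bounded[OF assms(1,3)] by auto
  then show ?thesis using papprox_resolvent_far[OF assms(1,3)] unfolding resolv_def
    by (intro exI[of _ B]) force
qed

lemma resolv_unbounded:
  assumes "compact X" "continuous_on X v" "papprox X v" "connected C" "C \<inter> v ` X = {}" "\<not> bounded C"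
  shows "C \<subseteq> resolv X v"
proof -
  obtain B where B: "\<And>b. norm b > B \<Longrightarrow> b \<in> resolv X v" using resolv_far[OF assms(1-3)] by auto
  obtain b where "b \<in> C" "norm b > B" using assms(6) unfolding bounded_iff by (meson linorder_not_le)
  then show ?thesis using connected_resolv[OF assms(1,2,4,5)] B by blast
qed

section \<open>Polynomial hulls and annihilating functionals\<close>

lemma poly_hull_bound:
  assumes "x \<in> poly_hull K" "K \<noteq> {}" "p \<in> hol_polys2" "\<And>y. y \<in> K \<Longrightarrow> norm (p y) \<le> B"
  shows "norm (p x) \<le> B"
proof -
  have "norm (p x) \<le> Sup ((\<lambda>y. norm (p y)) ` K)" using assms unfolding poly_hull_def by auto
  also have "\<dots> \<le> B" using assms by (intro cSup_least) auto
  finally show ?thesis .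
qed

lemma subset_poly_hull:
  assumes "compact K" shows "K \<subseteq> poly_hull K"
proof
  fix x assume x: "x \<in> K"
  have "norm (p x) \<le> Sup ((\<lambda>y. norm (p y)) ` K)" if "p \<in> hol_polys2" for p
    using x assms continuous_on_hol_polys2[OF that]
    by (intro cSup_upper bounded_imp_bdd_above compact_imp_bounded compact_continuous_image)
       (auto intro!: continuous_intros)
  then show "x \<in> poly_hull K" by (simp add: poly_hull_def)
qed

text \<open>Real Hahn-Banach separation in the sup norm. The surjection \<psi> turns continuous
  functions on \<open>D\<close> into bounded continuous functions on a whole type, which form a
  normed space. The factor 2 comes from estimating the real and imaginary parts of
  \<open>l v\<close> separately.\<close>

lemma papprox_dual:
  fixes \<psi> :: "'x::topological_space \<Rightarrow> complex \<times> complex"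
  assumes D: "compact D" and \<psi>: "continuous_on UNIV \<psi>" "range \<psi> = D"
    and u: "continuous_on D u" "\<not> papprox D u"
  obtains l :: "(complex \<times> complex \<Rightarrow> complex) \<Rightarrow> complex" where
    "\<And>v w. continuous_on D v \<Longrightarrow> continuous_on D w \<Longrightarrow> l (\<lambda>y. v y + w y) = l v + l w"
    "\<And>c v. continuous_on D v \<Longrightarrow> l (\<lambda>y. c * v y) = c * l v"
    "\<And>v B. continuous_on D v \<Longrightarrow> (\<And>y. y \<in> D \<Longrightarrow> norm (v y) \<le> B) \<Longrightarrow> norm (l v) \<le> 2 * B"
    "\<And>p. p \<in> hol_polys2 \<Longrightarrow> l p = 0"
    "l u \<noteq> 0"
proof -
  define B where "B v = Bcontfun (\<lambda>x. v (\<psi> x))" for v :: "complex \<times> complex \<Rightarrow> complex"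
  have Bin: "(\<lambda>x. v (\<psi> x)) \<in> bcontfun" if "continuous_on D v" for v :: "complex \<times> complex \<Rightarrow> complex"
  proof -
    have "continuous_on UNIV (\<lambda>x. v (\<psi> x))"
      using continuous_on_compose2[OF that \<psi>(1)] \<psi>(2) by auto
    moreover have "bounded (v ` D)" by (intro compact_imp_bounded compact_continuous_image that D)
    moreover have "v ` D = range (\<lambda>x. v (\<psi> x))" unfolding \<psi>(2)[symmetric] by (simp add: image_image)
    ultimately show ?thesis by (simp add: bcontfun_def)
  qed
  have Bapp: "apply_bcontfun (B v) x = v (\<psi> x)" if "continuous_on D v" for v x
    unfolding B_def using Bcontfun_inverse[OF Bin[OF that]] by simp
  have Badd: "B (\<lambda>y. v y + w y) = B v + B w" if "continuous_on D v" "continuous_on D w" for v w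
    using that by (intro bcontfun_eqI) (simp add: Bapp continuous_intros)
  have Bscale: "B (\<lambda>y. of_real r * v y) = r *\<^sub>R B v" if "continuous_on D v" for r v
    using that by (intro bcontfun_eqI) (simp add: Bapp continuous_intros scaleR_conv_of_real)
  have Bnorm: "norm (B v) \<le> b" if "continuous_on D v" "\<And>y. y \<in> D \<Longrightarrow> norm (v y) \<le> b" for v b
  proof (rule norm_bound)
    fix x
    have "\<psi> x \<in> D" using \<psi>(2) by auto
    then show "norm (apply_bcontfun (B v) x) \<le> b" using that by (simp add: Bapp)
  qed
  obtain e where e: "e > 0" "\<And>p. p \<in> hol_polys2 \<Longrightarrow> \<exists>y\<in>D. e \<le> norm (p y - u y)"
    using u(2) unfolding papprox_def by (meson linorder_not_le)
  note cp = continuous_on_hol_polys2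
  define S where "S = B ` hol_polys2"
  have "subspace S"
  proof (rule subspaceI)
    have "B (\<lambda>_. 0) = 0" by (intro bcontfun_eqI) (simp add: Bapp)
    then show "0 \<in> S" unfolding S_def using hol_polys2_const[of 0] by (metis imageI)
    show "x + y \<in> S" if "x \<in> S" "y \<in> S" for x y
      using that unfolding S_def by (auto simp: Badd[symmetric] cp intro!: imageI hol_polys2_intros)
    show "c *\<^sub>R x \<in> S" if "x \<in> S" for c x
      using that unfolding S_def by (auto simp: Bscale[symmetric] cp intro!: imageI hol_polys2_intros)
  qed
  moreover have "e \<le> norm (B u - s)" if "s \<in> S" for s
  proof -
    obtain p where p: "p \<in> hol_polys2" "s = B p" using \<open>s \<in> S\<close> unfolding S_def by (elim imageE) simp
    obtain y where y: "y \<in> D" "e \<le> norm (p y - u y)" using e(2)[OF p(1)] by auto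
    then obtain x where "y = \<psi> x" using \<psi>(2) by auto
    then have "apply_bcontfun (B u - s) x = u y - p y" by (simp add: p Bapp u cp)
    then show ?thesis using y norm_bounded[of "B u - s" x] by (simp add: norm_minus_commute)
  qed
  ultimately obtain f where f: "linear f" "\<And>v. \<bar>f v\<bar> \<le> norm v" "\<And>s. s \<in> S \<Longrightarrow> f s = 0" "f (B u) = e"
    using hahn_banach_separation[OF _ e(1), of S "B u"] by blast
  \<comment> \<open>The usual complexification of a real functional, with value
    \<open>f(v) - i f(i v)\<close>; it is complex linear because multiplying twice by
    \<open>\<i>\<close> is multiplying by \<open>-1\<close>.\<close>
  define l where "l v = Complex (f (B v)) (- f (B (\<lambda>y. \<i> * v y)))" for v
  have ladd: "l (\<lambda>y. v y + w y) = l v + l w" if "continuous_on D v" "continuous_on D w" for v w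
    using that by (simp add: l_def Badd continuous_intros distrib_left linear_add[OF f(1)] complex_eq_iff)
  have lreal: "l (\<lambda>y. of_real r * v y) = of_real r * l v" if "continuous_on D v" for r v
  proof -
    have "(\<lambda>y. \<i> * (of_real r * v y)) = (\<lambda>y. of_real r * (\<i> * v y))" by (simp add: mult_ac)
    then show ?thesis
      using that by (simp add: l_def Bscale continuous_intros linear_scale[OF f(1)] complex_eq_iff)
  qed
  have li: "l (\<lambda>y. \<i> * v y) = \<i> * l v" if "continuous_on D v" for v
  proof -
    have "B (\<lambda>y. \<i> * (\<i> * v y)) = B (\<lambda>y. of_real (-1) * v y)" by (simp add: mult.assoc[symmetric])
    also have "\<dots> = (-1) *\<^sub>R B v" by (rule Bscale[OF that])
    finally show ?thesis by (simp add: l_def complex_eq_iff linear_neg[OF f(1)])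
  qed
  show ?thesis
  proof (rule that)
    show "l (\<lambda>y. v y + w y) = l v + l w" if "continuous_on D v" "continuous_on D w" for v w
      using that by (rule ladd)
    show "l (\<lambda>y. c * v y) = c * l v" if v: "continuous_on D v" for c v
    proof -
      have eq: "(\<lambda>y. c * v y) = (\<lambda>y. of_real (Re c) * v y + \<i> * (of_real (Im c) * v y))"
        by (subst complex_eq[of c]) (simp add: algebra_simps)
      have "l (\<lambda>y. c * v y) = of_real (Re c) * l v + \<i> * (of_real (Im c) * l v)"
        unfolding eq using v by (simp add: ladd li lreal continuous_intros)
      also have "\<dots> = (of_real (Re c) + \<i> * of_real (Im c)) * l v" by (simp add: algebra_simps)
      also have "\<dots> = c * l v" by (simp add: complex_eq[symmetric])
      finally show ?thesis .
    qed
    show "norm (l v) \<le> 2 * b" if v: "continuous_on D v" "\<And>y. y \<in> D \<Longrightarrow> norm (v y) \<le> b" for v b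
    proof -
      have "norm (l v) \<le> \<bar>f (B v)\<bar> + \<bar>f (B (\<lambda>y. \<i> * v y))\<bar>"
        unfolding l_def using cmod_le[of "Complex (f (B v)) (- f (B (\<lambda>y. \<i> * v y)))"] by simp
      also have "\<dots> \<le> norm (B v) + norm (B (\<lambda>y. \<i> * v y))" using f(2) by (intro add_mono)
      also have "\<dots> \<le> b + b" using v by (intro add_mono Bnorm) (auto simp: norm_mult intro!: continuous_intros)
      finally show ?thesis by simp
    qed
    show "l p = 0" if "p \<in> hol_polys2" for p
      using that by (simp add: l_def f(3) S_def hol_polys2_intros complex_eq_iff)
    show "l u \<noteq> 0" using f(4) e(1) by (simp add: l_def complex_eq_iff)
  qed
qed

section \<open>Idempotents on a fibre\<close>

lemma winding_number_linepath_split: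
  assumes "c \<in> closed_segment a b" "z \<notin> closed_segment a b"
  shows "winding_number (linepath a b) z = winding_number (linepath a c) z + winding_number (linepath c b) z"
proof -
  have sub: "closed_segment a c \<subseteq> closed_segment a b" "closed_segment c b \<subseteq> closed_segment a b"
    using assms(1) by (auto simp: subset_closed_segment)
  have "continuous_on (closed_segment a b) (\<lambda>w. 1 / (w - z))"
    using assms(2) by (intro continuous_intros) auto
  from contour_integral_split_linepath[OF this assms(1)] show ?thesis
    using assms(2) sub by (subst (1 2 3) winding_number_valid_path) (auto simp: distrib_left add_divide_distrib)
qed

text \<open>The Cauchy integral is replaced by a Riemann sum with the single node \<open>a\<close>.
  The integrand varies by at most \<open>norm (b - a) / (d * d)\<close>, so the error is quadratic
  in the length and becomes negligible when added up over a fine subdivision.\<close>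

lemma winding_number_linepath_approx:
  assumes d: "d > 0" "\<And>w. w \<in> closed_segment a b \<Longrightarrow> d \<le> norm (w - z)"
  shows "norm (winding_number (linepath a b) z - (1 / (2 * pi * \<i>)) * ((b - a) / (a - z))) \<le> (norm (b - a) / d)\<^sup>2"
proof -
  have z: "z \<notin> closed_segment a b" using d by force
  have i1: "((\<lambda>w. 1 / (w - z)) has_contour_integral (contour_integral (linepath a b) (\<lambda>w. 1 / (w - z)))) (linepath a b)"
    using z by (intro has_contour_integral_integral contour_integrable_continuous_linepath continuous_intros) auto
  have "((\<lambda>w. 1 / (w - z) - 1 / (a - z)) has_contour_integral
      (contour_integral (linepath a b) (\<lambda>w. 1 / (w - z)) - (1 / (a - z)) * (b - a))) (linepath a b)"
    by (intro has_contour_integral_diff i1 has_contour_integral_const_linepath)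
  then have "norm (contour_integral (linepath a b) (\<lambda>w. 1 / (w - z)) - (1 / (a - z)) * (b - a)) \<le> (norm (b - a) / (d * d)) * norm (b - a)"
  proof (rule has_contour_integral_bound_linepath)
    show "0 \<le> norm (b - a) / (d * d)" using d by simp
    fix w assume w: "w \<in> closed_segment a b"
    have "norm (1 / (w - z) - 1 / (a - z)) = norm (a - w) / (norm (w - z) * norm (a - z))"
    proof -
      have "w - z \<noteq> 0" "a - z \<noteq> 0" using d(2)[OF w] d(2)[of a] d(1) by auto
      then have "1 / (w - z) - 1 / (a - z) = (a - w) / ((w - z) * (a - z))" by (simp add: divide_simps)
      then show ?thesis by (simp add: norm_divide norm_mult)
    qed
    also have "\<dots> \<le> norm (b - a) / (d * d)"
      using segment_bound[OF w] d(2)[OF w] d(2)[of a] d(1)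
      by (intro frac_le mult_mono) (auto simp: norm_minus_commute)
    finally show "norm (1 / (w - z) - 1 / (a - z)) \<le> norm (b - a) / (d * d)" .
  qed
  then have *: "norm (contour_integral (linepath a b) (\<lambda>w. 1 / (w - z)) - (b - a) / (a - z)) \<le> (norm (b - a) / d)\<^sup>2"
    by (simp add: power2_eq_square)
  have "winding_number (linepath a b) z = (1 / (2 * pi * \<i>)) * contour_integral (linepath a b) (\<lambda>w. 1 / (w - z))"
    using z by (subst winding_number_valid_path) auto
  then have "norm (winding_number (linepath a b) z - (1 / (2 * pi * \<i>)) * ((b - a) / (a - z)))
    = norm (1 / (2 * pi * \<i>)) * norm (contour_integral (linepath a b) (\<lambda>w. 1 / (w - z)) - (b - a) / (a - z))"
    by (simp only: norm_mult[symmetric] right_diff_distrib)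
  also have "\<dots> \<le> 1 * (norm (b - a) / d)\<^sup>2"
  proof (intro mult_mono *)
    show "norm (1 / (2 * pi * \<i>)) \<le> 1" using pi_gt3 by (simp add: norm_divide norm_mult)
  qed auto
  finally show ?thesis by simp
qed

text \<open>Riemann sums of the Cauchy integral are linear combinations of functions
  \<open>1 / (v - s)\<close> with \<open>s\<close> on the segment, and such \<open>s\<close> are
  resolvent points. The path is not closed, so the values are in general not integers.\<close>

lemma papprox_winding_number_linepath:
  assumes X: "compact X" and v: "continuous_on X v"
    and disj: "closed_segment a b \<inter> v ` X = {}" and r: "- (v ` X) \<subseteq> resolv X v"
  shows "papprox X (\<lambda>y. winding_number (linepath a b) (v y))"
proof (rule papprox_closed)
  fix e :: real assume e: "e > 0"
  obtain d where d: "d > 0" "\<And>w y. w \<in> closed_segment a b \<Longrightarrow> y \<in> X \<Longrightarrow> d \<le> norm (w - v y)"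
    using separate_compact_closed[of "closed_segment a b" "v ` X"] disj compact_continuous_image[OF v X]
    by (auto simp: compact_imp_closed dist_norm)
  define c where "c = (norm (b - a) / d)\<^sup>2"
  \<comment> \<open>\<open>N\<close> pieces with error at most \<open>c / N^2\<close> each give a
    total of \<open>c / N\<close>, below \<open>e\<close>.\<close>
  obtain N :: nat where N: "c / e < real N" using reals_Archimedean2 by blast
  have c0: "c \<ge> 0" by (simp add: c_def)
  have N0: "N > 0" using N c0 e by (metis divide_nonneg_pos gr0I not_less of_nat_0)
  define s where "s k = linepath a b (real k / real N)" for k :: nat
  have sseg: "s k \<in> closed_segment a b" if "k \<le> N" for k
    unfolding s_def using that N0 by (auto simp: linepath_in_path)
  have sdiff: "s (Suc k) - s k = (b - a) / of_nat N" for k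
  proof -
    have "s (Suc k) - s k = ((real (Suc k) - real k) / real N) *\<^sub>R (b - a)"
      unfolding s_def linepath_def by (simp add: algebra_simps add_divide_distrib diff_divide_distrib)
    then show ?thesis by (simp add: scaleR_conv_of_real)
  qed
  have s0: "s 0 = a" "s N = b" using N0 by (auto simp: s_def linepath_def)
  have seg: "closed_segment (s k) (s l) \<subseteq> closed_segment a b" if "k \<le> N" "l \<le> N" for k l
    using sseg that by (simp add: subset_closed_segment)
  have split: "winding_number (linepath a (s n)) z = (\<Sum>k<n. winding_number (linepath (s k) (s (Suc k))) z)"
    if "n \<le> N" "z \<notin> closed_segment a b" for n z
    using that(1)
  proof (induction n)
    case 0
    have "z \<noteq> a" using that(2) by auto
    then have "winding_number (linepath a a) z = 0" by (metis winding_number_trivial)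
    then show ?case by (simp only: s0 lessThan_0 sum.empty)
  next
    case (Suc n)
    have sn: "s n \<in> closed_segment a (s (Suc n))"
    proof -
      have "linepath a (linepath a b u) t = linepath a b (t * u)" for u t
        by (simp add: linepath_def algebra_simps)
      moreover have "real n / real (Suc n) * (real (Suc n) / real N) = real n / real N" by simp
      ultimately have "s n = linepath a (s (Suc n)) (real n / real (Suc n))"
        unfolding s_def by metis
      then show ?thesis by (auto simp: linepath_in_path)
    qed
    have "z \<notin> closed_segment a (s (Suc n))" using that(2) seg[of 0 "Suc n"] Suc.prems s0 by auto
    then show ?case using winding_number_linepath_split[OF sn] Suc by simp
  qed
  show "\<exists>u. papprox X u \<and> (\<forall>y\<in>X. norm (u y - winding_number (linepath a b) (v y)) < e)"
  proof (intro exI conjI ballI)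
    let ?u = "\<lambda>y. \<Sum>k<N. (- (1 / (2 * pi * \<i>)) * (s (Suc k) - s k)) * (1 / (v y - s k))"
    show "papprox X ?u"
    proof (intro papprox_sum papprox_mult X papprox_const)
      fix k assume "k \<in> {..<N}"
      then have "s k \<in> - (v ` X)" using sseg[of k] disj by auto
      then show "papprox X (\<lambda>y. 1 / (v y - s k))" using r by (auto simp: resolv_def)
    qed
    fix y assume y: "y \<in> X"
    have nz: "v y \<notin> closed_segment a b" using disj y by auto
    have "norm (winding_number (linepath a b) (v y) - ?u y) =
      norm (\<Sum>k<N. winding_number (linepath (s k) (s (Suc k))) (v y) - (1 / (2 * pi * \<i>)) * ((s (Suc k) - s k) / (s k - v y)))"
    proof -
      have "- (1 / (2 * pi * \<i>)) * (s (Suc k) - s k) * (1 / (v y - s k)) = (1 / (2 * pi * \<i>)) * ((s (Suc k) - s k) / (s k - v y))" for k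
      proof -
        have "1 / (v y - s k) = - (1 / (s k - v y))" by (metis minus_diff_eq minus_divide_right)
        then show ?thesis by simp
      qed
      then show ?thesis using split[of N "v y"] nz s0 by (simp add: sum_subtractf)
    qed
    also have "\<dots> \<le> (\<Sum>k<N. (norm (s (Suc k) - s k) / d)\<^sup>2)"
    proof (intro sum_norm_le winding_number_linepath_approx d)
      show "w \<in> closed_segment a b" if "k \<in> {..<N}" "w \<in> closed_segment (s k) (s (Suc k))" for k w
        using seg[of k "Suc k"] that by auto
    qed (rule y)
    also have "\<dots> = real N * (c / (real N)\<^sup>2)"
      by (simp add: sdiff norm_divide c_def power_divide power_mult_distrib)
    also have "\<dots> = c / real N" using N0 by (simp add: power2_eq_square)
    also have "\<dots> < e" using N N0 e by (simp add: field_simps)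
    finally show "norm (?u y - winding_number (linepath a b) (v y)) < e" by (simp add: norm_minus_commute)
  qed
qed

text \<open>Opposite sides are oriented alike, rightwards and upwards, so that an edge shared by two
  adjacent squares enters with opposite signs.\<close>

lemma winding_number_rectpath_edges:
  assumes "z \<notin> path_image (rectpath a1 a3)"
  defines "a2 \<equiv> Complex (Re a3) (Im a1)" and "a4 \<equiv> Complex (Re a1) (Im a3)"
  shows "winding_number (rectpath a1 a3) z = winding_number (linepath a1 a2) z + winding_number (linepath a2 a3) z
    - winding_number (linepath a4 a3) z - winding_number (linepath a1 a4) z"
proof -
  have z: "z \<notin> closed_segment a1 a2" "z \<notin> closed_segment a2 a3" "z \<notin> closed_segment a3 a4" "z \<notin> closed_segment a4 a1"
    using assms(1) unfolding rectpath_def Let_def a2_def a4_def by (auto simp: path_image_join)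
  have rev: "winding_number (linepath b a) z = - winding_number (linepath a b) z" if "z \<notin> closed_segment a b" for a b
    using winding_number_reversepath[of "linepath a b" z] that by (simp add: reversepath_linepath)
  have "winding_number (rectpath a1 a3) z = winding_number (linepath a1 a2) z + winding_number (linepath a2 a3) z
    + winding_number (linepath a3 a4) z + winding_number (linepath a4 a1) z"
    unfolding rectpath_def Let_def a2_def[symmetric] a4_def[symmetric]
    using z by (simp add: winding_number_join path_image_join)
  moreover have "winding_number (linepath a3 a4) z = - winding_number (linepath a4 a3) z"
    using rev[of a4 a3] z by (simp add: closed_segment_commute)
  moreover have "winding_number (linepath a4 a1) z = - winding_number (linepath a1 a4) z"
    using rev[of a1 a4] z by (simp add: closed_segment_commute)
  ultimately show ?thesis by simp
qed

text \<open>The indicator is the sum of the winding numbers of the grid squares meeting \<open>v ` A\<close>. Edges shared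
  by two such squares cancel, and the remaining edges avoid \<open>v ` X\<close>.\<close>

lemma papprox_indicator:
  assumes X: "compact X" and v: "continuous_on X v"
    and r: "- (v ` X) \<subseteq> resolv X v" and A: "A \<subseteq> X"
    and K: "compact (v ` A)" "compact (v ` (X - A))" "v ` A \<inter> v ` (X - A) = {}"
  shows "papprox X (\<lambda>y. if y \<in> A then 1 else 0)"
proof -
  obtain d0 where d0: "d0 > 0" "\<And>a b. a \<in> v ` A \<Longrightarrow> b \<in> v ` (X - A) \<Longrightarrow> d0 \<le> dist a b"
    using separate_compact_closed[OF K(1) compact_imp_closed[OF K(2)] K(3)] by blast
  \<comment> \<open>Squares of side \<delta> have diameter at most \<open>2 * \<delta> < d0\<close>,
    so none meets both images.\<close>
  define \<delta> where "\<delta> = d0 / 3"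
  have \<delta>: "\<delta> > 0" "2 * \<delta> < d0" using d0 by (auto simp: \<delta>_def)
  define g where "g i j = Complex (of_int i * \<delta>) (of_int j * \<delta>)" for i j :: int
  define Q where "Q i j = cbox (g i j) (g (i+1) (j+1))" for i j
  have inQ: "w \<in> Q i j \<longleftrightarrow> of_int i * \<delta> \<le> Re w \<and> Re w \<le> (of_int i + 1) * \<delta> \<and> of_int j * \<delta> \<le> Im w \<and> Im w \<le> (of_int j + 1) * \<delta>" for w i j
    by (auto simp: Q_def g_def in_cbox_complex_iff)
  have diam: "dist w w' \<le> 2 * \<delta>" if "w \<in> Q i j" "w' \<in> Q i j" for w w' i j
  proof -
    have "\<bar>Re (w - w')\<bar> \<le> \<delta>" "\<bar>Im (w - w')\<bar> \<le> \<delta>" using that by (auto simp: inQ algebra_simps abs_le_iff)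
    then show ?thesis using cmod_le[of "w - w'"] by (simp add: dist_norm)
  qed
  define I where "I = {(i, j). Q i j \<inter> v ` A \<noteq> {}}"
  have finI: "finite I"
  proof -
    obtain B where B: "\<And>w. w \<in> v ` A \<Longrightarrow> norm w \<le> B" using compact_imp_bounded[OF K(1)] by (auto simp: bounded_iff)
    define m where "m = \<lceil>B / \<delta>\<rceil> + 1"
    have "I \<subseteq> {-m..m} \<times> {-m..m}"
    proof clarify
      fix i j assume "(i, j) \<in> I"
      then obtain w where w: "w \<in> Q i j" "norm w \<le> B" using B by (auto simp: I_def)
      have *: "-m \<le> k \<and> k \<le> m" if "of_int k * \<delta> \<le> x" "x \<le> (of_int k + 1) * \<delta>" "\<bar>x\<bar> \<le> B" for k x
      proof -
        have "of_int k \<le> B / \<delta>" "- (B / \<delta>) \<le> of_int k + 1"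
          using that \<delta>(1) by (auto simp: field_simps abs_le_iff)
        then show ?thesis unfolding m_def by linarith
      qed
      show "i \<in> {-m..m} \<and> j \<in> {-m..m}"
        using w *[of i "Re w"] *[of j "Im w"] abs_Re_le_cmod[of w] abs_Im_le_cmod[of w] by (auto simp: inQ)
    qed
    then show ?thesis by (rule finite_subset) auto
  qed
  define wH where "wH i j z = winding_number (linepath (g i j) (g (i+1) j)) z" for i j z
  define wV where "wV i j z = winding_number (linepath (g i j) (g i (j+1))) z" for i j z
  define ch where "ch i j = (if (i, j) \<in> I then 1 else (0::complex))" for i j
  \<comment> \<open>\<open>J\<close> indexes the lower and left edges of the selected squares and,
    through the two shifts, their upper and right edges. In \<open>E\<close> an edge carries the
    difference of the indicators \<open>ch\<close> of the two squares that it bounds.\<close>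
  define J where "J = I \<union> (\<lambda>(i,j). (i, j+1)) ` I \<union> (\<lambda>(i,j). (i+1, j)) ` I"
  have finJ: "finite J" using finI by (simp add: J_def)
  define E where "E z = (\<Sum>(i,j)\<in>J. (ch i j - ch i (j-1)) * wH i j z + (ch (i-1) j - ch i j) * wV i j z)" for z
  have segH: "closed_segment (g i j) (g (i+1) j) \<subseteq> Q i j \<inter> Q i (j-1)" for i j
    unfolding Q_def using \<delta>(1)
    by (intro Int_greatest closed_segment_subset convex_box) (auto simp: in_cbox_complex_iff g_def mult_right_mono)
  have segV: "closed_segment (g i j) (g i (j+1)) \<subseteq> Q i j \<inter> Q (i-1) j" for i j
    unfolding Q_def using \<delta>(1)
    by (intro Int_greatest closed_segment_subset convex_box) (auto simp: in_cbox_complex_iff g_def mult_right_mono)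
  have nearI: "Q i j \<inter> v ` (X - A) = {}" if "(i, j) \<in> I" for i j
  proof (rule ccontr)
    assume "Q i j \<inter> v ` (X - A) \<noteq> {}"
    then obtain b where b: "b \<in> Q i j" "b \<in> v ` (X - A)" by auto
    obtain a where "a \<in> Q i j" "a \<in> v ` A" using \<open>(i,j) \<in> I\<close> by (auto simp: I_def)
    then show False using diam[OF _ b(1)] d0(2)[OF _ b(2)] \<delta>(2) by force
  qed
  have XA: "v ` X = v ` A \<union> v ` (X - A)" using A by auto
  have edge: "S \<inter> v ` X = {}"
    if "S \<subseteq> Q i j \<inter> Q i' j'" "ch i j \<noteq> ch i' j'" for S i j i' j'
  proof -
    consider "(i, j) \<in> I" "(i', j') \<notin> I" | "(i', j') \<in> I" "(i, j) \<notin> I"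
      using \<open>ch i j \<noteq> ch i' j'\<close> by (auto simp: ch_def split: if_splits)
    then have "S \<inter> v ` A = {} \<and> S \<inter> v ` (X - A) = {}"
      by cases (use that(1) nearI in \<open>auto simp: I_def\<close>; blast)+
    then show ?thesis unfolding XA by blast
  qed
  have edgeH: "closed_segment (g i j) (g (i+1) j) \<inter> v ` X = {}" if "ch i j \<noteq> ch i (j-1)" for i j
    by (rule edge[OF segH that])
  have edgeV: "closed_segment (g i j) (g i (j+1)) \<inter> v ` X = {}" if "ch (i-1) j \<noteq> ch i j" for i j
    using edge[OF segV, of i j] that by simp
  have pE: "papprox X (\<lambda>y. E (v y))"
    unfolding E_def
  proof (intro papprox_sum, clarify, intro papprox_add)
    fix i j
    show "papprox X (\<lambda>y. (ch i j - ch i (j-1)) * wH i j (v y))"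
    proof (cases "ch i j = ch i (j-1)")
      case True then show ?thesis by (simp add: papprox_const)
    next
      case False
      then show ?thesis unfolding wH_def
        by (intro papprox_mult X papprox_const papprox_winding_number_linepath v r edgeH)
    qed
    show "papprox X (\<lambda>y. (ch (i-1) j - ch i j) * wV i j (v y))"
    proof (cases "ch (i-1) j = ch i j")
      case True then show ?thesis by (simp add: papprox_const)
    next
      case False
      then show ?thesis unfolding wV_def
        by (intro papprox_mult X papprox_const papprox_winding_number_linepath v r edgeV)
    qed
  qed
  have contE: "isCont E z" if z: "z \<in> v ` X" for z
    unfolding E_def
  proof (intro continuous_sum, clarify, intro continuous_add)
    fix i j
    show "isCont (\<lambda>z. (ch i j - ch i (j-1)) * wH i j z) z"
    proof (cases "ch i j = ch i (j-1)")
      case True then show ?thesis by simp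
    next
      case False
      then have "z \<notin> path_image (linepath (g i j) (g (i+1) j))" using edgeH[of i j] z by auto
      then show ?thesis unfolding wH_def
        by (intro continuous_intros continuous_at_winding_number) auto
    qed
    show "isCont (\<lambda>z. (ch (i-1) j - ch i j) * wV i j z) z"
    proof (cases "ch (i-1) j = ch i j")
      case True then show ?thesis by simp
    next
      case False
      then have "z \<notin> path_image (linepath (g i j) (g i (j+1)))" using edgeV[of i j] z by auto
      then show ?thesis unfolding wV_def
        by (intro continuous_intros continuous_at_winding_number) auto
    qed
  qed
  have Esum: "E z = (\<Sum>(i,j)\<in>I. wH i j z + wV (i+1) j z - wH i (j+1) z - wV i j z)" for z
  proof -
    have inJ: "I \<subseteq> J" by (auto simp: J_def)
    have a: "(\<Sum>(i,j)\<in>J. ch i j * f i j) = (\<Sum>(i,j)\<in>I. f i j)" for f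
      using finJ inJ by (intro sum.mono_neutral_cong_right) (auto simp: ch_def)
    have b: "(\<Sum>(i,j)\<in>J. ch i (j-1) * f i j) = (\<Sum>(i,j)\<in>I. f i (j+1))" for f
    proof -
      have "(\<Sum>(i,j)\<in>J. ch i (j-1) * f i j) = (\<Sum>(i,j)\<in>(\<lambda>(i,j). (i, j+1)) ` I. f i j)"
        using finJ by (intro sum.mono_neutral_cong_right) (force simp: ch_def J_def)+
      also have "\<dots> = (\<Sum>(i,j)\<in>I. f i (j+1))"
        by (subst sum.reindex) (auto simp: inj_on_def case_prod_unfold)
      finally show ?thesis .
    qed
    have c: "(\<Sum>(i,j)\<in>J. ch (i-1) j * f i j) = (\<Sum>(i,j)\<in>I. f (i+1) j)" for f
    proof -
      have "(\<Sum>(i,j)\<in>J. ch (i-1) j * f i j) = (\<Sum>(i,j)\<in>(\<lambda>(i,j). (i+1, j)) ` I. f i j)"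
        using finJ by (intro sum.mono_neutral_cong_right) (force simp: ch_def J_def)+
      also have "\<dots> = (\<Sum>(i,j)\<in>I. f (i+1) j)"
        by (subst sum.reindex) (auto simp: inj_on_def case_prod_unfold)
      finally show ?thesis .
    qed
    have "E z = (\<Sum>(i,j)\<in>J. ch i j * wH i j z) - (\<Sum>(i,j)\<in>J. ch i (j-1) * wH i j z)
      + (\<Sum>(i,j)\<in>J. ch (i-1) j * wV i j z) - (\<Sum>(i,j)\<in>J. ch i j * wV i j z)"
      unfolding E_def sum_subtractf[symmetric] sum.distrib[symmetric]
      by (intro sum.cong refl) (auto simp: algebra_simps)
    also have "\<dots> = (\<Sum>(i,j)\<in>I. wH i j z) - (\<Sum>(i,j)\<in>I. wH i (j+1) z) + (\<Sum>(i,j)\<in>I. wV (i+1) j z) - (\<Sum>(i,j)\<in>I. wV i j z)"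
      by (simp only: a b c)
    also have "\<dots> = (\<Sum>(i,j)\<in>I. wH i j z + wV (i+1) j z - wH i (j+1) z - wV i j z)"
      unfolding sum_subtractf[symmetric] sum.distrib[symmetric]
      by (intro sum.cong refl) (auto simp: algebra_simps)
    finally show ?thesis .
  qed
  have Ebox: "E z = ch i0 j0" if z: "z \<in> box (g i0 j0) (g (i0+1) (j0+1))" for z i0 j0
  proof -
    have zb: "of_int i0 * \<delta> < Re z" "Re z < (of_int i0 + 1) * \<delta>" "of_int j0 * \<delta> < Im z" "Im z < (of_int j0 + 1) * \<delta>"
      using z by (auto simp: g_def in_box_complex_iff)
    have uniq: "k = k0" if "of_int k * \<delta> \<le> x" "x \<le> (of_int k + 1) * \<delta>" "of_int k0 * \<delta> < x" "x < (of_int k0 + 1) * \<delta>" for k k0 :: int and x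
    proof -
      have "of_int k0 * \<delta> < (of_int k + 1) * \<delta>" "of_int k * \<delta> < (of_int k0 + 1) * \<delta>" using that by linarith+
      then have "of_int k0 < (of_int k + 1 :: real)" "of_int k < (of_int k0 + 1 :: real)" using \<delta>(1) by auto
      then show ?thesis by linarith
    qed
    have "wH i j z + wV (i+1) j z - wH i (j+1) z - wV i j z = (if (i, j) = (i0, j0) then 1 else 0)" for i j
    proof -
      have leg: "Re (g i j) \<le> Re (g (i+1) (j+1))" "Im (g i j) \<le> Im (g (i+1) (j+1))"
        using \<delta>(1) by (auto simp: g_def)
      have wn: "z \<notin> path_image (rectpath (g i j) (g (i+1) (j+1))) \<and> winding_number (rectpath (g i j) (g (i+1) (j+1))) z = (if (i, j) = (i0, j0) then 1 else 0)"
      proof (cases "(i, j) = (i0, j0)")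
        case True
        then show ?thesis using z path_image_rectpath_inter_box[OF leg] by (auto simp: winding_number_rectpath)
      next
        case False
        then have "z \<notin> Q i j" using zb uniq by (auto simp: inQ)
        then show ?thesis using path_image_rectpath_subset_cbox[OF leg] leg False
          by (auto simp: Q_def winding_number_rectpath_outside)
      qed
      have "Complex (Re (g (i+1) (j+1))) (Im (g i j)) = g (i+1) j" "Complex (Re (g i j)) (Im (g (i+1) (j+1))) = g i (j+1)"
        by (auto simp: g_def)
      then show ?thesis
        using winding_number_rectpath_edges[of z "g i j" "g (i+1) (j+1)"] wn unfolding wH_def wV_def by simp
    qed
    then have "E z = (\<Sum>p\<in>I. if p = (i0, j0) then 1 else 0)"
      unfolding Esum by (intro sum.cong refl) (auto split: prod.splits)
    then show ?thesis using finI by (simp add: ch_def)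
  qed
  \<comment> \<open>A value of \<open>v\<close> may lie on a grid line. It is reached from the
    interior of any closed square containing it, along the segment to the centre \<open>c\<close>;
    \<open>E\<close> is continuous there because edges with a nonzero coefficient avoid the
    image.\<close>
  have Eval: "E z = ch i0 j0" if z: "z \<in> v ` X" "z \<in> Q i0 j0" for z i0 j0
  proof -
    define c where "c = Complex ((of_int i0 + 1/2) * \<delta>) ((of_int j0 + 1/2) * \<delta>)"
    define t where "t n = inverse (real (Suc n))" for n
    have "(\<lambda>n. z + of_real (t n) * (c - z)) \<longlonglongrightarrow> z + of_real 0 * (c - z)"
      unfolding t_def by (intro tendsto_intros LIMSEQ_inverse_real_of_nat)
    then have lim: "(\<lambda>n. E (z + of_real (t n) * (c - z))) \<longlonglongrightarrow> E z"
      using isCont_tendsto_compose[OF contE[OF z(1)]] by simp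
    have "E (z + of_real (t n) * (c - z)) = ch i0 j0" for n
    proof (rule Ebox)
      have t: "0 < t n" "t n \<le> 1" by (auto simp: t_def divide_simps)
      have *: "k * \<delta> < x + t n * ((k + 1/2) * \<delta> - x) \<and> x + t n * ((k + 1/2) * \<delta> - x) < (k + 1) * \<delta>"
        if "k * \<delta> \<le> x" "x \<le> (k + 1) * \<delta>" for k x
      proof -
        have e: "x + t n * ((k + 1/2) * \<delta> - x) = (1 - t n) * x + t n * ((k + 1/2) * \<delta>)" by (simp add: algebra_simps)
        have a: "(1 - t n) * (k * \<delta>) \<le> (1 - t n) * x" "(1 - t n) * x \<le> (1 - t n) * ((k + 1) * \<delta>)"
          using that t by (auto intro: mult_left_mono)
        have b: "t n * (k * \<delta>) < t n * ((k + 1/2) * \<delta>)" "t n * ((k + 1/2) * \<delta>) < t n * ((k + 1) * \<delta>)"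
          using t \<delta>(1) by auto
        have c: "(1 - t n) * (k * \<delta>) + t n * (k * \<delta>) = k * \<delta>" "(1 - t n) * ((k+1) * \<delta>) + t n * ((k+1) * \<delta>) = (k+1) * \<delta>"
          by (auto simp: algebra_simps)
        show ?thesis unfolding e
          using add_le_less_mono[OF a(1) b(1)] add_le_less_mono[OF a(2) b(2)] unfolding c by blast
      qed
      show "z + of_real (t n) * (c - z) \<in> box (g i0 j0) (g (i0+1) (j0+1))"
        using *[of "of_int i0" "Re z"] *[of "of_int j0" "Im z"] z(2)
        by (auto simp: in_box_complex_iff g_def c_def inQ)
    qed
    then show ?thesis using LIMSEQ_unique[OF lim] tendsto_const by fastforce
  qed
  have "E (v y) = (if y \<in> A then 1 else 0)" if y: "y \<in> X" for y
  proof -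
    define i0 where "i0 = \<lfloor>Re (v y) / \<delta>\<rfloor>"
    define j0 where "j0 = \<lfloor>Im (v y) / \<delta>\<rfloor>"
    have *: "of_int \<lfloor>x / \<delta>\<rfloor> * \<delta> \<le> x \<and> x \<le> (of_int \<lfloor>x / \<delta>\<rfloor> + 1) * \<delta>" for x
    proof -
      have "of_int \<lfloor>x / \<delta>\<rfloor> \<le> x / \<delta>" "x / \<delta> \<le> of_int \<lfloor>x / \<delta>\<rfloor> + 1" by linarith+
      then show ?thesis by (simp only: pos_le_divide_eq[OF \<delta>(1)] pos_divide_le_eq[OF \<delta>(1)] simp_thms)
    qed
    have q: "v y \<in> Q i0 j0" using * by (auto simp: inQ i0_def j0_def)
    have "E (v y) = ch i0 j0" using Eval[OF _ q] y by auto
    also have "\<dots> = (if y \<in> A then 1 else 0)"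
      using q y nearI[of i0 j0] by (auto simp: ch_def I_def)
    finally show ?thesis .
  qed
  then show ?thesis by (rule papprox_cong[THEN iffD1, OF _ pE])
qed

section \<open>Regular plane curves\<close>

text \<open>\<open>G\<close> is the gradient of \<open>h\<close> read as a complex number, so
  \<open>\<i> * G z\<close> is tangent to the level curve. Its differentiability is the second-order
  information that produces tangent discs.\<close>

locale regular_curve =
  fixes h :: "complex \<Rightarrow> real" and G :: "complex \<Rightarrow> complex"
  assumes deriv: "\<And>z. (h has_derivative (\<lambda>v. G z \<bullet> v)) (at z)"
    and G_diff: "\<And>z. G differentiable (at z)"
    and regular: "\<And>z. h z = 0 \<Longrightarrow> G z \<noteq> 0"
begin

definition E where "E = {z. h z = 0}"

lemma G_cont: "isCont G z"
  using G_diff differentiable_imp_continuous_within by blast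

lemma h_cont: "continuous_on S h"
  using deriv by (meson continuous_at_imp_continuous_on has_derivative_continuous)

lemma closed_E: "closed E"
proof -
  have "E = h -` {0}" by (auto simp: E_def)
  then show ?thesis using h_cont[of UNIV] by (metis closed_singleton closed_vimage)
qed

lemma open_pos: "open {z. h z > 0}" and open_neg: "open {z. h z < 0}"
  using h_cont[of UNIV] by (auto intro!: open_Collect_less continuous_on_const)

lemma deriv_line: "DERIV (\<lambda>t. h (z + t *\<^sub>R v)) t :> G (z + t *\<^sub>R v) \<bullet> v"
proof -
  have "((\<lambda>t. h (z + t *\<^sub>R v)) has_derivative (\<lambda>s. G (z + t *\<^sub>R v) \<bullet> (s *\<^sub>R v))) (at t)"
    by (rule has_derivative_compose[OF _ deriv]) (auto intro!: derivative_eq_intros)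
  then show ?thesis by (simp add: has_field_derivative_def mult.commute[of _ "G (z + t *\<^sub>R v) \<bullet> v"])
qed

lemma regular_curve_uminus: "regular_curve (\<lambda>z. - h z) (\<lambda>z. - G z)"
proof
  show "((\<lambda>z. - h z) has_derivative (\<lambda>v. - G z \<bullet> v)) (at z)" for z
    using has_derivative_minus[OF deriv[of z]] by simp
qed (use G_diff regular in auto)

lemma transversal:
  assumes "z0 \<in> E"
  obtains r where "r > 0" "\<And>z. z \<in> ball z0 r \<Longrightarrow> G z \<bullet> G z0 > 0"
proof -
  have "G z0 \<bullet> G z0 > 0" using regular assms by (simp add: E_def)
  moreover have "isCont (\<lambda>z. G z \<bullet> G z0) z0" by (intro continuous_intros G_cont)
  ultimately have "\<forall>\<^sub>F z in at z0. G z \<bullet> G z0 > 0"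
    unfolding isCont_def by (rule order_tendstoD(1)[rotated])
  then obtain r where "r > 0" "\<And>z. z \<noteq> z0 \<Longrightarrow> dist z z0 < r \<Longrightarrow> G z \<bullet> G z0 > 0"
    unfolding eventually_at by auto
  then show ?thesis using that[of r] \<open>G z0 \<bullet> G z0 > 0\<close> by (metis dist_commute mem_ball)
qed

lemma increasing_along:
  assumes "\<And>z. z \<in> ball z0 r \<Longrightarrow> G z \<bullet> n > 0" and "z \<in> ball z0 r" "z + t *\<^sub>R n \<in> ball z0 r" "t > 0"
  shows "h z < h (z + t *\<^sub>R n)"
proof -
  have "z + s *\<^sub>R n \<in> ball z0 r" if "0 \<le> s" "s \<le> t" for s
  proof -
    have "(1 - s / t) *\<^sub>R z + (s / t) *\<^sub>R (z + t *\<^sub>R n) \<in> ball z0 r"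
      using assms that by (intro convexD[OF convex_ball]) auto
    moreover have "(1 - s / t) *\<^sub>R z + (s / t) *\<^sub>R (z + t *\<^sub>R n) = z + s *\<^sub>R n"
      using assms(4) by (simp add: algebra_simps)
    ultimately show ?thesis by simp
  qed
  then have "h (z + 0 *\<^sub>R n) < h (z + t *\<^sub>R n)"
    using assms(4) by (intro DERIV_pos_imp_increasing[of 0 t "\<lambda>t. h (z + t *\<^sub>R n)"]) (auto intro!: exI deriv_line assms(1))
  then show ?thesis by simp
qed

lemma small_shift:
  fixes n :: complex
  assumes "e > 0" obtains t where "t > 0" "norm (t *\<^sub>R n) < e"
proof (rule that[of "e / (norm n + 1)"])
  show "e / (norm n + 1) > 0" using assms by (simp add: add_nonneg_pos)
  have "norm n < norm n + 1" by simp
  then have "e * norm n < e * (norm n + 1)" using assms by simp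
  then show "norm ((e / (norm n + 1)) *\<^sub>R n) < e"
    using assms by (simp add: divide_less_eq add_nonneg_pos mult.commute)
qed

text \<open>Near \<open>z0\<close> the function increases along \<open>n = G z0\<close>, so each
  point of the positive side can be pushed along \<open>n\<close>, without leaving that side, into a
  fixed ball about \<open>c\<close>. A connected set squeezed between two one-sided neighbourhoods
  replaces the claim that one of them is connected.\<close>

lemma pos_side:
  assumes z0: "z0 \<in> E" and e: "e > 0"
  shows "\<exists>d>0. \<exists>P. open P \<and> connected P \<and> P \<subseteq> ball z0 e \<inter> {z. h z > 0} \<and> ball z0 d \<inter> {z. h z > 0} \<subseteq> P"
proof -
  obtain r where r: "r > 0" "\<And>z. z \<in> ball z0 r \<Longrightarrow> G z \<bullet> G z0 > 0" using transversal[OF z0] by blast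
  define n where "n = G z0"
  define e' where "e' = min e r"
  have e': "e' > 0" "e' \<le> e" "e' \<le> r" using e r by (auto simp: e'_def)
  have Gn: "\<And>z. z \<in> ball z0 e' \<Longrightarrow> G z \<bullet> n > 0" using r(2) e'(3) by (auto simp: n_def)
  obtain t where t: "t > 0" "norm (t *\<^sub>R n) < e' / 2" using small_shift[of "e'/2"] e' by auto
  define c where "c = z0 + t *\<^sub>R n"
  have cb: "c \<in> ball z0 e'" using t e' by (simp add: c_def dist_norm)
  have "h z0 < h c" unfolding c_def
    using e' t cb by (intro increasing_along[of z0 e'] Gn) (auto simp: c_def)
  then have hc: "h c > 0" using z0 by (simp add: E_def)
  define W where "W = ball z0 e' \<inter> {z. h z > 0}"
  have oW: "open W" unfolding W_def by (intro open_Int open_ball open_pos)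
  obtain q where q: "q > 0" "ball c q \<subseteq> W" using oW cb hc unfolding W_def by (metis (mono_tags, lifting) IntI mem_Collect_eq openE)
  define P where "P = connected_component_set W c"
  define d where "d = min q (e' / 2)"
  have "ball z0 d \<inter> {z. h z > 0} \<subseteq> P"
  proof
    fix z assume z: "z \<in> ball z0 d \<inter> {z. h z > 0}"
    have in1: "z + s *\<^sub>R n \<in> ball z0 e'" if "0 \<le> s" "s \<le> t" for s
    proof -
      have "norm (s *\<^sub>R n) \<le> norm (t *\<^sub>R n)" using that t by (simp add: mult_right_mono)
      moreover have "dist z0 z < e' / 2" using z by (simp add: d_def)
      ultimately show ?thesis using t(2) dist_triangle[of z0 "z + s *\<^sub>R n" z] by (simp add: dist_norm)
    qed
    have in2: "z + s *\<^sub>R n \<in> W" if s: "0 \<le> s" "s \<le> t" for s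
    proof (cases "s = 0")
      case False
      then have "h z < h (z + s *\<^sub>R n)" using in1[of 0] in1[OF s] s t by (intro increasing_along[of z0 e'] Gn) auto
      then show ?thesis using in1[OF s] z by (auto simp: W_def)
    qed (use z in1[of 0] t in \<open>auto simp: W_def\<close>)
    have "z + t *\<^sub>R n \<in> ball c q" using z by (simp add: c_def d_def dist_norm)
    have "connected ((\<lambda>s. z + s *\<^sub>R n) ` {0..t})"
      by (intro connected_continuous_image continuous_intros) auto
    then have "connected ((\<lambda>s. z + s *\<^sub>R n) ` {0..t} \<union> ball c q)"
    proof (rule connected_Un)
      have "z + t *\<^sub>R n \<in> (\<lambda>s. z + s *\<^sub>R n) ` {0..t}" using t by auto
      then show "(\<lambda>s. z + s *\<^sub>R n) ` {0..t} \<inter> ball c q \<noteq> {}" using \<open>z + t *\<^sub>R n \<in> ball c q\<close> by blast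
    qed auto
    moreover have "(\<lambda>s. z + s *\<^sub>R n) ` {0..t} \<union> ball c q \<subseteq> W" using in2 q by auto
    moreover have "z \<in> (\<lambda>s. z + s *\<^sub>R n) ` {0..t} \<union> ball c q" using t by (auto intro!: image_eqI[of _ _ 0])
    moreover have "c \<in> (\<lambda>s. z + s *\<^sub>R n) ` {0..t} \<union> ball c q" using q by auto
    ultimately show "z \<in> P" unfolding P_def connected_component_def mem_Collect_eq by blast
  qed
  moreover have "P \<subseteq> ball z0 e \<inter> {z. h z > 0}"
    using connected_component_subset[of W c] e'(2) by (auto simp: P_def W_def)
  moreover have "open P" "connected P" unfolding P_def by (auto intro: open_connected_component oW)
  ultimately show ?thesis using q e' by (intro exI[of _ d] exI[of _ P]) (auto simp: d_def)
qed

lemma pos_adherent: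
  assumes "z0 \<in> E" "e > 0" shows "\<exists>z\<in>ball z0 e. h z > 0"
proof -
  obtain r where r: "r > 0" "\<And>z. z \<in> ball z0 r \<Longrightarrow> G z \<bullet> G z0 > 0" using transversal[OF assms(1)] by blast
  obtain t where t: "t > 0" "norm (t *\<^sub>R G z0) < min e r" using small_shift[of "min e r"] r assms(2) by auto
  have "h z0 < h (z0 + t *\<^sub>R G z0)" using r t by (intro increasing_along[of z0 r]) (auto simp: dist_norm)
  then show ?thesis using t assms(1) by (intro bexI[of _ "z0 + t *\<^sub>R G z0"]) (auto simp: E_def dist_norm)
qed

text \<open>Differentiability of \<open>G\<close> at \<open>z0\<close> bounds the change of
  \<open>G\<close> by a multiple of the distance, and the mean value theorem turns this into a
  quadratic error for \<open>h\<close>.\<close>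

lemma taylor_bound:
  assumes z0: "z0 \<in> E"
  obtains C r where "C > 0" "r > 0" "\<And>v. norm v < r \<Longrightarrow> \<bar>h (z0 + v) - G z0 \<bullet> v\<bar> \<le> C * (norm v)\<^sup>2"
proof -
  obtain G' where G': "(G has_derivative G') (at z0)" using G_diff by (auto simp: differentiable_def)
  obtain K where K: "\<And>u. norm (G' u) \<le> norm u * K" "K > 0"
    using bounded_linear.pos_bounded[OF has_derivative_bounded_linear[OF G']] by blast
  obtain r where r: "r > 0" "\<And>y. norm (y - z0) < r \<Longrightarrow> norm (G y - G z0 - G' (y - z0)) \<le> 1 * norm (y - z0)"
    using G' unfolding has_derivative_at_alt by (meson zero_less_one)
  have lip: "norm (G y - G z0) \<le> (K + 1) * norm (y - z0)" if "norm (y - z0) < r" for y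
    using r(2)[OF that] K(1)[of "y - z0"] norm_triangle_ineq2[of "G y - G z0" "G' (y - z0)"] by (simp add: algebra_simps)
  show ?thesis
  proof (rule that[of "K + 1" r])
    fix v :: complex assume v: "norm v < r"
    have "\<And>t. DERIV (\<lambda>t. h (z0 + t *\<^sub>R v) - t * (G z0 \<bullet> v)) t :> G (z0 + t *\<^sub>R v) \<bullet> v - G z0 \<bullet> v"
      by (auto intro!: derivative_eq_intros deriv_line)
    from MVT2[of 0 1, OF _ this] obtain t where t: "0 < t" "t < 1"
      "h (z0 + v) - G z0 \<bullet> v - h z0 = (G (z0 + t *\<^sub>R v) - G z0) \<bullet> v"
      by (auto simp: inner_diff_left)
    have tv: "norm (t *\<^sub>R v) \<le> norm v" using t mult_left_le_one_le[of "norm v" t] by simp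
    have "\<bar>(G (z0 + t *\<^sub>R v) - G z0) \<bullet> v\<bar> \<le> norm (G (z0 + t *\<^sub>R v) - G z0) * norm v"
      by (rule Cauchy_Schwarz_ineq2)
    also have "\<dots> \<le> ((K + 1) * norm v) * norm v"
    proof (intro mult_right_mono norm_ge_zero)
      have "norm (G (z0 + t *\<^sub>R v) - G z0) \<le> (K + 1) * norm (t *\<^sub>R v)" using lip[of "z0 + t *\<^sub>R v"] tv v by simp
      also have "\<dots> \<le> (K + 1) * norm v" using tv K by (intro mult_left_mono) auto
      finally show "norm (G (z0 + t *\<^sub>R v) - G z0) \<le> (K + 1) * norm v" .
    qed
    finally show "\<bar>h (z0 + v) - G z0 \<bullet> v\<bar> \<le> (K + 1) * (norm v)\<^sup>2"
      using t(3) z0 by (simp add: E_def power2_eq_square)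
  qed (use K r in auto)
qed

text \<open>The inequality \<open>norm (v - s n) \<le> norm (s n)\<close> means
  \<open>norm v ^ 2 \<le> 2 s (n \<bullet> v)\<close>, so for small \<open>s\<close> the linear term
  of \<open>h\<close> dominates on the closed disc about \<open>c\<close> away from
  \<open>z0\<close>. Thus \<open>z0\<close> is the only point of \<open>E\<close> nearest to
  \<open>c\<close>, which makes \<open>1 / (z - c)\<close> peak there.\<close>

lemma tangent_disc:
  assumes z0: "z0 \<in> E" and e: "e > 0"
  shows "\<exists>c\<in>ball z0 e. c \<noteq> z0 \<and> h c > 0 \<and> (\<forall>z\<in>E - {z0}. dist z0 c < dist z c)"
proof -
  obtain C r where C: "C > 0" "r > 0" "\<And>v. norm v < r \<Longrightarrow> \<bar>h (z0 + v) - G z0 \<bullet> v\<bar> \<le> C * (norm v)\<^sup>2"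
    using taylor_bound[OF z0] by metis
  define n where "n = G z0"
  have n0: "n \<noteq> 0" using regular z0 by (simp add: n_def E_def)
  obtain t where t: "t > 0" "norm (t *\<^sub>R n) < min e (r / 2)" using small_shift[of "min e (r/2)"] e C by auto
  \<comment> \<open>The bound \<open>1 / (4 * C)\<close> gives \<open>C * s \<le> 1 / 4\<close>, so
    on the disc the quadratic error is at most half of the linear term.\<close>
  define s where "s = min t (1 / (4 * C))"
  have s: "s > 0" "s \<le> t" "s \<le> 1 / (4 * C)" using t C by (auto simp: s_def)
  have sn: "norm (s *\<^sub>R n) < min e (r / 2)"
    using t s mult_right_mono[OF s(2), of "norm n"] by simp
  define c where "c = z0 + s *\<^sub>R n"
  have key: "h z > 0" if z: "z \<noteq> z0" "dist z c \<le> dist z0 c" for z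
  proof -
    define v where "v = z - z0"
    have v0: "v \<noteq> 0" using z by (simp add: v_def)
    have vs: "norm (v - s *\<^sub>R n) \<le> norm (s *\<^sub>R n)" using z(2) by (simp add: v_def c_def dist_norm algebra_simps)
    then have "(norm (v - s *\<^sub>R n))\<^sup>2 \<le> (norm (s *\<^sub>R n))\<^sup>2" by (intro power_mono) auto
    moreover have "(norm (v - s *\<^sub>R n))\<^sup>2 = (norm v)\<^sup>2 - 2 * s * (n \<bullet> v) + (norm (s *\<^sub>R n))\<^sup>2"
      unfolding power2_norm_eq_inner by (simp add: inner_diff_left inner_diff_right inner_commute algebra_simps)
    ultimately have q: "(norm v)\<^sup>2 \<le> 2 * s * (n \<bullet> v)" by linarith
    have "norm v \<le> norm (v - s *\<^sub>R n) + norm (s *\<^sub>R n)" using norm_triangle_ineq[of "v - s *\<^sub>R n" "s *\<^sub>R n"] by simp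
    then have "norm v < r" using vs sn by linarith
    from C(3)[OF this] have "h z \<ge> n \<bullet> v - C * (norm v)\<^sup>2" by (simp add: v_def n_def abs_le_iff)
    moreover have "C * (norm v)\<^sup>2 \<le> (1 / 2) * (n \<bullet> v)"
    proof -
      have nv: "n \<bullet> v \<ge> 0" using q s(1) by (smt (verit) mult_pos_neg zero_le_power2)
      have "C * (norm v)\<^sup>2 \<le> C * (2 * s * (n \<bullet> v))" using q C by simp
      also have "\<dots> = (C * s) * (2 * (n \<bullet> v))" by simp
      also have "\<dots> \<le> (1 / 4) * (2 * (n \<bullet> v))"
      proof (intro mult_right_mono)
        show "C * s \<le> 1 / 4" using s(3) C(1) by (simp add: field_simps)
      qed (use nv in simp)
      finally show ?thesis by simp
    qed
    moreover have "n \<bullet> v > 0" using q s(1) v0 by (smt (verit) mult_nonneg_nonpos zero_less_norm_iff zero_less_power)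
    ultimately show ?thesis by linarith
  qed
  have "c \<noteq> z0" using s n0 by (simp add: c_def)
  moreover have "h c > 0" using key[of c] \<open>c \<noteq> z0\<close> by simp
  moreover have "dist z0 c < dist z c" if "z \<in> E - {z0}" for z
    using key[of z] that by (force simp: E_def)
  moreover have "c \<in> ball z0 e" using sn by (simp add: c_def dist_norm)
  ultimately show ?thesis by blast
qed

section \<open>A tangential coordinate on the curve\<close>

lemma frame: "(norm n)\<^sup>2 *\<^sub>R w = (n \<bullet> w) *\<^sub>R n + ((\<i> * n) \<bullet> w) *\<^sub>R (\<i> * n)"
  for n w :: complex
  by (simp add: complex_eq_iff inner_complex_def cmod_power2) (simp add: algebra_simps power2_eq_square)

text \<open>Expansion of \<open>w\<close> in the orthogonal basis \<open>g\<close>,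
  \<open>\<i> * g\<close>, paired with \<open>\<i> * n\<close>. For \<open>g\<close> the gradient
  and \<open>w\<close> tangent to the curve the first term drops out, and pairing with
  \<open>\<i> * n\<close> becomes a multiple of pairing with \<open>\<i> * g\<close>.\<close>

lemma inner_frame: "(\<i> * n) \<bullet> w * (norm g)\<^sup>2 = (g \<bullet> w) * ((\<i> * n) \<bullet> g) + ((\<i> * g) \<bullet> w) * (n \<bullet> g)"
  for n w g :: complex
  by (simp add: inner_complex_def cmod_power2) (simp add: algebra_simps power2_eq_square)

text \<open>The last clause says that \<open>dS\<close> restricted to the curve is the form \<open>v \<mapsto> (\<i> * G) \<bullet> v\<close>, so that
  \<open>S \<circ> f\<close> is a local primitive of its pullback under any \<open>f\<close> into the curve.\<close>

definition coordinate :: "complex \<Rightarrow> real \<Rightarrow> (complex \<Rightarrow> real) \<Rightarrow> bool" where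
  "coordinate z0 r S \<longleftrightarrow> r > 0 \<and> S z0 = 0 \<and> continuous_on (E \<inter> ball z0 r) S \<and>
    (\<forall>e>0. \<exists>z\<in>E \<inter> ball z0 e. S z > 0) \<and>
    (\<forall>f f' (x::complex) K. x \<in> K \<longrightarrow> f x \<in> E \<inter> ball z0 r \<longrightarrow> (f has_derivative f') (at x within K) \<longrightarrow>
      (\<forall>v. G (f x) \<bullet> f' v = 0) \<longrightarrow>
      ((\<lambda>x. S (f x)) has_derivative (\<lambda>v. (\<i> * G (f x)) \<bullet> f' v)) (at x within K))"

text \<open>The curve is a graph over its tangent line at \<open>z0\<close>: \<open>Y\<close> is the
  coordinate along that line, up to scale, and \<open>c\<close> its inverse on the curve. By
  \<open>inner_frame\<close> the form given by \<open>\<i> * G\<close> is \<open>m\<close> times the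
  differential of \<open>Y\<close> along the curve, so a primitive \<sigma> of \<open>m\<close>
  along \<open>c\<close> yields the coordinate.\<close>

lemma coordinate_exists:
  assumes z0: "z0 \<in> E"
  shows "\<exists>r S. coordinate z0 r S"
proof -
  obtain r0 where r0: "r0 > 0" "\<And>z. z \<in> ball z0 r0 \<Longrightarrow> G z \<bullet> G z0 > 0" using transversal[OF z0] by blast
  define n where "n = G z0"
  have n0: "n \<noteq> 0" using regular z0 by (simp add: n_def E_def)
  have Gn: "\<And>z. z \<in> ball z0 r0 \<Longrightarrow> G z \<bullet> n > 0" using r0 by (simp add: n_def)
  define r1 where "r1 = r0 / 2"
  have r1: "r1 > 0" "cball z0 r1 \<subseteq> ball z0 r0" using r0 by (auto simp: r1_def)
  define Y where "Y z = (\<i> * n) \<bullet> (z - z0)" for z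
  have Ycont: "continuous_on S Y" for S unfolding Y_def by (intro continuous_intros)
  define K0 where "K0 = E \<inter> cball z0 r1"
  have K0: "compact K0" unfolding K0_def by (intro closed_Int_compact closed_E compact_cball)
  \<comment> \<open>Points with equal \<open>Y\<close> differ by a multiple of \<open>n\<close>,
    along which \<open>h\<close> is strictly increasing.\<close>
  have injY: "inj_on Y K0"
  proof (rule inj_onI)
    fix z w assume zw: "z \<in> K0" "w \<in> K0" "Y z = Y w"
    define t where "t = (n \<bullet> (w - z)) / (norm n)\<^sup>2"
    have "(\<i> * n) \<bullet> (w - z) = 0" using zw(3) by (simp add: Y_def inner_diff_right)
    then have "(norm n)\<^sup>2 *\<^sub>R (w - z) = (n \<bullet> (w - z)) *\<^sub>R n" using frame[of n "w - z"] by simp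
    then have "(1 / (norm n)\<^sup>2) *\<^sub>R ((norm n)\<^sup>2 *\<^sub>R (w - z)) = t *\<^sub>R n" by (simp add: t_def)
    then have w: "w = z + t *\<^sub>R n" using n0 by (simp add: algebra_simps)
    have b: "z \<in> ball z0 r0" "w \<in> ball z0 r0" and hz: "h z = 0" "h w = 0"
      using zw r1 by (auto simp: K0_def E_def)
    have "\<not> t > 0" using increasing_along[of z0 r0 n z t, OF Gn] b hz w by auto
    moreover have "\<not> t < 0" using increasing_along[of z0 r0 n w "-t", OF Gn] b hz w by auto
    ultimately show "z = w" using w by simp
  qed
  define c where "c = inv_into K0 Y"
  have cY: "c (Y z) = z" if "z \<in> K0" for z unfolding c_def using injY that by (rule inv_into_f_f)
  have ccont: "continuous_on (Y ` K0) c"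
    by (rule continuous_on_inv[OF Ycont K0]) (auto simp: cY)
  obtain t where t: "t > 0" "norm (t *\<^sub>R n) < r1 / 2" using small_shift[of "r1/2"] r1 by auto
  have hp: "h (z0 + t *\<^sub>R n) > 0" "h (z0 + (-t) *\<^sub>R n) < 0"
  proof -
    have b: "z0 + t *\<^sub>R n \<in> ball z0 r0" "z0 + (-t) *\<^sub>R n \<in> ball z0 r0" using t r1_def r0 by (auto simp: dist_norm)
    show "h (z0 + t *\<^sub>R n) > 0" using increasing_along[of z0 r0 n z0 t, OF Gn] b t r0 z0 by (simp add: E_def)
    show "h (z0 + (-t) *\<^sub>R n) < 0" using increasing_along[of z0 r0 n "z0 + (-t) *\<^sub>R n" t, OF Gn] b t r0 z0 by (simp add: E_def)
  qed
  obtain q where q: "q > 0" "ball (z0 + t *\<^sub>R n) q \<subseteq> {z. h z > 0}" "ball (z0 + (-t) *\<^sub>R n) q \<subseteq> {z. h z < 0}"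
  proof -
    obtain q1 where q1: "q1 > 0" "ball (z0 + t *\<^sub>R n) q1 \<subseteq> {z. h z > 0}"
      using open_pos hp(1) by (metis mem_Collect_eq openE)
    obtain q2 where q2: "q2 > 0" "ball (z0 + (-t) *\<^sub>R n) q2 \<subseteq> {z. h z < 0}"
      using open_neg hp(2) by (metis mem_Collect_eq openE)
    show ?thesis by (rule that[of "min q1 q2"]) (use q1 q2 in auto)
  qed
  \<comment> \<open>For \<open>\<bar>y\<bar> \<le> y0\<close> the displacement \<open>p\<close>
    along the tangent line is shorter than \<open>q\<close>, so \<open>h\<close> keeps opposite
    signs at the two normal shifts, and shorter than \<open>r1 / 2\<close>, so the zero between them
    stays in the closed ball.\<close>
  define y0 where "y0 = min q (r1 / 2) * norm n / 2"
  have nn: "norm n > 0" using n0 by simp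
  have y0: "y0 > 0" using q(1) r1(1) nn by (simp add: y0_def)
  have range: "\<exists>z\<in>K0. Y z = y" if y: "\<bar>y\<bar> \<le> y0" for y
  proof -
    define p where "p = (y / (norm n)\<^sup>2) *\<^sub>R (\<i> * n)"
    have "norm p = \<bar>y\<bar> / norm n" using nn by (simp add: p_def norm_mult power2_eq_square)
    also have "\<dots> \<le> y0 / norm n" using y nn by (simp add: divide_right_mono)
    also have "\<dots> < min q (r1 / 2)" using nn q(1) r1(1) by (auto simp: y0_def)
    finally have p: "norm p < q" "norm p < r1 / 2" by auto
    have "h (z0 + p + t *\<^sub>R n) > 0" "h (z0 + p + (-t) *\<^sub>R n) < 0"
    proof -
      have "z0 + p + t *\<^sub>R n \<in> ball (z0 + t *\<^sub>R n) q" "z0 + p + (-t) *\<^sub>R n \<in> ball (z0 + (-t) *\<^sub>R n) q"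
        using p(1) by (auto simp: dist_norm algebra_simps)
      then show "h (z0 + p + t *\<^sub>R n) > 0" "h (z0 + p + (-t) *\<^sub>R n) < 0" using q by blast+
    qed
    then have "\<exists>s\<ge>-t. s \<le> t \<and> h (z0 + p + s *\<^sub>R n) = 0"
      using t(1) by (intro IVT) (auto intro!: DERIV_isCont deriv_line)
    then obtain s where s: "-t \<le> s" "s \<le> t" "h (z0 + p + s *\<^sub>R n) = 0" by auto
    have "norm (s *\<^sub>R n) \<le> norm (t *\<^sub>R n)" using s by (auto intro!: mult_right_mono)
    then have "norm (p + s *\<^sub>R n) \<le> r1" using norm_triangle_ineq[of p "s *\<^sub>R n"] t(2) p(2) by linarith
    then have "z0 + p + s *\<^sub>R n \<in> K0" using s(3) norm_minus_cancel[of "p + s *\<^sub>R n"] by (simp add: K0_def E_def dist_norm algebra_simps)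
    moreover have "Y (z0 + p + s *\<^sub>R n) = y"
    proof -
      have "(\<i> * n) \<bullet> n = 0" by (simp add: inner_complex_def)
      moreover have "(\<i> * n) \<bullet> (\<i> * n) = (norm n)\<^sup>2" by (simp add: power2_norm_eq_inner[symmetric] norm_mult)
      ultimately show ?thesis using nn by (simp add: Y_def p_def inner_add_right add.assoc)
    qed
    ultimately show ?thesis by blast
  qed
  have cK: "c y \<in> K0" "Y (c y) = y" if "\<bar>y\<bar> \<le> y0" for y
    using range[OF that] cY by auto
  have sub: "{-y0..y0} \<subseteq> Y ` K0"
  proof
    fix y assume "y \<in> {-y0..y0}"
    then have "\<bar>y\<bar> \<le> y0" by auto
    from range[OF this] show "y \<in> Y ` K0" by auto
  qed
  define m where "m z = (norm (G z))\<^sup>2 / (G z \<bullet> n)" for z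
  have mpos: "m z > 0" if "z \<in> K0" for z
  proof -
    have "G z \<bullet> n > 0" "G z \<noteq> 0" using Gn[of z] that r1 regular[of z] by (auto simp: K0_def E_def)
    then show ?thesis by (simp add: m_def)
  qed
  have mcont: "continuous_on K0 m"
  proof -
    have "continuous_on K0 G" using G_cont by (auto intro: continuous_at_imp_continuous_on)
    moreover have "G z \<bullet> n \<noteq> 0" if "z \<in> K0" for z using Gn[of z] that r1 by (force simp: K0_def)
    ultimately show ?thesis unfolding m_def by (intro continuous_intros) auto
  qed
  have mc: "continuous_on {-y0..y0} (\<lambda>y. m (c y))"
    by (rule continuous_on_compose2[OF mcont continuous_on_subset[OF ccont sub]]) (use cK in auto)
  \<comment> \<open>The difference of integrals is the primitive that vanishes at \<open>0\<close>,
    defined on both sides of it.\<close>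
  define \<sigma> where "\<sigma> y = integral {-y0..y} (\<lambda>y. m (c y)) - integral {-y0..0} (\<lambda>y. m (c y))" for y
  have \<sigma>': "(\<sigma> has_real_derivative m (c y)) (at y)" if y: "\<bar>y\<bar> < y0" for y
  proof -
    have "((\<lambda>y. integral {-y0..y} (\<lambda>y. m (c y))) has_real_derivative m (c y)) (at y within {-y0..y0})"
      using y by (intro integral_has_real_derivative mc) auto
    moreover have "at y within {-y0..y0} = at y" using y by (intro at_within_interior) auto
    ultimately show ?thesis unfolding \<sigma>_def by (auto intro!: derivative_eq_intros)
  qed
  obtain r2 where r2: "r2 > 0" "\<And>z. z \<in> ball z0 r2 \<Longrightarrow> \<bar>Y z\<bar> < y0"
  proof (rule that[of "y0 / norm n"])
    show "y0 / norm n > 0" using y0 nn by simp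
    fix z assume "z \<in> ball z0 (y0 / norm n)"
    then have "norm n * norm (z - z0) < y0" using nn by (simp add: dist_norm norm_minus_commute pos_less_divide_eq mult.commute)
    then show "\<bar>Y z\<bar> < y0" using Cauchy_Schwarz_ineq2[of "\<i> * n" "z - z0"] by (simp add: Y_def norm_mult)
  qed
  define r where "r = min r1 r2"
  have rE: "z \<in> K0" "\<bar>Y z\<bar> < y0" if "z \<in> E \<inter> ball z0 r" for z
    using that r2(2) by (auto simp: r_def K0_def)
  have "coordinate z0 r (\<lambda>z. \<sigma> (Y z))"
    unfolding coordinate_def
  proof (intro conjI allI impI)
    show "r > 0" using r1 r2 by (simp add: r_def)
    show "\<sigma> (Y z0) = 0" by (simp add: \<sigma>_def Y_def)
    have "continuous_on {-y0<..<y0} \<sigma>"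
      by (intro continuous_at_imp_continuous_on ballI DERIV_isCont[OF \<sigma>']) auto
    then show "continuous_on (E \<inter> ball z0 r) (\<lambda>z. \<sigma> (Y z))"
      by (rule continuous_on_compose2[OF _ Ycont]) (use rE in \<open>force simp: abs_less_iff\<close>)
    show "\<exists>z\<in>E \<inter> ball z0 e. \<sigma> (Y z) > 0" if e: "e > 0" for e
    proof -
      have c0: "c 0 = z0" using cY[of z0] z0 r1 by (simp add: K0_def Y_def)
      have "continuous_on {-y0..y0} c" by (rule continuous_on_subset[OF ccont sub])
      then obtain d where d: "d > 0" "\<And>y. y \<in> {-y0..y0} \<Longrightarrow> dist y 0 < d \<Longrightarrow> dist (c y) (c 0) < e"
        using y0 e unfolding continuous_on_iff by (metis atLeastAtMost_iff less_imp_le neg_le_0_iff_le)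
      define y where "y = min (d / 2) (y0 / 2)"
      have y: "0 < y" "y < d" "y < y0" using d y0 by (auto simp: y_def)
      have "\<sigma> 0 < \<sigma> y"
      proof (rule DERIV_pos_imp_increasing[OF y(1)])
        fix x assume "0 \<le> x" "x \<le> y"
        then show "\<exists>D. (\<sigma> has_real_derivative D) (at x) \<and> 0 < D"
          using \<sigma>'[of x] mpos[OF cK(1)[of x]] y by auto
      qed
      then have "\<sigma> (Y (c y)) > 0" using cK(2)[of y] y by (simp add: \<sigma>_def)
      moreover have "c y \<in> E \<inter> ball z0 e" using cK(1)[of y] d(2)[of y] y c0 by (auto simp: K0_def dist_commute)
      ultimately show ?thesis by blast
    qed
    fix f :: "complex \<Rightarrow> complex" and f' x K
    assume x: "x \<in> K" "f x \<in> E \<inter> ball z0 r" and f': "(f has_derivative f') (at x within K)"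
      and perp: "\<forall>v. G (f x) \<bullet> f' v = 0"
    have "((\<lambda>x. Y (f x)) has_derivative (\<lambda>v. (\<i> * n) \<bullet> f' v)) (at x within K)"
      unfolding Y_def by (auto intro!: derivative_eq_intros f')
    from has_derivative_compose[OF this, of \<sigma> "\<lambda>s. m (c (Y (f x))) * s"] \<sigma>'[OF rE(2)[OF x(2)]]
    have "((\<lambda>x. \<sigma> (Y (f x))) has_derivative (\<lambda>v. m (f x) * ((\<i> * n) \<bullet> f' v))) (at x within K)"
      using cY[OF rE(1)[OF x(2)]] by (simp add: has_field_derivative_def)
    moreover have "m (f x) * ((\<i> * n) \<bullet> f' v) = (\<i> * G (f x)) \<bullet> f' v" for v
    proof -
      have "G (f x) \<bullet> n > 0" using Gn[of "f x"] rE(1)[OF x(2)] r1 by (auto simp: K0_def)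
      then show ?thesis using inner_frame[of n "f' v" "G (f x)"] perp
        by (simp add: m_def field_simps inner_commute)
    qed
    ultimately show "((\<lambda>x. \<sigma> (Y (f x))) has_derivative (\<lambda>v. (\<i> * G (f x)) \<bullet> f' v)) (at x within K)" by simp
  qed
  then show ?thesis by blast
qed

end

section \<open>Discs over a plane curve\<close>

text \<open>At a boundary point only the directions \<open>y - x\<close> into the disc are
  controlled: there the difference quotients lie in \<open>L\<close>, which is closed. These
  directions suffice, since every vector is a multiple of a difference of two of them.\<close>

lemma derivative_in_subspace:
  fixes F :: "complex \<Rightarrow> 'b::euclidean_space"
  assumes F: "(F has_derivative A) (at x)" and x: "x \<in> cball 0 1" and r: "r > 0"
    and L: "subspace L" and FL: "\<And>y. y \<in> cball 0 1 \<Longrightarrow> dist x y < r \<Longrightarrow> F y - F x \<in> L"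
  shows "A v \<in> L"
proof -
  have lin: "linear A" using F has_derivative_linear by blast
  have 1: "A (y - x) \<in> L" if y: "y \<in> cball 0 1" for y
  proof -
    have "\<exists>l\<in>L. dist l (A (y - x)) < e" if e: "e > 0" for e
    proof -
      define v where "v = y - x"
      define e' where "e' = e / (2 * (norm v + 1))"
      have e': "e' > 0" "e' * norm v < e"
      proof -
        have nv: "norm v + 1 > 0" by (simp add: add_nonneg_pos)
        have nv2: "norm v < 2 * (norm v + 1)" using add_nonneg_pos[of "norm v" 2] by (simp add: distrib_left)
        show "e' > 0" unfolding e'_def by (intro divide_pos_pos mult_pos_pos e nv) simp
        have "e' * norm v = (e * norm v) / (2 * (norm v + 1))" by (simp add: e'_def)
        also have "\<dots> < e"
        proof -
          have "e * norm v < e * (2 * (norm v + 1))" using e nv by (intro mult_strict_left_mono nv2) simp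
          then show ?thesis using nv by (simp add: pos_divide_less_eq)
        qed
        finally show "e' * norm v < e" .
      qed
      obtain d where d: "d > 0" "\<And>y. norm (y - x) < d \<Longrightarrow> norm (F y - F x - A (y - x)) \<le> e' * norm (y - x)"
        using F e'(1) unfolding has_derivative_at_alt by blast
      define t where "t = min 1 (min d r / (2 * (norm v + 1)))"
      have t: "0 < t" "t \<le> 1" "t * norm v < d" "t * norm v < r"
      proof -
        have nv: "norm v + 1 > 0" by (simp add: add_nonneg_pos)
        have nv2: "norm v < 2 * (norm v + 1)" using add_nonneg_pos[of "norm v" 2] by (simp add: distrib_left)
        have "0 < min d r / (2 * (norm v + 1))" using d r by (intro divide_pos_pos mult_pos_pos nv) auto
        then show "0 < t" "t \<le> 1" by (auto simp: t_def)
        have "t * norm v \<le> min d r / (2 * (norm v + 1)) * norm v" by (intro mult_right_mono) (auto simp: t_def)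
        also have "\<dots> < min d r"
        proof -
          have "min d r * norm v < min d r * (2 * (norm v + 1))" using d r by (intro mult_strict_left_mono nv2) simp
          moreover have "2 * (norm v + 1) > 0" using nv by simp
          ultimately have "min d r * norm v / (2 * (norm v + 1)) < min d r" by (simp only: pos_divide_less_eq)
          then show ?thesis by simp
        qed
        finally show "t * norm v < d" "t * norm v < r" by auto
      qed
      define p where "p = x + t *\<^sub>R v"
      have "p = (1 - t) *\<^sub>R x + t *\<^sub>R y" by (simp add: p_def v_def algebra_simps)
      then have pc: "p \<in> cball 0 1" using convexD[OF convex_cball x y, of "1 - t" t] t by auto
      have "dist x p < r" using t by (simp add: p_def dist_norm)
      then have "F p - F x \<in> L" using FL pc by blast
      then have l: "(1/t) *\<^sub>R (F p - F x) \<in> L" using L by (simp add: subspace_scale)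
      have "norm (F p - F x - A (t *\<^sub>R v)) \<le> e' * norm (t *\<^sub>R v)"
        using d(2)[of p] t by (simp add: p_def)
      then have "norm ((1/t) *\<^sub>R (F p - F x - A (t *\<^sub>R v))) \<le> (1/t) * (e' * (t * norm v))"
        using t by (simp add: pos_divide_le_eq mult_ac)
      moreover have "(1/t) *\<^sub>R (F p - F x - A (t *\<^sub>R v)) = (1/t) *\<^sub>R (F p - F x) - A v"
        using t by (simp add: linear_scale[OF lin] scaleR_diff_right)
      ultimately have "dist ((1/t) *\<^sub>R (F p - F x)) (A v) < e" using t e' by (simp add: dist_norm)
      then show ?thesis using l by (auto simp: v_def)
    qed
    then have "A (y - x) \<in> closure L" by (simp add: closure_approachable)
    then show ?thesis using closed_subspace[OF L] by simp
  qed
  define e where "e = 1 / (norm v + 1)"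
  have nv: "norm v + 1 > 0" by (simp add: add_nonneg_pos)
  then have e: "e > 0" "e * norm v \<le> 1" by (auto simp: e_def pos_divide_le_eq)
  have "e *\<^sub>R v \<in> cball 0 1" using e by simp
  then have "A (e *\<^sub>R v - x) - A (0 - x) \<in> L" using 1[of "e *\<^sub>R v"] 1[of 0] by (intro subspace_diff[OF L]) simp_all
  then have "(1/e) *\<^sub>R A (e *\<^sub>R v) \<in> L" using L by (simp add: linear_diff[OF lin, symmetric] subspace_scale)
  then show ?thesis using e by (simp add: linear_scale[OF lin])
qed

text \<open>The primitive is the sum of increments of local primitives along the subdivided ray from
  \<open>0\<close> to \<open>x\<close>. On a common convex region two local primitives differ by a
  constant, so the increments do not depend on the one chosen; no derivative of \<alpha>
  enters.\<close>

lemma locally_exact_imp_exact: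
  fixes K :: "'a::euclidean_space set" and \<alpha> :: "'a \<Rightarrow> 'a \<Rightarrow> real"
  assumes K: "compact K" "convex K" "0 \<in> K"
    and loc: "\<And>x. x \<in> K \<Longrightarrow> \<exists>e>0. \<exists>u. \<forall>y\<in>K \<inter> ball x e. (u has_derivative \<alpha> y) (at y within K)"
  shows "\<exists>g. \<forall>y\<in>K. (g has_derivative \<alpha> y) (at y within K)"
proof -
  define \<B> where "\<B> = {B. open B \<and> (\<exists>u. \<forall>y\<in>K \<inter> B. (u has_derivative \<alpha> y) (at y within K))}"
  have KB: "K \<subseteq> \<Union>\<B>"
  proof
    fix x assume "x \<in> K"
    from loc[OF this] obtain e u where e: "e > 0" "\<forall>y\<in>K \<inter> ball x e. (u has_derivative \<alpha> y) (at y within K)"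
      by blast
    then have "ball x e \<in> \<B>" by (auto simp: \<B>_def)
    have "x \<in> ball x e" using e(1) by simp
    then show "x \<in> \<Union>\<B>" using \<open>ball x e \<in> \<B>\<close> by blast
  qed
  have op: "\<And>B. B \<in> \<B> \<Longrightarrow> open B" by (simp add: \<B>_def)
  obtain \<epsilon> where \<epsilon>: "\<epsilon> > 0" "\<And>x. x \<in> K \<Longrightarrow> \<exists>B\<in>\<B>. ball x \<epsilon> \<subseteq> B"
    using Heine_Borel_lemma[OF K(1) KB op] by metis
  then have "\<forall>x\<in>K. \<exists>u. \<forall>y\<in>K \<inter> ball x \<epsilon>. (u has_derivative \<alpha> y) (at y within K)"
    unfolding \<B>_def by blast
  then obtain U where "\<forall>x\<in>K. \<forall>y\<in>K \<inter> ball x \<epsilon>. (U x has_derivative \<alpha> y) (at y within K)"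
    unfolding bchoice_iff by blast
  then have U: "\<And>x y. x \<in> K \<Longrightarrow> y \<in> K \<Longrightarrow> dist x y < \<epsilon> \<Longrightarrow> (U x has_derivative \<alpha> y) (at y within K)"
    by simp
  have incr: "U x y - U x z = U x' y - U x' z"
    if "x \<in> K" "x' \<in> K" "y \<in> K" "z \<in> K" "dist x y < \<epsilon>" "dist x z < \<epsilon>" "dist x' y < \<epsilon>" "dist x' z < \<epsilon>" for x x' y z
  proof -
    let ?C = "K \<inter> ball x \<epsilon> \<inter> ball x' \<epsilon>"
    have "U x y - U x' y = U x z - U x' z"
    proof (rule has_derivative_zero_unique[of ?C "\<lambda>y. U x y - U x' y"])
      show "convex ?C" by (intro convex_Int K convex_ball)
      fix p assume p: "p \<in> ?C"
      have "((\<lambda>y. U x y - U x' y) has_derivative (\<lambda>h. \<alpha> p h - \<alpha> p h)) (at p within K)"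
        using p that by (intro has_derivative_diff U) auto
      then have "((\<lambda>y. U x y - U x' y) has_derivative (\<lambda>h. 0)) (at p within K)" by simp
      then show "((\<lambda>y. U x y - U x' y) has_derivative (\<lambda>h. 0)) (at p within ?C)"
        by (rule has_derivative_subset) auto
    qed (use that in auto)
    then show ?thesis by simp
  qed
  obtain B where B: "B > 0" "\<And>x. x \<in> K \<Longrightarrow> norm x \<le> B" using compact_imp_bounded[OF K(1)] by (auto simp: bounded_pos)
  obtain N :: nat where N: "4 * B / \<epsilon> < real N" using reals_Archimedean2 by blast
  have N0: "N > 0" using N B \<epsilon> by (metis divide_pos_pos gr0I mult_pos_pos not_less_iff_gr_or_eq of_nat_0 zero_less_numeral)
  have BN: "B / real N < \<epsilon> / 4" using N N0 \<epsilon> by (simp add: field_simps)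
  define t where "t k = real k / real N" for k
  have t0: "t 0 = 0" "t N = 1" using N0 by (auto simp: t_def)
  have tK: "t k *\<^sub>R x \<in> K" if "k \<le> N" "x \<in> K" for k x
    using convexD[OF K(2) that(2) K(3), of "t k" "1 - t k"] that(1) N0 by (simp add: t_def divide_simps)
  have step: "dist (t k *\<^sub>R x) (t (Suc k) *\<^sub>R x) < \<epsilon> / 4" if "x \<in> K" for k x
  proof -
    have "dist (t k *\<^sub>R x) (t (Suc k) *\<^sub>R x) = norm (t (Suc k) *\<^sub>R x - t k *\<^sub>R x)" by (simp add: dist_norm norm_minus_commute)
    also have "\<dots> = norm ((t (Suc k) - t k) *\<^sub>R x)" by (simp only: scaleR_diff_left)
    also have "t (Suc k) - t k = 1 / real N" by (simp add: t_def diff_divide_distrib[symmetric])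
    also have "norm ((1 / real N) *\<^sub>R x) = norm x / real N" by simp
    also have "\<dots> \<le> B / real N" using B that by (simp add: divide_right_mono)
    finally show ?thesis using BN by linarith
  qed
  have shrink: "dist (t k *\<^sub>R x) (t k *\<^sub>R y) \<le> dist x y" if "k \<le> N" for k and x y :: 'a
  proof -
    have "dist (t k *\<^sub>R x) (t k *\<^sub>R y) = norm (t k *\<^sub>R (x - y))" by (simp add: dist_norm scaleR_diff_right)
    also have "\<dots> \<le> dist x y" using that N0 mult_right_mono[of "t k" 1 "norm (x - y)"] by (simp add: dist_norm t_def)
    finally show ?thesis .
  qed
  define g where "g x = (\<Sum>k<N. U (t k *\<^sub>R x) (t (Suc k) *\<^sub>R x) - U (t k *\<^sub>R x) (t k *\<^sub>R x))" for x
  have "(g has_derivative \<alpha> x0) (at x0 within K)" if x0: "x0 \<in> K" for x0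
  proof -
    \<comment> \<open>Passing from \<open>x0\<close> to \<open>x\<close> changes the
      \<open>k\<close>-th increment by \<open>A (Suc k) - A k\<close>, and the sum telescopes to the
      increment of the single primitive \<open>U x0\<close>. Steps and displacement below
      \<open>\<epsilon> / 4\<close> keep the four corners involved within \<epsilon> of each
      other.\<close>
    have eq: "U x0 x - U x0 x0 + g x0 = g x" if x: "x \<in> K" "dist x x0 < \<epsilon> / 4" for x
    proof -
      define A where "A k = U (t k *\<^sub>R x0) (t k *\<^sub>R x) - U (t k *\<^sub>R x0) (t k *\<^sub>R x0)" for k
      have "(U (t k *\<^sub>R x) (t (Suc k) *\<^sub>R x) - U (t k *\<^sub>R x) (t k *\<^sub>R x)) -
          (U (t k *\<^sub>R x0) (t (Suc k) *\<^sub>R x0) - U (t k *\<^sub>R x0) (t k *\<^sub>R x0)) = A (Suc k) - A k" if k: "k < N" for k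
      proof -
        have kk: "k \<le> N" "Suc k \<le> N" using k by auto
        note m = tK[OF kk(1) x(1)] tK[OF kk(2) x(1)] tK[OF kk(1) x0] tK[OF kk(2) x0]
        have d1: "dist (t k *\<^sub>R x) (t k *\<^sub>R x0) < \<epsilon> / 4" "dist (t (Suc k) *\<^sub>R x) (t (Suc k) *\<^sub>R x0) < \<epsilon> / 4"
          using shrink[OF kk(1), of x x0] shrink[OF kk(2), of x x0] x(2) by linarith+
        note d2 = step[OF x(1), of k] step[OF x0, of k]
        have "dist (t k *\<^sub>R x0) (t (Suc k) *\<^sub>R x) < \<epsilon>"
          using dist_triangle_le[of "t k *\<^sub>R x0" "t k *\<^sub>R x" "t (Suc k) *\<^sub>R x" "\<epsilon>/2"] d1(1) d2(1) \<epsilon>(1)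
          by (simp add: dist_commute)
        moreover have "dist (t (Suc k) *\<^sub>R x0) (t (Suc k) *\<^sub>R x) < \<epsilon>" using d1 \<epsilon>(1) by (simp add: dist_commute)
        ultimately have "U (t k *\<^sub>R x) (t (Suc k) *\<^sub>R x) - U (t k *\<^sub>R x) (t k *\<^sub>R x)
            = U (t k *\<^sub>R x0) (t (Suc k) *\<^sub>R x) - U (t k *\<^sub>R x0) (t k *\<^sub>R x)"
          "U (t k *\<^sub>R x0) (t (Suc k) *\<^sub>R x) - U (t k *\<^sub>R x0) (t (Suc k) *\<^sub>R x0)
            = U (t (Suc k) *\<^sub>R x0) (t (Suc k) *\<^sub>R x) - U (t (Suc k) *\<^sub>R x0) (t (Suc k) *\<^sub>R x0)"
          using d1 d2 \<epsilon>(1) by (intro incr m; simp add: dist_commute)+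
        then show ?thesis by (simp add: A_def)
      qed
      then have "g x - g x0 = (\<Sum>k<N. A (Suc k) - A k)"
        unfolding g_def sum_subtractf[symmetric] by (intro sum.cong) auto
      also have "\<dots> = A N - A 0" by (rule sum_lessThan_telescope)
      finally show ?thesis using t0 by (simp add: A_def)
    qed
    have "((\<lambda>x. U x0 x - U x0 x0 + g x0) has_derivative \<alpha> x0) (at x0 within K)"
      using U[OF x0 x0] \<epsilon>(1) by (auto intro!: derivative_eq_intros)
    then show ?thesis
      by (rule has_derivative_transform_within[where d = "\<epsilon>/4"]) (use eq \<epsilon>(1) x0 in auto)
  qed
  then show ?thesis by blast
qed

lemma (in regular_curve) coordinateD:
  fixes f :: "complex \<Rightarrow> complex"
  assumes "coordinate z0 r S" "x \<in> K" "f x \<in> E \<inter> ball z0 r" "(f has_derivative f') (at x within K)"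
    "\<And>v. G (f x) \<bullet> f' v = 0"
  shows "((\<lambda>x. S (f x)) has_derivative (\<lambda>v. (\<i> * G (f x)) \<bullet> f' v)) (at x within K)"
  using assms(1)[unfolded coordinate_def, THEN conjunct2, THEN conjunct2, THEN conjunct2, THEN conjunct2,
      rule_format, of x K f f'] assms(2-) by simp

locale disc_on_curve = regular_curve h G for h G +
  fixes f :: "complex \<Rightarrow> complex" and f' :: "complex \<Rightarrow> complex \<Rightarrow> complex"
  assumes f': "\<And>x. x \<in> cball 0 1 \<Longrightarrow> (f has_derivative f' x) (at x)"
    and f'_nonzero: "\<And>x. x \<in> cball 0 1 \<Longrightarrow> \<exists>v. f' x v \<noteq> 0"
    and f_E: "f ` cball 0 1 \<subseteq> E"
begin

text \<open>The pullback under \<open>f\<close> of the tangential form along the curve.\<close>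

definition \<alpha> where "\<alpha> x v = (\<i> * G (f x)) \<bullet> f' x v"

lemma f_cont: "continuous_on (cball 0 1) f"
  using f' by (meson continuous_at_imp_continuous_on has_derivative_continuous)

lemma h_f: "x \<in> cball 0 1 \<Longrightarrow> h (f x) = 0"
  using f_E unfolding E_def by blast

text \<open>The composite of \<open>h\<close> and \<open>f\<close> is known to vanish only on the
  closed disc, so boundary points are handled by \<open>derivative_in_subspace\<close> with
  \<open>L = {0}\<close>.\<close>

lemma tangential:
  assumes x: "x \<in> cball 0 1" shows "G (f x) \<bullet> f' x v = 0"
proof -
  have d: "((\<lambda>x. h (f x)) has_derivative (\<lambda>v. G (f x) \<bullet> f' x v)) (at x)"
    by (rule has_derivative_compose[OF f'[OF x] deriv])
  have "(\<lambda>v. G (f x) \<bullet> f' x v) v \<in> {0}"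
  proof (rule derivative_in_subspace[OF d x zero_less_one])
    show "h (f y) - h (f x) \<in> {0}" if "y \<in> cball 0 1" for y
      using h_f[OF x] h_f[OF that] by simp
  qed simp
  then show ?thesis by simp
qed

lemma \<alpha>_nonzero:
  assumes x: "x \<in> cball 0 1" shows "\<exists>v. \<alpha> x v \<noteq> 0"
proof -
  obtain v where v: "f' x v \<noteq> 0" using f'_nonzero[OF x] by blast
  have "G (f x) \<noteq> 0" using regular h_f[OF x] by simp
  then have "\<alpha> x v \<noteq> 0"
    using frame[of "G (f x)" "f' x v"] tangential[OF x, of v] v by (auto simp: \<alpha>_def)
  then show ?thesis by blast
qed

lemma coordinate_derivative:
  assumes "coordinate z0 r S" and "x \<in> cball 0 1" "f x \<in> ball z0 r"
  shows "((\<lambda>x. S (f x)) has_derivative \<alpha> x) (at x within cball 0 1)"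
proof -
  have "((\<lambda>x. S (f x)) has_derivative (\<lambda>v. (\<i> * G (f x)) \<bullet> f' x v)) (at x within cball 0 1)"
    using assms(3) f_E assms(2)
    by (intro coordinateD[OF assms(1,2) _ has_derivative_at_withinI[OF f'[OF assms(2)]] tangential[OF assms(2)]]) auto
  then show ?thesis by (simp add: \<alpha>_def[abs_def])
qed

lemma nearby:
  assumes "x \<in> cball 0 1" "f x \<in> ball z0 r"
  obtains e where "e > 0" "\<And>y. y \<in> cball 0 1 \<Longrightarrow> dist x y < e \<Longrightarrow> f y \<in> ball z0 r"
proof -
  have "r - dist z0 (f x) > 0" using assms by simp
  then obtain e where e: "e > 0" "\<And>y. y \<in> cball 0 1 \<Longrightarrow> dist y x < e \<Longrightarrow> dist (f y) (f x) < r - dist z0 (f x)"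
    using f_cont assms(1) unfolding continuous_on_iff by blast
  show ?thesis
  proof (rule that[OF e(1)])
    show "f y \<in> ball z0 r" if "y \<in> cball 0 1" "dist x y < e" for y
      using e(2)[of y] that dist_triangle[of z0 "f y" "f x"] by (simp add: dist_commute)
  qed
qed

lemma lift_exists: "\<exists>g. \<forall>x\<in>cball 0 1. (g has_derivative \<alpha> x) (at x within cball 0 1)"
proof (rule locally_exact_imp_exact)
  fix x :: complex assume x: "x \<in> cball 0 1"
  then have "f x \<in> E" using f_E by auto
  obtain r S where S: "coordinate (f x) r S" using coordinate_exists[OF \<open>f x \<in> E\<close>] by blast
  then have r: "r > 0" by (simp add: coordinate_def)
  obtain e where e: "e > 0" "\<And>y. y \<in> cball 0 1 \<Longrightarrow> dist x y < e \<Longrightarrow> f y \<in> ball (f x) r"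
    using nearby[OF x, of "f x" r] r by auto
  show "\<exists>e>0. \<exists>u. \<forall>y\<in>cball 0 1 \<inter> ball x e. (u has_derivative \<alpha> y) (at y within cball 0 1)"
    using e by (intro exI[of _ e] exI[of _ "\<lambda>y. S (f y)"] conjI ballI coordinate_derivative[OF S]) auto
qed auto

definition lift where "lift = (SOME g. \<forall>x\<in>cball 0 1. (g has_derivative \<alpha> x) (at x within cball 0 1))"

lemma lift: "x \<in> cball 0 1 \<Longrightarrow> (lift has_derivative \<alpha> x) (at x within cball 0 1)"
  unfolding lift_def using someI_ex[OF lift_exists] by blast

lemma lift_cont: "continuous_on (cball 0 1) lift"
  unfolding continuous_on_eq_continuous_within by (intro ballI has_derivative_continuous[OF lift])

text \<open>Both \<open>lift\<close> and the composite of \<open>S\<close> with \<open>f\<close>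
  have differential \<alpha>, so their difference is locally constant; a compact preimage is covered
  by finitely many balls of constancy. The values in \<open>T\<close> label the sheets.\<close>

lemma sheets:
  assumes z0: "z0 \<in> E"
  shows "\<exists>r S T. r > 0 \<and> S z0 = 0 \<and> continuous_on (E \<inter> ball z0 r) S \<and>
    (\<forall>e>0. \<exists>z\<in>E \<inter> ball z0 e. S z > 0) \<and> finite T \<and>
    (\<forall>x\<in>cball 0 1. f x \<in> ball z0 r \<longrightarrow> lift x - S (f x) \<in> T)"
proof -
  obtain r S where S: "coordinate z0 r S" using coordinate_exists[OF z0] by blast
  then have r: "r > 0" and S1: "S z0 = 0" "continuous_on (E \<inter> ball z0 r) S"
    "\<And>e. e > 0 \<Longrightarrow> \<exists>z\<in>E \<inter> ball z0 e. S z > 0" by (auto simp: coordinate_def)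
  \<comment> \<open>The halved radius provides a compact preimage of a closed ball around which
    \<open>S\<close> is still available.\<close>
  define K1 where "K1 = {x \<in> cball 0 1. f x \<in> cball z0 (r/2)}"
  have "closedin (top_of_set (cball 0 1)) K1"
    using continuous_closedin_preimage[OF f_cont, of "cball z0 (r/2)"] by (simp add: K1_def vimage_def Int_def)
  then have K1: "compact K1" using closedin_compact compact_cball by blast
  have "\<exists>e>0. \<forall>y \<in> cball 0 1. dist x y < e \<longrightarrow> f y \<in> ball z0 r" if "x \<in> K1" for x
  proof -
    have x: "x \<in> cball 0 1" "f x \<in> ball z0 r" using that r by (auto simp: K1_def)
    show ?thesis by (rule nearby[OF x]) blast
  qed
  then obtain e where e: "\<And>x. x \<in> K1 \<Longrightarrow> e x > 0" "\<And>x y. x \<in> K1 \<Longrightarrow> y \<in> cball 0 1 \<Longrightarrow> dist x y < e x \<Longrightarrow> f y \<in> ball z0 r"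
    by metis
  have const: "lift y - S (f y) = lift x - S (f x)" if x: "x \<in> K1" and y: "y \<in> cball 0 1" "dist x y < e x" for x y
  proof (rule has_derivative_zero_unique[of "cball 0 1 \<inter> ball x (e x)" "\<lambda>y. lift y - S (f y)"])
    show "convex (cball 0 1 \<inter> ball x (e x))" by (intro convex_Int convex_cball convex_ball)
    fix p assume p: "p \<in> cball 0 1 \<inter> ball x (e x)"
    have "((\<lambda>y. lift y - S (f y)) has_derivative (\<lambda>v. \<alpha> p v - \<alpha> p v)) (at p within cball 0 1)"
      using p e(2)[OF x] by (intro has_derivative_diff lift coordinate_derivative[OF S]) auto
    then have "((\<lambda>y. lift y - S (f y)) has_derivative (\<lambda>v. 0)) (at p within cball 0 1)" by simp
    then show "((\<lambda>y. lift y - S (f y)) has_derivative (\<lambda>v. 0)) (at p within cball 0 1 \<inter> ball x (e x))"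
      by (rule has_derivative_subset) auto
  qed (use x y e(1)[OF x] in \<open>auto simp: K1_def\<close>)
  have "K1 \<subseteq> (\<Union>x\<in>K1. ball x (e x))" using e(1) by force
  from compactE_image[OF K1 _ this] obtain X where X: "X \<subseteq> K1" "finite X" "K1 \<subseteq> (\<Union>x\<in>X. ball x (e x))" by auto
  show ?thesis
  proof (rule exI[of _ "r/2"], rule exI[of _ S], rule exI[of _ "(\<lambda>x. lift x - S (f x)) ` X"], intro conjI ballI impI allI)
    show "continuous_on (E \<inter> ball z0 (r / 2)) S" using r by (intro continuous_on_subset[OF S1(2)]) auto
    fix y :: complex assume y: "y \<in> cball 0 1" "f y \<in> ball z0 (r/2)"
    then have "y \<in> K1" by (auto simp: K1_def)
    then obtain x where "x \<in> X" "dist x y < e x" using X(3) by auto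
    then show "lift y - S (f y) \<in> (\<lambda>x. lift x - S (f x)) ` X" using const[of x y] X(1) y by auto
  qed (use r S1 X in auto)
qed

lemma compact_level: "compact {x \<in> cball 0 1. f x = z \<and> lift x = t}"
proof -
  have "closedin (top_of_set (cball 0 1)) (cball 0 1 \<inter> f -` {z})"
    "closedin (top_of_set (cball 0 1)) (cball 0 1 \<inter> lift -` {t})"
    by (intro continuous_closedin_preimage f_cont lift_cont closed_singleton)+
  then have "compact ((cball 0 1 \<inter> f -` {z}) \<inter> (cball 0 1 \<inter> lift -` {t}))"
    using closedin_compact[OF compact_cball] compact_Int by blast
  also have "(cball 0 1 \<inter> f -` {z}) \<inter> (cball 0 1 \<inter> lift -` {t}) = {x \<in> cball 0 1. f x = z \<and> lift x = t}" by auto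
  finally show ?thesis .
qed

text \<open>The lift has no critical point in the disc, so it has no extremum in a bounded
  complementary component of one of its level sets.\<close>

lemma connected_Compl_level: "connected (- {x \<in> cball 0 1. f x = z \<and> lift x = t})"
proof -
  define L where "L = {x \<in> cball 0 1. f x = z \<and> lift x = t}"
  have L: "compact L" unfolding L_def by (rule compact_level)
  have unb: "\<not> bounded Q" if Q: "Q \<in> components (- L)" for Q
  proof
    assume bO: "bounded Q"
    have oO: "open Q" using Q L by (meson compact_imp_closed open_Compl open_components)
    \<comment> \<open>The exterior of the disc is connected and misses \<open>L\<close>, so a
      component meeting it would contain it and be unbounded.\<close>
    have "Q \<inter> - cball 0 1 = {}"
    proof (rule ccontr)
      assume "Q \<inter> - cball 0 1 \<noteq> {}"
      moreover have "connected (- cball (0::complex) 1)" by (rule connected_complement_bounded_convex) auto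
      moreover have "- cball 0 1 \<subseteq> - L" by (auto simp: L_def)
      ultimately have "- cball 0 1 \<subseteq> Q" using Q by (metis Int_commute components_maximal)
      then have "bounded (- cball (0::complex) 1)" using bO bounded_subset by blast
      then show False using cobounded_imp_unbounded[of "cball 0 (1::real)"] bounded_cball cobounded_imp_unbounded
        by (metis bounded_cball double_complement)
    qed
    then have sub: "Q \<subseteq> cball 0 1" by auto
    then have clO: "closure Q \<subseteq> cball 0 1" by (simp add: closure_minimal)
    have fr: "frontier Q \<subseteq> L"
      using Q L by (metis compact_imp_closed frontier_of_components_closed_complement double_complement)
    have ne: "Q \<noteq> {}" using Q in_components_nonempty by blast
    have cO: "compact (closure Q)" using bO by (simp add: compact_closure)
    have gc: "continuous_on (closure Q) lift" by (rule continuous_on_subset[OF lift_cont clO])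
    obtain M where M: "M \<in> closure Q" "\<And>x. x \<in> closure Q \<Longrightarrow> lift x \<le> lift M"
      using continuous_attains_sup[OF cO _ gc] ne by auto
    obtain m where m: "m \<in> closure Q" "\<And>x. x \<in> closure Q \<Longrightarrow> lift m \<le> lift x"
      using continuous_attains_inf[OF cO _ gc] ne by auto
    have crit: False if p: "p \<in> Q" and ext: "(\<forall>y\<in>Q. lift y \<le> lift p) \<or> (\<forall>y\<in>Q. lift p \<le> lift y)" for p
    proof -
      have pc: "p \<in> cball 0 1" using p sub by blast
      have "(lift has_derivative \<alpha> p) (at p within Q)"
        by (rule has_derivative_subset[OF lift[OF pc] sub])
      then have "(lift has_derivative \<alpha> p) (at p)" unfolding at_within_open[OF p oO] .
      then have "\<alpha> p = (\<lambda>v. 0)" by (rule differential_zero_maxmin[OF p oO _ ext])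
      then show False using \<alpha>_nonzero[OF pc] by simp
    qed
    have Qc: "\<And>y. y \<in> Q \<Longrightarrow> y \<in> closure Q" using closure_subset[of Q] by blast
    consider "M \<in> Q" | "m \<in> Q" | "M \<in> L" "m \<in> L"
      using M(1) m(1) fr unfolding closure_Un_frontier by blast
    then show False
    proof cases
      case 1 then show False using crit[of M] M(2) Qc by simp
    next
      case 2 then show False using crit[of m] m(2) Qc by simp
    next
      \<comment> \<open>With both extrema on the level set, \<open>lift\<close> is constant on
        \<open>Q\<close> and every point of \<open>Q\<close> is critical.\<close>
      case 3
      then have "lift M = lift m" by (simp add: L_def)
      obtain p where p: "p \<in> Q" using ne by auto
      have "lift y \<le> lift p" if "y \<in> Q" for y
        using M(2)[OF Qc[OF that]] m(2)[OF Qc[OF p]] \<open>lift M = lift m\<close> by simp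
      then show False using crit[OF p] by blast
    qed
  qed
  show ?thesis
    using unb L cobounded_has_bounded_component[of "- L"] compact_imp_bounded unfolding L_def[symmetric]
    by auto
qed

lemma finite_lifts:
  assumes "z \<in> E" shows "finite (lift ` {x \<in> cball 0 1. f x = z})"
proof -
  obtain r S T where S: "r > 0" "S z = 0" "finite T" "\<forall>x\<in>cball 0 1. f x \<in> ball z r \<longrightarrow> lift x - S (f x) \<in> T"
    using sheets[OF assms] by blast
  have "lift ` {x \<in> cball 0 1. f x = z} \<subseteq> T" using S(1,2,4) by force
  then show ?thesis using S(3) by (rule finite_subset)
qed

text \<open>The fibre is a finite union of disjoint compact level sets, and the union of two
  disjoint closed sets that do not separate the plane does not separate it either. The map
  \<open>w\<close> is a homeomorphism of the fibre onto its image, and for compact plane sets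
  separation is a topological invariant.\<close>

lemma connected_Compl_fibre:
  fixes w :: "complex \<Rightarrow> complex"
  assumes w: "continuous_on (cball 0 1) w" and inj: "inj_on (\<lambda>x. (f x, w x)) (cball 0 1)"
    and z: "z \<in> E"
  shows "connected (- (w ` {x \<in> cball 0 1. f x = z}))"
proof -
  define L where "L T = {x \<in> cball 0 1. f x = z \<and> lift x \<in> T}" for T
  have "compact (L T) \<and> connected (- L T)" if "finite T" for T
    using that
  proof (induction T)
    case empty
    then show ?case by (simp add: L_def connected_UNIV)
  next
    case (insert t T)
    have eq: "L (insert t T) = {x \<in> cball 0 1. f x = z \<and> lift x = t} \<union> L T" by (auto simp: L_def)
    have "connected (- ({x \<in> cball 0 1. f x = z \<and> lift x = t} \<union> L T))"
      using insert by (intro separation_by_Un_closed connected_Compl_level compact_imp_closed compact_level) (auto simp: L_def)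
    then show ?case using insert.IH compact_level[of z t] unfolding eq by (auto intro: compact_Un)
  qed
  moreover have "L (lift ` {x \<in> cball 0 1. f x = z}) = {x \<in> cball 0 1. f x = z}" by (auto simp: L_def)
  ultimately have *: "compact {x \<in> cball 0 1. f x = z}" "connected (- {x \<in> cball 0 1. f x = z})"
    using finite_lifts[OF z] by metis+
  have wc: "continuous_on {x \<in> cball 0 1. f x = z} w" by (rule continuous_on_subset[OF w]) auto
  have wi: "inj_on w {x \<in> cball 0 1. f x = z}" using inj by (auto simp: inj_on_def)
  have "{x \<in> cball 0 1. f x = z} homeomorphic w ` {x \<in> cball 0 1. f x = z}"
    by (rule homeomorphic_compact[where f = w]) (rule *(1) wc wi refl)+
  then show ?thesis
    using homotopy_eqv_separation[OF homeomorphic_imp_homotopy_eqv *(1)] *(2) compact_continuous_image[OF wc *(1)] by blast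
qed

end

section \<open>The two sides of the projected disc\<close>

context regular_curve begin

definition side :: "bool \<Rightarrow> complex set" where
  "side s = (if s then {z. h z > 0} else {z. h z < 0})"

lemma side_nbhd:
  assumes z0: "z0 \<in> E" and e: "e > 0"
  shows "\<exists>d>0. \<exists>P. open P \<and> connected P \<and> P \<subseteq> ball z0 e \<inter> side s \<and> ball z0 d \<inter> side s \<subseteq> P"
proof (cases s)
  case True then show ?thesis using pos_side[OF assms] by (simp add: side_def)
next
  case False
  interpret neg: regular_curve "\<lambda>z. - h z" "\<lambda>z. - G z" by (rule regular_curve_uminus)
  have "z0 \<in> neg.E" using z0 by (simp add: neg.E_def E_def)
  from neg.pos_side[OF this e] show ?thesis using False by (simp add: side_def)
qed

lemma side_adherent:
  assumes z0: "z0 \<in> E" and e: "e > 0"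
  shows "\<exists>z\<in>ball z0 e. z \<in> side s"
proof (cases s)
  case True then show ?thesis using pos_adherent[OF assms] by (simp add: side_def)
next
  case False
  interpret neg: regular_curve "\<lambda>z. - h z" "\<lambda>z. - G z" by (rule regular_curve_uminus)
  have "z0 \<in> neg.E" using z0 by (simp add: neg.E_def E_def)
  from neg.pos_adherent[OF this e] show ?thesis using False by (simp add: side_def)
qed

lemma side_disc:
  assumes z0: "z0 \<in> E" and e: "e > 0"
  shows "\<exists>c\<in>ball z0 e. c \<noteq> z0 \<and> c \<in> side s \<and> (\<forall>z\<in>E - {z0}. dist z0 c < dist z c)"
proof (cases s)
  case True then show ?thesis using tangent_disc[OF assms] by (simp add: side_def)
next
  case False
  interpret neg: regular_curve "\<lambda>z. - h z" "\<lambda>z. - G z" by (rule regular_curve_uminus)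
  have eq: "neg.E = E" by (auto simp: neg.E_def E_def)
  have "z0 \<in> neg.E" using z0 eq by simp
  from neg.tangent_disc[OF this e] show ?thesis using False eq by (simp add: side_def)
qed

lemma side_disjoint_E: "side s \<inter> E = {}"
  by (auto simp: side_def E_def)

lemma side_cases: "z \<in> E \<or> z \<in> side True \<or> z \<in> side False"
  by (auto simp: side_def E_def)

end

text \<open>What is retained of the disc: \<open>g\<close> is the lift moved to \<open>D\<close>,
  \<psi> is the surjection required by \<open>papprox_dual\<close>, \<open>fibre\<close> gives
  approximation on single fibres, and by \<open>sheets\<close> the function \<open>g\<close> is
  locally a coordinate of the curve plus one of finitely many constants.\<close>

locale sheeted = regular_curve h G for h G +
  fixes D :: "(complex \<times> complex) set" and g :: "complex \<times> complex \<Rightarrow> real"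
    and \<psi> :: "complex \<Rightarrow> complex \<times> complex"
  assumes compact_D: "compact D" and connected_D: "connected D"
    and D_E: "fst ` D \<subseteq> E"
    and g_cont: "continuous_on D g"
    and \<psi>: "continuous_on UNIV \<psi>" "range \<psi> = D"
    and fibre: "\<And>z. z \<in> E \<Longrightarrow> connected (- (snd ` {y \<in> D. fst y = z}))"
    and sheets: "\<And>z0. z0 \<in> E \<Longrightarrow> \<exists>r S T. r > 0 \<and> S z0 = 0 \<and> continuous_on (E \<inter> ball z0 r) S \<and>
      (\<forall>e>0. \<exists>z\<in>E \<inter> ball z0 e. S z > 0) \<and> finite T \<and>
      (\<forall>y\<in>D. fst y \<in> ball z0 r \<longrightarrow> g y - S (fst y) \<in> T)"
begin

definition F where "F = fst ` D"
definition Good where "Good = resolv D fst"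
definition Bad where "Bad = - F - Good"

lemma F_E: "F \<subseteq> E" using D_E by (simp add: F_def)

lemma compact_F: "compact F"
  unfolding F_def by (intro compact_continuous_image compact_D continuous_intros)

lemma connected_F: "connected F"
  unfolding F_def by (intro connected_continuous_image connected_D continuous_intros)

lemma D_nonempty: "D \<noteq> {}" using \<psi>(2) by auto

lemma fst_cont: "continuous_on X (fst :: complex \<times> complex \<Rightarrow> complex)" and
  snd_cont: "continuous_on X (snd :: complex \<times> complex \<Rightarrow> complex)"
  by (intro continuous_intros)+

lemma open_Good: "open Good" and open_Bad: "open Bad"
  unfolding Bad_def Good_def F_def by (intro open_resolv open_Compl_resolv compact_D fst_cont)+

lemma Good_F: "Good \<inter> F = {}"
  by (auto simp: Good_def resolv_def F_def)

lemma Good_or_Bad: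
  assumes "connected C" "C \<inter> F = {}" shows "C \<subseteq> Good \<or> C \<subseteq> Bad"
  using connected_resolv[OF compact_D fst_cont assms(1)] assms(2) unfolding Bad_def Good_def F_def by blast

lemma Good_nonempty: "Good \<noteq> {}"
proof -
  obtain B where "\<And>b. norm b > B \<Longrightarrow> b \<in> Good"
    using resolv_far[OF compact_D fst_cont papprox_poly[OF hol_polys2_fst]] unfolding Good_def by blast
  moreover have "B < norm (of_real (\<bar>B\<bar> + 1) :: complex)" unfolding norm_of_real by linarith
  ultimately show ?thesis by blast
qed

text \<open>The one-sided neighbourhood is enclosed in a connected set off \<open>F\<close>, where
  either all points are resolvent or none.\<close>

lemma side_Good_or_Bad:
  assumes z: "z \<in> F"
  shows "\<exists>d>0. ball z d \<inter> side s \<subseteq> Good \<or> ball z d \<inter> side s \<subseteq> Bad"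
proof -
  have zE: "z \<in> E" using z F_E by blast
  obtain d P where "d > 0" "connected P" "P \<subseteq> ball z 1 \<inter> side s" "ball z d \<inter> side s \<subseteq> P"
    using side_nbhd[OF zE zero_less_one, of s] by blast
  moreover have "P \<inter> F = {}" using calculation(3) F_E side_disjoint_E by blast
  ultimately show ?thesis using Good_or_Bad[of P] by blast
qed

lemma open_meets_side:
  assumes "open W" "p \<in> W" "p \<in> E" shows "W \<inter> side s \<noteq> {}"
proof -
  obtain e where "e > 0" "ball p e \<subseteq> W" using assms openE by blast
  then show ?thesis using side_adherent[OF assms(3), of e s] by blast
qed

text \<open>An open set containing a point of \<open>E\<close> meets both sides. If both sides were
  of one kind near \<open>z\<close>, the other open region could therefore not accumulate there.
  Likewise a point of \<open>E\<close> off \<open>F\<close> near \<open>z\<close> would lie in one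
  region and drag points of both sides into it.\<close>

lemma two_sides_aux:
  assumes z: "z \<in> F" "z \<in> closure Good" "z \<in> closure Bad"
  shows "\<exists>s d. d > 0 \<and> ball z d \<inter> side s \<subseteq> Bad \<and> ball z d \<inter> side (\<not> s) \<subseteq> Good \<and> E \<inter> ball z d \<subseteq> F"
proof -
  obtain d1 where d1: "d1 > 0" "ball z d1 \<inter> side True \<subseteq> Good \<or> ball z d1 \<inter> side True \<subseteq> Bad"
    using side_Good_or_Bad[OF z(1)] by blast
  obtain d2 where d2: "d2 > 0" "ball z d2 \<inter> side False \<subseteq> Good \<or> ball z d2 \<inter> side False \<subseteq> Bad"
    using side_Good_or_Bad[OF z(1)] by blast
  define d where "d = min d1 d2"
  have d0: "d > 0" using d1 d2 by (simp add: d_def)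
  have sub: "ball z d \<subseteq> ball z d1" "ball z d \<subseteq> ball z d2" by (auto simp: d_def)
  have dd: "ball z d \<inter> side True \<subseteq> Good \<or> ball z d \<inter> side True \<subseteq> Bad"
    "ball z d \<inter> side False \<subseteq> Good \<or> ball z d \<inter> side False \<subseteq> Bad"
    using d1(2) d2(2) sub by blast+
  have disj: "Good \<inter> Bad = {}" by (auto simp: Bad_def)
  have meet: "\<exists>s. W \<inter> ball z d \<inter> side s \<noteq> {}" if W: "open W" "z \<in> closure W" for W
  proof -
    obtain p where p: "p \<in> W \<inter> ball z d" using W(2) d0 closure_approachable[of z W] by (auto simp: dist_commute)
    show ?thesis
    proof (cases "p \<in> E")
      case True
      then show ?thesis using open_meets_side[of "W \<inter> ball z d" p True] W(1) p by blast
    next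
      case False
      then show ?thesis using side_cases[of p] p by blast
    qed
  qed
  have "\<not> (ball z d \<inter> side True \<subseteq> Good \<and> ball z d \<inter> side False \<subseteq> Good)"
  proof
    assume *: "ball z d \<inter> side True \<subseteq> Good \<and> ball z d \<inter> side False \<subseteq> Good"
    obtain s where "Bad \<inter> ball z d \<inter> side s \<noteq> {}" using meet[OF open_Bad z(3)] by blast
    moreover have "ball z d \<inter> side s \<subseteq> Good" using * by (cases s) simp_all
    ultimately show False using disj by blast
  qed
  moreover have "\<not> (ball z d \<inter> side True \<subseteq> Bad \<and> ball z d \<inter> side False \<subseteq> Bad)"
  proof
    assume *: "ball z d \<inter> side True \<subseteq> Bad \<and> ball z d \<inter> side False \<subseteq> Bad"
    obtain s where "Good \<inter> ball z d \<inter> side s \<noteq> {}" using meet[OF open_Good z(2)] by blast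
    moreover have "ball z d \<inter> side s \<subseteq> Bad" using * by (cases s) simp_all
    ultimately show False using disj by blast
  qed
  ultimately obtain s where s: "ball z d \<inter> side s \<subseteq> Bad" "ball z d \<inter> side (\<not> s) \<subseteq> Good"
    using dd by (metis (full_types))
  have "E \<inter> ball z d \<subseteq> F"
  proof (rule ccontr)
    assume "\<not> E \<inter> ball z d \<subseteq> F"
    then obtain p where p: "p \<in> E" "p \<in> ball z d" "p \<notin> F" by blast
    then have "p \<in> Good \<or> p \<in> Bad" by (auto simp: Bad_def)
    then show False
    proof
      assume "p \<in> Good"
      then have "Good \<inter> ball z d \<inter> side s \<noteq> {}" using p open_Good by (intro open_meets_side) auto
      then show False using s disj by blast
    next
      assume "p \<in> Bad"
      then have "Bad \<inter> ball z d \<inter> side (\<not> s) \<noteq> {}" using p open_Bad by (intro open_meets_side) auto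
      then show False using s disj by blast
    qed
  qed
  then show ?thesis using s d0 by blast
qed

text \<open>The points of \<open>F\<close> adherent to both regions form a nonempty clopen subset of the connected
  set \<open>F\<close>; hence \<open>F\<close> is open in the curve as soon as \<open>Bad\<close> is nonempty.\<close>

lemma two_sides:
  assumes Bad: "Bad \<noteq> {}" and z: "z \<in> F"
  shows "\<exists>s d. d > 0 \<and> ball z d \<inter> side s \<subseteq> Bad \<and> ball z d \<inter> side (\<not> s) \<subseteq> Good \<and> E \<inter> ball z d \<subseteq> F"
proof -
  define T where "T = F \<inter> (closure Good \<inter> closure Bad)"
  have disj: "Good \<inter> Bad = {}" by (auto simp: Bad_def)
  \<comment> \<open>Points off \<open>F\<close> belong to one of the regions, and \<open>F\<close>
    has no interior because points with \<open>h > 0\<close> accumulate at every point of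
    \<open>E\<close>.\<close>
  have "closure Good \<union> closure Bad = UNIV"
  proof -
    have "closure (Good \<union> Bad) = UNIV"
    proof (rule ccontr)
      assume "closure (Good \<union> Bad) \<noteq> UNIV"
      then obtain p where p: "p \<in> - closure (Good \<union> Bad)" by blast
      then have "p \<notin> Good \<union> Bad" using closure_subset[of "Good \<union> Bad"] by blast
      then have "p \<in> E" using F_E by (auto simp: Bad_def)
      then have "- closure (Good \<union> Bad) \<inter> side True \<noteq> {}" using p by (intro open_meets_side) auto
      moreover have "side True \<inter> F = {}" using side_disjoint_E F_E by blast
      moreover have "- F \<subseteq> Good \<union> Bad" by (auto simp: Bad_def)
      ultimately show False using closure_subset[of "Good \<union> Bad"] by blast
    qed
    then show ?thesis by simp
  qed
  moreover have "closure Good \<inter> closure Bad \<subseteq> T"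
  proof
    fix p assume p: "p \<in> closure Good \<inter> closure Bad"
    have "p \<notin> Good" using p disj open_Good by (meson IntD2 disjoint_iff open_Int_closure_eq_empty)
    moreover have "p \<notin> Bad" using p disj open_Bad by (metis IntD1 Int_commute disjoint_iff open_Int_closure_eq_empty)
    ultimately show "p \<in> T" using p by (auto simp: T_def Bad_def)
  qed
  moreover have "closure Good \<noteq> {}" "closure Bad \<noteq> {}" using Good_nonempty Bad by auto
  \<comment> \<open>Two nonempty closed sets covering the connected plane must meet.\<close>
  ultimately have "T \<noteq> {}"
    using connected_closedD[OF connected_UNIV, of "closure Good" "closure Bad"] by auto
  moreover have "closedin (top_of_set F) T" unfolding T_def by (intro closedin_closed_Int closed_Int closed_closure)
  moreover have "openin (top_of_set F) T"
    unfolding openin_contains_ball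
  proof (intro conjI ballI)
    show "T \<subseteq> F" by (auto simp: T_def)
    fix p assume "p \<in> T"
    then have "p \<in> F" "p \<in> closure Good" "p \<in> closure Bad" by (auto simp: T_def)
    from two_sides_aux[OF this] obtain s d where d: "d > 0" "ball p d \<inter> side s \<subseteq> Bad" "ball p d \<inter> side (\<not> s) \<subseteq> Good"
      by blast
    have "ball p d \<inter> F \<subseteq> T"
    proof
      fix x assume x: "x \<in> ball p d \<inter> F"
      then have xE: "x \<in> E" using F_E by blast
      have ad: "x \<in> closure W" if "ball p d \<inter> side s' \<subseteq> W" for s' W
        unfolding closure_approachable
      proof (intro allI impI)
        fix e :: real assume e: "e > 0"
        have "ball p d \<inter> ball x e \<inter> side s' \<noteq> {}" using x xE e by (intro open_meets_side) auto
        then show "\<exists>y\<in>W. dist y x < e" using that by (auto simp: dist_commute)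
      qed
      show "x \<in> T" using x ad[OF d(2)] ad[OF d(3)] by (auto simp: T_def)
    qed
    then show "\<exists>e>0. ball p e \<inter> F \<subseteq> T" using d(1) by blast
  qed
  ultimately have "T = F" using connected_F unfolding connected_clopen by blast
  then have "z \<in> closure Good" "z \<in> closure Bad" using z by (auto simp: T_def)
  from two_sides_aux[OF z this] show ?thesis .
qed

section \<open>Peak functions and the hull over a fibre\<close>

lemma separated_from_fibre:
  fixes K :: "(complex \<times> complex) set"
  assumes "compact K" "\<And>y. y \<in> K \<Longrightarrow> fst y \<noteq> z"
  shows "\<exists>d>0. \<forall>y\<in>K. d \<le> dist (fst y) (z::complex)"
proof -
  have "compact (fst ` K)" using assms(1) by (intro compact_continuous_image fst_cont)
  moreover have "z \<notin> fst ` K" using assms(2) by blast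
  ultimately obtain d where "d > 0" "\<And>x. x \<in> fst ` K \<Longrightarrow> d \<le> dist z x"
    using separate_point_closed[OF compact_imp_closed] by metis
  then have "0 < d" "\<forall>y\<in>K. d \<le> dist (fst y) z" by (simp_all add: dist_commute[of _ z])
  then show ?thesis by blast
qed

text \<open>The ratio is the modulus of \<open>s / (fst y - e)\<close> with
  \<open>s = dist z e\<close>. It equals 1 over \<open>z\<close> and is smaller over the rest of
  \<open>F\<close>; compactness makes the gap uniform at distance \<open>d\<close> from
  \<open>z\<close>.\<close>

lemma peak:
  assumes e: "\<And>z'. z' \<in> F - {z} \<Longrightarrow> dist z e < dist z' e" "z \<noteq> e" and d: "d > 0"
  shows "\<exists>k. 0 < k \<and> k < 1 \<and> (\<forall>y\<in>D. d \<le> dist (fst y) z \<longrightarrow> dist z e / dist (fst y) e \<le> k)"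
proof -
  define K where "K = F - ball z d"
  have K: "compact K" unfolding K_def by (intro compact_diff compact_F open_ball)
  show ?thesis
  proof (cases "K = {}")
    case True
    then have "\<not> d \<le> dist (fst y) z" if "y \<in> D" for y using that by (auto simp: K_def F_def dist_commute)
    then show ?thesis by (intro exI[of _ "1/2"]) auto
  next
    case False
    obtain p where p: "p \<in> K" "\<And>q. q \<in> K \<Longrightarrow> dist p e \<le> dist q e"
    proof -
      have "continuous_on K (\<lambda>q. dist q e)" by (intro continuous_intros)
      from continuous_attains_inf[OF K False this] show ?thesis using that by blast
    qed
    have "p \<in> F - {z}" using p(1) d by (auto simp: K_def)
    from e(1)[OF this] have lt: "dist z e < dist p e" .
    have pos: "0 < dist z e" using e(2) by simp
    show ?thesis
    proof (intro exI[of _ "dist z e / dist p e"] conjI ballI impI)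
      show "0 < dist z e / dist p e" "dist z e / dist p e < 1"
        using divide_pos_pos[OF pos less_trans[OF pos lt]] lt less_trans[OF pos lt] pos_divide_less_eq[of "dist p e" "dist z e" 1]
        by simp_all
      fix y assume "y \<in> D" "d \<le> dist (fst y) z"
      then have "fst y \<in> K" by (auto simp: K_def F_def dist_commute)
      from p(2)[OF this] show "dist z e / dist (fst y) e \<le> dist z e / dist p e"
        using lt pos by (intro divide_left_mono mult_pos_pos) linarith+
    qed
  qed
qed

lemma compact_fibre: "compact {y \<in> D. fst y = z}"
proof -
  have "{y \<in> D. fst y = z} = D \<inter> fst -` {z}" by auto
  moreover have "closed (fst -` {z} :: (complex \<times> complex) set)"
    by (intro closed_vimage closed_singleton fst_cont)
  ultimately show ?thesis using compact_D by (simp add: compact_Int_closed)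
qed

lemma fibre_resolv: 
  assumes "z \<in> E" shows "- (snd ` {y \<in> D. fst y = z}) \<subseteq> resolv {y \<in> D. fst y = z} snd"
proof (rule resolv_unbounded[OF compact_fibre snd_cont papprox_poly[OF hol_polys2_snd] fibre[OF assms]])
  have "bounded (snd ` {y \<in> D. fst y = z})"
    by (intro compact_imp_bounded compact_continuous_image compact_fibre snd_cont)
  then show "\<not> bounded (- (snd ` {y \<in> D. fst y = z}))" by (rule cobounded_imp_unbounded[of "- _", unfolded double_complement])
qed auto

text \<open>A point \<open>(z, w)\<close> outside \<open>D\<close> is excluded by a polynomial that
  is smaller on \<open>D\<close> than at the point. For \<open>z\<close> outside \<open>F\<close> it
  is \<open>1 - (fst - z) p\<close> with \<open>p\<close> close to \<open>1 / (fst - z)\<close>. For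
  \<open>z\<close> in \<open>F\<close> a polynomial \<open>q\<close>, equal to 1 at the point and
  small on the fibre, is damped elsewhere on \<open>D\<close> by a high power of the peak function
  at \<open>z\<close>.\<close>

lemma polynomially_convex_if_all_Good:
  assumes "Bad = {}" shows "poly_hull D = D"
proof
  show "D \<subseteq> poly_hull D" by (rule subset_poly_hull[OF compact_D])
  have FG: "- F \<subseteq> Good" using assms by (auto simp: Bad_def)
  show "poly_hull D \<subseteq> D"
  proof (rule subsetI, rule ccontr)
    fix x assume x: "x \<in> poly_hull D" "x \<notin> D"
    obtain z w where zw: "x = (z, w)" by (cases x)
    have bnd: "norm (p x) \<le> B" if "p \<in> hol_polys2" "\<And>y. y \<in> D \<Longrightarrow> norm (p y) \<le> B" for p B
      by (rule poly_hull_bound[OF x(1) D_nonempty that])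
    show False
    proof (cases "z \<in> F")
      case False
      then have "papprox D (\<lambda>y. 1 / (fst y - z))" using FG by (auto simp: Good_def resolv_def)
      moreover obtain B where B: "B > 0" "\<And>y. y \<in> D \<Longrightarrow> norm (fst y - z) \<le> B"
        using papprox_bounded[OF compact_D papprox_poly[OF hol_polys2_diff[OF hol_polys2_fst hol_polys2_const]], of z] by blast
      ultimately obtain p where p: "p \<in> hol_polys2" "\<And>y. y \<in> D \<Longrightarrow> norm (p y - 1 / (fst y - z)) < 1 / (2 * B)"
        unfolding papprox_def using B(1) by (metis divide_pos_pos mult_pos_pos zero_less_numeral zero_less_one)
      have "norm (1 - (fst x - z) * p x) \<le> 1 / 2"
      proof (rule bnd)
        show "(\<lambda>y. 1 - (fst y - z) * p y) \<in> hol_polys2" by (intro hol_polys2_intros p)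
        fix y assume y: "y \<in> D"
        have "fst y \<noteq> z" using False y by (auto simp: F_def)
        then have "1 - (fst y - z) * p y = - ((fst y - z) * (p y - 1 / (fst y - z)))" by (simp add: field_simps)
        then have "norm (1 - (fst y - z) * p y) = norm (fst y - z) * norm (p y - 1 / (fst y - z))"
          by (simp add: norm_mult)
        also have "\<dots> \<le> B * (1 / (2 * B))" using B p(2)[OF y] y by (intro mult_mono) (auto intro: less_imp_le)
        finally show "norm (1 - (fst y - z) * p y) \<le> 1 / 2" using B(1) by simp
      qed
      then show False by (simp add: zw)
    next
      case True
      then have zE: "z \<in> E" using F_E by blast
      define X where "X = {y \<in> D. fst y = z}"
      have "w \<notin> snd ` X" using x(2) zw by (auto simp: X_def)
      then have "papprox X (\<lambda>y. 1 / (snd y - w))" using fibre_resolv[OF zE] unfolding resolv_def X_def by blast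
      moreover obtain B where B: "B > 0" "\<And>y. y \<in> X \<Longrightarrow> norm (snd y - w) \<le> B"
        using papprox_bounded[OF compact_fibre papprox_poly[OF hol_polys2_diff[OF hol_polys2_snd hol_polys2_const]], of z w]
        unfolding X_def by blast
      \<comment> \<open>This accuracy gives \<open>norm (q y) \<le> 1 / 4\<close> on the fibre and
        leaves room for \<open>1 / 2\<close> on a neighbourhood of it.\<close>
      ultimately obtain p where p: "p \<in> hol_polys2" "\<And>y. y \<in> X \<Longrightarrow> norm (p y - 1 / (snd y - w)) < 1 / (4 * B)"
        unfolding papprox_def using B(1) by (metis divide_pos_pos mult_pos_pos zero_less_numeral zero_less_one)
      define q where "q y = 1 - (snd y - w) * p y" for y
      have q: "q \<in> hol_polys2" unfolding q_def by (intro hol_polys2_intros p)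
      have qX: "norm (q y) \<le> 1 / 4" if y: "y \<in> X" for y
      proof -
        have "snd y \<noteq> w" using \<open>w \<notin> snd ` X\<close> y by auto
        then have "q y = - ((snd y - w) * (p y - 1 / (snd y - w)))" by (simp add: q_def field_simps)
        then have "norm (q y) = norm (snd y - w) * norm (p y - 1 / (snd y - w))" by (simp add: norm_mult)
        also have "\<dots> \<le> B * (1 / (4 * B))" using B p(2)[OF y] y by (intro mult_mono) (auto intro: less_imp_le)
        finally show ?thesis using B(1) by simp
      qed
      have "compact {y \<in> D. 1 / 2 \<le> norm (q y)}"
      proof -
        have "{y \<in> D. 1 / 2 \<le> norm (q y)} = D \<inter> {y. 1 / 2 \<le> norm (q y)}" by auto
        moreover have "closed {y. 1 / 2 \<le> norm (q y)}"
          by (intro closed_Collect_le continuous_on_const continuous_on_norm continuous_on_hol_polys2 q)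
        ultimately show ?thesis using compact_D by (simp add: compact_Int_closed)
      qed
      moreover have "fst y \<noteq> z" if "y \<in> {y \<in> D. 1 / 2 \<le> norm (q y)}" for y
        using qX[of y] that by (force simp: X_def)
      ultimately obtain d where d: "d > 0" "\<And>y. y \<in> D \<Longrightarrow> 1/2 \<le> norm (q y) \<Longrightarrow> d \<le> dist (fst y) z"
        using separated_from_fibre[of "{y \<in> D. 1 / 2 \<le> norm (q y)}" z] by blast
      obtain e where e: "e \<noteq> z" "e \<in> side True" "\<And>z'. z' \<in> E - {z} \<Longrightarrow> dist z e < dist z' e"
        using side_disc[OF zE zero_less_one] by blast
      have "e \<notin> F" using e(2) side_disjoint_E F_E by blast
      then have pe: "papprox D (\<lambda>y. 1 / (fst y - e))" using FG by (auto simp: Good_def resolv_def)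
      define s where "s = dist z e"
      have s: "s > 0" using e(1) by (simp add: s_def)
      obtain k where k: "0 < k" "k < 1" "\<And>y. y \<in> D \<Longrightarrow> d \<le> dist (fst y) z \<Longrightarrow> s / dist (fst y) e \<le> k"
        using peak[of z e d] e F_E d(1) unfolding s_def by blast
      obtain B' where B': "B' > 0" "\<And>y. y \<in> D \<Longrightarrow> norm (q y) \<le> B'"
        using papprox_bounded[OF compact_D papprox_poly[OF q]] by blast
      \<comment> \<open>Away from the fibre \<open>k ^ N\<close> outweighs the bound
        \<open>B'\<close> of \<open>q\<close>.\<close>
      obtain N where N: "k ^ N < 1 / (2 * B')" using real_arch_pow_inv[of "1 / (2 * B')" k] k B' by auto
      define r where "r y = (of_real s * (1 / (fst y - e))) ^ N" for y :: "complex \<times> complex"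
      have pr: "papprox D r" unfolding r_def by (intro papprox_power papprox_mult compact_D papprox_const pe)
      have nr: "norm (r y) = (s / dist (fst y) e) ^ N" for y
        using s by (simp add: r_def norm_power norm_mult norm_divide dist_norm)
      have le1: "s / dist (fst y) e \<le> 1" if "y \<in> D" for y
      proof (cases "fst y = z")
        case True then show ?thesis using s by (simp add: s_def)
      next
        case False
        then have "s < dist (fst y) e" using e(3)[of "fst y"] that F_E by (auto simp: s_def F_def)
        then show ?thesis using s pos_divide_le_eq[of "dist (fst y) e" s 1] by linarith
      qed
      have rq: "norm (r y) * norm (q y) \<le> 1 / 2" and r1: "norm (r y) \<le> 1" if y: "y \<in> D" for y
      proof -
        show r1: "norm (r y) \<le> 1" unfolding nr using le1[OF y] s by (intro power_le_one) auto
        show "norm (r y) * norm (q y) \<le> 1 / 2"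
        proof (cases "1/2 \<le> norm (q y)")
          case True
          have "norm (r y) \<le> k ^ N" unfolding nr using k(3)[OF y d(2)[OF y True]] s by (intro power_mono) auto
          then have "norm (r y) * norm (q y) \<le> (1 / (2 * B')) * B'" using N B'(2)[OF y] B'(1) by (intro mult_mono) auto
          then show ?thesis using B'(1) by simp
        next
          case False
          then have "norm (r y) * norm (q y) \<le> 1 * (1/2)" using r1 by (intro mult_mono) auto
          then show ?thesis by simp
        qed
      qed
      obtain B2 where B2: "B2 > 0" "\<And>y. y \<in> D \<Longrightarrow> norm ((fst y - e) ^ N) \<le> B2"
        using papprox_bounded[OF compact_D papprox_poly[OF hol_polys2_power[OF hol_polys2_diff[OF hol_polys2_fst hol_polys2_const]]], of e N] by blast
      \<comment> \<open>The first bound limits the cost of replacing \<open>r\<close> by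
        \<open>p'\<close> in the product with \<open>q\<close> to \<open>1 / 8\<close>, the second
        limits the error in determining \<open>p'\<close> at \<open>x\<close> to a quarter of
        \<open>s ^ N\<close>. The contradiction is \<open>3 / 4\<close> against
        \<open>5 / 8\<close>.\<close>
      define \<eta> where "\<eta> = min (1 / (8 * B')) (s ^ N / (4 * B2))"
      have \<eta>: "\<eta> > 0" "\<eta> * B' \<le> 1 / 8" "B2 * \<eta> \<le> s ^ N / 4"
      proof -
        show "\<eta> > 0" using B' B2 s by (simp add: \<eta>_def)
        have "\<eta> * B' \<le> (1 / (8 * B')) * B'" using B'(1) by (intro mult_right_mono) (auto simp: \<eta>_def)
        then show "\<eta> * B' \<le> 1 / 8" using B'(1) by simp
        have "B2 * \<eta> \<le> B2 * (s ^ N / (4 * B2))" using B2(1) by (intro mult_left_mono) (auto simp: \<eta>_def)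
        then show "B2 * \<eta> \<le> s ^ N / 4" using B2(1) by simp
      qed
      obtain p' where p': "p' \<in> hol_polys2" "\<And>y. y \<in> D \<Longrightarrow> norm (p' y - r y) < \<eta>"
        using pr \<eta>(1) unfolding papprox_def by metis
      \<comment> \<open>Closeness of \<open>p'\<close> to \<open>r\<close> on \<open>D\<close> says
        nothing directly at \<open>x\<close>. With the denominator cleared it is a bound for a
        polynomial, and such bounds pass to the hull.\<close>
      have "norm ((fst x - e) ^ N * p' x - of_real s ^ N) \<le> s ^ N / 4"
      proof (rule bnd)
        show "(\<lambda>y. (fst y - e) ^ N * p' y - of_real s ^ N) \<in> hol_polys2" by (intro hol_polys2_intros p')
        fix y assume y: "y \<in> D"
        have "fst y \<noteq> e" using y \<open>e \<notin> F\<close> by (auto simp: F_def)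
        then have "(fst y - e) ^ N * r y = of_real s ^ N"
          by (simp add: r_def power_mult_distrib power_divide)
        then have "(fst y - e) ^ N * p' y - of_real s ^ N = (fst y - e) ^ N * (p' y - r y)"
          by (simp add: right_diff_distrib)
        then have "norm ((fst y - e) ^ N * p' y - of_real s ^ N) = norm ((fst y - e) ^ N) * norm (p' y - r y)"
          by (simp add: norm_mult)
        also have "\<dots> \<le> B2 * \<eta>" using B2 y p'(2)[OF y] by (intro mult_mono) auto
        finally show "norm ((fst y - e) ^ N * p' y - of_real s ^ N) \<le> s ^ N / 4" using \<eta>(3) by linarith
      qed
      moreover have "norm ((fst x - e) ^ N * p' x) = s ^ N * norm (p' x)"
        by (simp add: zw norm_mult norm_power s_def dist_norm)
      moreover have "norm ((of_real s :: complex) ^ N) = s ^ N" using s by (simp add: norm_power)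
      ultimately have "s ^ N - s ^ N * norm (p' x) \<le> s ^ N / 4"
        using norm_triangle_ineq2[of "of_real s ^ N" "(fst x - e) ^ N * p' x"] by (simp add: norm_minus_commute)
      then have "s ^ N * (3 / 4) \<le> s ^ N * norm (p' x)" by simp
      then have big: "3 / 4 \<le> norm (p' x)" using s by simp
      have "norm (p' x * q x) \<le> 5 / 8"
      proof (rule bnd)
        show "(\<lambda>y. p' y * q y) \<in> hol_polys2" by (intro hol_polys2_intros p' q)
        fix y assume y: "y \<in> D"
        have "norm (p' y * q y) = norm (r y * q y + (p' y - r y) * q y)" by (simp add: algebra_simps)
        also have "\<dots> \<le> norm (r y) * norm (q y) + norm (p' y - r y) * norm (q y)"
          using norm_triangle_ineq[of "r y * q y" "(p' y - r y) * q y"] by (simp add: norm_mult)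
        also have "\<dots> \<le> 1 / 2 + \<eta> * B'"
          using rq[OF y] p'(2)[OF y] B'(2)[OF y] \<eta>(1) by (intro add_mono mult_mono) auto
        finally show "norm (p' y * q y) \<le> 5 / 8" using \<eta>(2) by linarith
      qed
      moreover have "q x = 1" by (simp add: q_def zw)
      ultimately show False using big by simp
    qed
  qed
qed

end

text \<open>The probability that more than half of \<open>2 n + 1\<close> independent trials of success probability \<open>x\<close>
  succeed: it separates \<open>x\<close> near \<open>0\<close> from \<open>x\<close> near \<open>1\<close> at a geometric rate while growing only geometrically.\<close>

definition majority :: "nat \<Rightarrow> complex \<Rightarrow> complex" where
  "majority n x = (\<Sum>j\<in>{n+1..2*n+1}. of_nat ((2*n+1) choose j) * x ^ j * (1 - x) ^ (2*n+1-j))"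

text \<open>An odd number of trials leaves no tie, so failure of the majority under \<open>x\<close>
  is success under \<open>1 - x\<close>.\<close>

lemma majority_compl: "majority n (1 - x) = 1 - majority n x"
proof -
  let ?t = "\<lambda>j. of_nat ((2*n+1) choose j) * x ^ j * (1 - x) ^ (2*n+1-j)"
  have "majority n (1 - x) = (\<Sum>j\<in>{..n}. ?t j)"
    unfolding majority_def
    by (rule sum.reindex_bij_witness[of _ "\<lambda>j. 2*n+1-j" "\<lambda>j. 2*n+1-j"])
       (auto simp: binomial_symmetric[symmetric] mult_ac)
  moreover have "(\<Sum>j\<in>{..n}. ?t j) + majority n x = (\<Sum>j\<in>{..2*n+1}. ?t j)"
  proof -
    have "{..2*n+1} = {..n} \<union> {n+1..2*n+1}" by auto
    then show ?thesis unfolding majority_def by (simp only:) (subst sum.union_disjoint, auto)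
  qed
  moreover have "(\<Sum>j\<in>{..2*n+1}. ?t j) = (x + (1 - x)) ^ (2*n+1)"
    by (rule binomial_ring[symmetric])
  ultimately show ?thesis by (simp add: algebra_simps)
qed

text \<open>Each term has more than \<open>n\<close> factors of modulus at most \<open>1/16\<close>,
  at most \<open>n\<close> of modulus at most \<open>17/16\<close>, and the coefficients sum to at
  most \<open>2 ^ (2 * n + 1)\<close>; the total is at most
  \<open>(17/8) * (17/64) ^ n\<close>.\<close>

lemma majority_small:
  assumes "norm x \<le> 1/16" shows "norm (majority n x) \<le> 3 * (1/2) ^ n"
proof -
  have x1: "norm (1 - x) \<le> 17/16" using norm_triangle_ineq4[of 1 x] assms by simp
  have "norm (majority n x) \<le> (\<Sum>j\<in>{n+1..2*n+1}. of_nat ((2*n+1) choose j) * ((1/16) ^ n * (17/16) ^ (n+1)))"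
    unfolding majority_def
  proof (rule sum_norm_le)
    fix j assume j: "j \<in> {n+1..2*n+1}"
    have "norm x ^ j * norm (1 - x) ^ (2*n+1-j) \<le> (1/16) ^ n * (17/16) ^ (n+1)"
    proof (rule mult_mono)
      have "norm x ^ j \<le> (1/16) ^ j" using assms by (intro power_mono) auto
      also have "\<dots> \<le> (1/16) ^ n" using j by (intro power_decreasing) auto
      finally show "norm x ^ j \<le> (1/16) ^ n" .
      have "norm (1 - x) ^ (2*n+1-j) \<le> (17/16) ^ (2*n+1-j)" using x1 by (intro power_mono) auto
      also have "\<dots> \<le> (17/16) ^ (n+1)" using j by (intro power_increasing) auto
      finally show "norm (1 - x) ^ (2*n+1-j) \<le> (17/16) ^ (n+1)" .
    qed auto
    then show "norm (of_nat ((2*n+1) choose j) * x ^ j * (1 - x) ^ (2*n+1-j))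
      \<le> of_nat ((2*n+1) choose j) * ((1/16) ^ n * (17/16) ^ (n+1))"
      by (simp add: norm_mult norm_power mult.assoc mult_left_mono)
  qed
  also have "\<dots> = real (\<Sum>j\<in>{n+1..2*n+1}. (2*n+1) choose j) * ((1/16) ^ n * (17/16) ^ (n+1))"
    by (simp only: sum_distrib_right of_nat_sum)
  also have "\<dots> \<le> real (2 ^ (2*n+1)) * ((1/16) ^ n * (17/16) ^ (n+1))"
  proof (rule mult_right_mono)
    have "(\<Sum>j\<in>{n+1..2*n+1}. (2*n+1) choose j) \<le> (\<Sum>j\<le>2*n+1. (2*n+1) choose j)" by (intro sum_mono2) auto
    also have "\<dots> = 2 ^ (2*n+1)" by (rule choose_row_sum)
    finally show "real (\<Sum>j\<in>{n+1..2*n+1}. (2*n+1) choose j) \<le> real (2 ^ (2*n+1))" by (rule of_nat_mono)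
  qed auto
  also have "\<dots> = (17/8) * (17/64) ^ n"
  proof -
    have "real (2 ^ (2*n+1)) = 2 * 4 ^ n" by (simp add: power_mult)
    moreover have "(17/64::real) ^ n = 4 ^ n * ((1/16) ^ n * (17/16) ^ n)"
      by (simp only: power_mult_distrib[symmetric]) simp
    ultimately show ?thesis by simp
  qed
  also have "\<dots> \<le> 3 * (1/2) ^ n" by (intro mult_mono power_mono) auto
  finally show ?thesis .
qed

lemma majority_bound:
  assumes "norm x \<le> Q" shows "norm (majority n x) \<le> (1 + 2 * Q) * ((1 + 2 * Q)\<^sup>2) ^ n"
proof -
  have x1: "norm (1 - x) \<le> 1 + Q" using norm_triangle_ineq4[of 1 x] assms by simp
  have "norm (majority n x) \<le> (\<Sum>j\<in>{n+1..2*n+1}. of_nat ((2*n+1) choose j) * norm x ^ j * norm (1 - x) ^ (2*n+1-j))"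
    unfolding majority_def by (rule sum_norm_le) (simp add: norm_mult norm_power)
  also have "\<dots> \<le> (\<Sum>j\<le>2*n+1. of_nat ((2*n+1) choose j) * norm x ^ j * norm (1 - x) ^ (2*n+1-j))"
    by (rule sum_mono2) auto
  also have "\<dots> = (norm x + norm (1 - x)) ^ (2*n+1)" by (rule binomial_ring[symmetric])
  also have "\<dots> \<le> (1 + 2 * Q) ^ (2*n+1)" using x1 assms by (intro power_mono) auto
  also have "\<dots> = (1 + 2 * Q) * ((1 + 2 * Q)\<^sup>2) ^ n" by (simp add: power_mult[symmetric])
  finally show ?thesis .
qed

lemma majority_poly: "q \<in> hol_polys2 \<Longrightarrow> (\<lambda>y. majority n (q y)) \<in> hol_polys2"
  unfolding majority_def by (intro hol_polys2_intros)

section \<open>Cauchy transforms of an annihilating functional\<close>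

text \<open>A hypothetical functional, refuted in \<open>no_annihilator\<close>.\<close>

locale annihilator = sheeted +
  fixes l :: "(complex \<times> complex \<Rightarrow> complex) \<Rightarrow> complex" and a0 :: complex
  assumes l_add: "\<And>v w. continuous_on D v \<Longrightarrow> continuous_on D w \<Longrightarrow> l (\<lambda>y. v y + w y) = l v + l w"
    and l_scale: "\<And>c v. continuous_on D v \<Longrightarrow> l (\<lambda>y. c * v y) = c * l v"
    and l_bound: "\<And>v B. continuous_on D v \<Longrightarrow> (\<And>y. y \<in> D \<Longrightarrow> norm (v y) \<le> B) \<Longrightarrow> norm (l v) \<le> 2 * B"
    and l_poly: "\<And>p. p \<in> hol_polys2 \<Longrightarrow> l p = 0"
    and a0: "a0 \<in> Bad" and l_a0: "l (\<lambda>y. 1 / (fst y - a0)) \<noteq> 0"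
begin

lemma Bad_ne: "Bad \<noteq> {}" using a0 by blast

lemma Bad_F: "\<xi> \<in> Bad \<Longrightarrow> y \<in> D \<Longrightarrow> fst y \<noteq> \<xi>"
  by (auto simp: Bad_def F_def)

lemma l_diff:
  assumes "continuous_on D v" "continuous_on D w" shows "l (\<lambda>y. v y - w y) = l v - l w"
proof -
  have "l (\<lambda>y. v y + (-1) * w y) = l v + l (\<lambda>y. (-1) * w y)"
    by (rule l_add) (intro assms continuous_intros)+
  then show ?thesis using l_scale[OF assms(2), of "-1"] by simp
qed

text \<open>\<open>l\<close> is applied to functions on the whole space; its norm bound makes it
  depend only on their values on \<open>D\<close>.\<close>

lemma l_cong: "(\<And>y. y \<in> D \<Longrightarrow> v y = w y) \<Longrightarrow> continuous_on D v \<Longrightarrow> l v = l w"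
proof -
  assume eq: "\<And>y. y \<in> D \<Longrightarrow> v y = w y" and v: "continuous_on D v"
  have w: "continuous_on D w" using continuous_on_cong[of D D v w] eq v by simp
  have "norm (l (\<lambda>y. v y - w y)) \<le> 2 * 0"
    by (rule l_bound) (use eq v w in \<open>auto intro: continuous_intros\<close>)
  then show ?thesis using l_diff[OF v w] by simp
qed

lemma l_papprox:
  assumes "papprox D u" "continuous_on D u" shows "l u = 0"
proof (rule ccontr)
  assume "l u \<noteq> 0"
  then have "norm (l u) / 4 > 0" by simp
  then obtain p where p: "p \<in> hol_polys2" "\<And>y. y \<in> D \<Longrightarrow> norm (p y - u y) < norm (l u) / 4"
    using assms(1) unfolding papprox_def by blast
  have pc: "continuous_on D p" by (rule continuous_on_hol_polys2[OF p(1)])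
  have "norm (l (\<lambda>y. p y - u y)) \<le> 2 * (norm (l u) / 4)"
    by (rule l_bound) (use p pc assms(2) in \<open>auto intro!: continuous_intros less_imp_le\<close>)
  then show False using l_diff[OF pc assms(2)] l_poly[OF p(1)] \<open>l u \<noteq> 0\<close> by simp
qed

text \<open>If \<open>l\<close> is integration against a measure, this is the Cauchy transform of
  \<open>p\<close> times that measure, pushed to the plane by \<open>fst\<close>.\<close>

definition C :: "(complex \<times> complex \<Rightarrow> complex) \<Rightarrow> complex \<Rightarrow> complex" where
  "C p \<xi> = l (\<lambda>y. p y / (fst y - \<xi>))"

lemma C_cont: "continuous_on D p \<Longrightarrow> \<xi> \<in> Bad \<Longrightarrow> continuous_on D (\<lambda>y. p y / (fst y - \<xi>))"
  using Bad_F by (intro continuous_intros) auto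

lemma C_add:
  assumes "continuous_on D p" "continuous_on D q" "\<xi> \<in> Bad"
  shows "C (\<lambda>y. p y + q y) \<xi> = C p \<xi> + C q \<xi>"
  unfolding C_def add_divide_distrib by (intro l_add C_cont assms)

lemma C_diff:
  assumes "continuous_on D p" "continuous_on D q" "\<xi> \<in> Bad"
  shows "C (\<lambda>y. p y - q y) \<xi> = C p \<xi> - C q \<xi>"
  unfolding C_def diff_divide_distrib by (intro l_diff C_cont assms)

lemma C_scale:
  assumes "continuous_on D p" "\<xi> \<in> Bad"
  shows "C (\<lambda>y. c * p y) \<xi> = c * C p \<xi>"
proof -
  have "(\<lambda>y. c * p y / (fst y - \<xi>)) = (\<lambda>y. c * (p y / (fst y - \<xi>)))" by simp
  then show ?thesis unfolding C_def by (simp only: l_scale[OF C_cont[OF assms]])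
qed

lemma C_bound:
  assumes "continuous_on D p" "\<xi> \<in> Bad" "d > 0" "\<And>y. y \<in> D \<Longrightarrow> d \<le> norm (fst y - \<xi>)"
    "\<And>y. y \<in> D \<Longrightarrow> norm (p y) \<le> B" "B \<ge> 0"
  shows "norm (C p \<xi>) \<le> 2 * (B / d)"
  unfolding C_def
proof (rule l_bound[OF C_cont[OF assms(1,2)]])
  show "norm (p y / (fst y - \<xi>)) \<le> B / d" if "y \<in> D" for y
    unfolding norm_divide using assms that by (intro frac_le) auto
qed

lemma dist_Bad:
  assumes "\<xi> \<in> Bad" obtains d where "d > 0" "\<And>y. y \<in> D \<Longrightarrow> d \<le> norm (fst y - \<xi>)"
  using separated_from_fibre[OF compact_D, of \<xi>] Bad_F[OF assms] unfolding dist_norm by blast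

lemma D_bound:
  assumes "continuous_on D p" obtains B where "B > 0" "\<And>y. y \<in> D \<Longrightarrow> norm (p y :: complex) \<le> B"
proof -
  have "bounded (p ` D)" by (intro compact_imp_bounded compact_continuous_image assms compact_D)
  then show ?thesis using that by (auto simp: bounded_pos)
qed

text \<open>As \<xi> has positive distance from \<open>F\<close>, the difference quotients of the
  kernel converge uniformly on \<open>D\<close>; the derivative has the squared denominator.\<close>

lemma C_holomorphic:
  assumes p: "continuous_on D p" shows "C p holomorphic_on Bad"
proof (rule holomorphic_onI)
  fix \<xi> assume \<xi>: "\<xi> \<in> Bad"
  obtain d where d: "d > 0" "\<And>y. y \<in> D \<Longrightarrow> d \<le> norm (fst y - \<xi>)" using dist_Bad[OF \<xi>] by blast
  obtain B where B: "B > 0" "\<And>y. y \<in> D \<Longrightarrow> norm (p y) \<le> B" using D_bound[OF p] by blast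
  obtain e where e: "e > 0" "ball \<xi> e \<subseteq> Bad" using open_Bad \<xi> openE by blast
  define C2 where "C2 = l (\<lambda>y. p y / (fst y - \<xi>) / (fst y - \<xi>))"
  have c1: "continuous_on D (\<lambda>y. p y / (fst y - \<xi>))" by (rule C_cont[OF p \<xi>])
  have est: "norm ((C p \<eta> - C p \<xi>) / (\<eta> - \<xi>) - C2) \<le> (4 * B / d ^ 3) * norm (\<eta> - \<xi>)"
    if \<eta>: "\<eta> \<noteq> \<xi>" "dist \<eta> \<xi> < min e (d/2)" for \<eta>
  proof -
    have \<eta>B: "\<eta> \<in> Bad" using \<eta> e by (auto simp: dist_commute)
    have far: "d / 2 \<le> norm (fst y - \<eta>)" if "y \<in> D" for y
      using d(2)[OF that] \<eta>(2) norm_triangle_ineq[of "fst y - \<eta>" "\<eta> - \<xi>"] by (simp add: dist_norm)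
    have cd: "continuous_on D (\<lambda>y. p y / (fst y - \<eta>) - p y / (fst y - \<xi>))"
      by (intro continuous_on_diff C_cont p \<eta>B \<xi>)
    have "(C p \<eta> - C p \<xi>) / (\<eta> - \<xi>) - C2 =
        l (\<lambda>y. (1 / (\<eta> - \<xi>)) * (p y / (fst y - \<eta>) - p y / (fst y - \<xi>)) - p y / (fst y - \<xi>) / (fst y - \<xi>))"
      using l_diff[OF continuous_on_mult_left[OF cd, of "1 / (\<eta> - \<xi>)"] C_cont[OF c1 \<xi>]]
        l_scale[OF cd, of "1 / (\<eta> - \<xi>)"] l_diff[OF C_cont[OF p \<eta>B] c1]
      unfolding C_def C2_def by (metis (no_types, lifting) mult.left_neutral times_divide_eq_left)
    also have "norm \<dots> \<le> 2 * (2 * B / d ^ 3 * norm (\<eta> - \<xi>))"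
    proof (rule l_bound)
      show "continuous_on D (\<lambda>y. (1 / (\<eta> - \<xi>)) * (p y / (fst y - \<eta>) - p y / (fst y - \<xi>)) - p y / (fst y - \<xi>) / (fst y - \<xi>))"
        by (intro continuous_on_diff continuous_on_mult_left C_cont p \<eta>B \<xi>)
      fix y assume y: "y \<in> D"
      have nz: "fst y - \<eta> \<noteq> 0" "fst y - \<xi> \<noteq> 0" "\<eta> - \<xi> \<noteq> 0" using Bad_F[OF \<eta>B y] Bad_F[OF \<xi> y] \<eta> by auto
      have "(1 / (\<eta> - \<xi>)) * (p y / (fst y - \<eta>) - p y / (fst y - \<xi>)) - p y / (fst y - \<xi>) / (fst y - \<xi>)
        = p y * (\<eta> - \<xi>) / ((fst y - \<eta>) * ((fst y - \<xi>) * (fst y - \<xi>)))"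
      proof -
        have "p y / (fst y - \<eta>) - p y / (fst y - \<xi>) = p y * (\<eta> - \<xi>) / ((fst y - \<eta>) * (fst y - \<xi>))"
          using nz(1,2) by (simp add: divide_simps) (simp add: algebra_simps)
        then have "(1 / (\<eta> - \<xi>)) * (p y / (fst y - \<eta>) - p y / (fst y - \<xi>)) = p y / ((fst y - \<eta>) * (fst y - \<xi>))"
          using nz(3) by simp
        moreover have "p y / ((fst y - \<eta>) * (fst y - \<xi>)) - p y / (fst y - \<xi>) / (fst y - \<xi>)
            = p y * (\<eta> - \<xi>) / ((fst y - \<eta>) * ((fst y - \<xi>) * (fst y - \<xi>)))"
          using nz(1,2) by (simp add: divide_simps) (simp add: algebra_simps)
        ultimately show ?thesis by simp
      qed
      also have "norm \<dots> = norm (p y) * norm (\<eta> - \<xi>) / (norm (fst y - \<eta>) * (norm (fst y - \<xi>) * norm (fst y - \<xi>)))"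
        by (simp add: norm_divide norm_mult)
      also have "\<dots> \<le> B * norm (\<eta> - \<xi>) / ((d / 2) * (d * d))"
        using B y d far[OF y] by (intro frac_le mult_mono mult_nonneg_nonneg mult_pos_pos) auto
      also have "\<dots> = 2 * B / d ^ 3 * norm (\<eta> - \<xi>)" by (simp add: power3_eq_cube mult_ac)
      finally show "norm ((1 / (\<eta> - \<xi>)) * (p y / (fst y - \<eta>) - p y / (fst y - \<xi>)) - p y / (fst y - \<xi>) / (fst y - \<xi>))
        \<le> 2 * B / d ^ 3 * norm (\<eta> - \<xi>)" .
    qed
    finally show ?thesis by simp
  qed
  have "((\<lambda>\<eta>. (C p \<eta> - C p \<xi>) / (\<eta> - \<xi>) - C2) \<longlongrightarrow> 0) (at \<xi>)"
  proof (rule Lim_null_comparison)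
    show "\<forall>\<^sub>F \<eta> in at \<xi>. norm ((C p \<eta> - C p \<xi>) / (\<eta> - \<xi>) - C2) \<le> (4 * B / d ^ 3) * norm (\<eta> - \<xi>)"
      unfolding eventually_at using est e d by (intro exI[of _ "min e (d/2)"]) auto
    have "((\<lambda>\<eta>. (4 * B / d ^ 3) * norm (\<eta> - \<xi>)) \<longlongrightarrow> (4 * B / d ^ 3) * norm (\<xi> - \<xi>)) (at \<xi>)"
      by (intro tendsto_intros)
    then show "((\<lambda>\<eta>. (4 * B / d ^ 3) * norm (\<eta> - \<xi>)) \<longlongrightarrow> 0) (at \<xi>)" by simp
  qed
  then have "((\<lambda>\<eta>. (C p \<eta> - C p \<xi>) / (\<eta> - \<xi>)) \<longlongrightarrow> C2) (at \<xi>)" by (simp only: Lim_null[symmetric])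
  then have "(C p has_field_derivative C2) (at \<xi>)" by (simp add: has_field_derivative_iff)
  then show "C p field_differentiable at \<xi> within Bad"
    by (meson field_differentiable_at_within field_differentiable_def)
qed

text \<open>For \<open>u = 1 / (fst - e)\<close> the quotient of \<open>u - u(\<xi>)\<close> by
  \<open>fst - \<xi>\<close> is a constant multiple of \<open>u\<close>. Its product with
  \<open>p\<close> lies in the closure of the polynomials and is annihilated, so \<open>u\<close>
  can be pulled out of the transform as its value at \<xi>.\<close>

lemma C_peak:
  assumes e: "e \<in> Good" and p: "papprox D p" "continuous_on D p" and \<xi>: "\<xi> \<in> Bad"
  shows "C (\<lambda>y. (s / (fst y - e)) ^ n * p y) \<xi> = (s / (\<xi> - e)) ^ n * C p \<xi>"
proof -
  have eF: "fst y \<noteq> e" if "y \<in> D" for y using e that Good_F by (auto simp: F_def)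
  have pe: "papprox D (\<lambda>y. 1 / (fst y - e))" using e by (simp add: Good_def resolv_def)
  have ce: "continuous_on D (\<lambda>y. 1 / (fst y - e))" using eF by (intro continuous_intros) auto
  have \<xi>e: "\<xi> \<noteq> e" using e \<xi> by (auto simp: Bad_def)
  have "papprox D (\<lambda>y. (s / (fst y - e)) ^ n * p y) \<and> continuous_on D (\<lambda>y. (s / (fst y - e)) ^ n * p y) \<and>
    C (\<lambda>y. (s / (fst y - e)) ^ n * p y) \<xi> = (s / (\<xi> - e)) ^ n * C p \<xi>"
  proof (induction n)
    case 0 then show ?case using p by simp
  next
    case (Suc n)
    define q where "q y = (s / (fst y - e)) ^ n * p y" for y
    have q: "papprox D q" "continuous_on D q" "C q \<xi> = (s / (\<xi> - e)) ^ n * C p \<xi>"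
      using Suc unfolding q_def by auto
    have eq: "(\<lambda>y. (s / (fst y - e)) ^ Suc n * p y) = (\<lambda>y. s * (1 / (fst y - e) * q y))"
      by (simp add: q_def fun_eq_iff)
    have pq: "papprox D (\<lambda>y. 1 / (fst y - e) * q y)" by (intro papprox_mult compact_D pe q)
    have cq: "continuous_on D (\<lambda>y. 1 / (fst y - e) * q y)" by (intro continuous_on_mult ce q)
    have "C (\<lambda>y. 1 / (fst y - e) * q y) \<xi> = (1 / (\<xi> - e)) * C q \<xi>"
    proof -
      have "C (\<lambda>y. 1 / (fst y - e) * q y) \<xi> - (1 / (\<xi> - e)) * C q \<xi>
        = C (\<lambda>y. 1 / (fst y - e) * q y - 1 / (\<xi> - e) * q y) \<xi>"
        by (simp only: C_diff[OF cq continuous_on_mult_left[OF q(2)] \<xi>] C_scale[OF q(2) \<xi>])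
      also have "\<dots> = l (\<lambda>y. (- 1 / (\<xi> - e)) * (1 / (fst y - e) * q y))"
        unfolding C_def
      proof (rule l_cong)
        fix y assume y: "y \<in> D"
        have nz: "fst y - e \<noteq> 0" "\<xi> - e \<noteq> 0" "fst y - \<xi> \<noteq> 0" using eF[OF y] \<xi>e Bad_F[OF \<xi> y] by auto
        have "1 / (fst y - e) - 1 / (\<xi> - e) = - ((fst y - \<xi>) / ((fst y - e) * (\<xi> - e)))"
          using nz(1,2) by (simp add: divide_simps)
        then have "(1 / (fst y - e) - 1 / (\<xi> - e)) / (fst y - \<xi>) = (- 1 / (\<xi> - e)) * (1 / (fst y - e))"
          using nz(3) by simp
        moreover have "(1 / (fst y - e) * q y - 1 / (\<xi> - e) * q y) / (fst y - \<xi>)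
          = ((1 / (fst y - e) - 1 / (\<xi> - e)) / (fst y - \<xi>)) * q y" by (simp add: algebra_simps diff_divide_distrib)
        ultimately show "(1 / (fst y - e) * q y - 1 / (\<xi> - e) * q y) / (fst y - \<xi>) = (- 1 / (\<xi> - e)) * (1 / (fst y - e) * q y)"
          by (simp only: mult.assoc)
      next
        show "continuous_on D (\<lambda>y. (1 / (fst y - e) * q y - 1 / (\<xi> - e) * q y) / (fst y - \<xi>))"
          by (intro C_cont[OF _ \<xi>] continuous_on_diff cq continuous_on_mult_left q)
      qed
      also have "\<dots> = (- 1 / (\<xi> - e)) * l (\<lambda>y. 1 / (fst y - e) * q y)" by (rule l_scale[OF cq])
      also have "l (\<lambda>y. 1 / (fst y - e) * q y) = 0" by (rule l_papprox[OF pq cq])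
      finally show ?thesis by simp
    qed
    then have "C (\<lambda>y. s * (1 / (fst y - e) * q y)) \<xi> = (s / (\<xi> - e)) ^ Suc n * C p \<xi>"
      unfolding C_scale[OF cq \<xi>] q(3) by simp
    then show ?case unfolding eq using papprox_mult[OF compact_D papprox_const pq] continuous_on_mult_left[OF cq] by blast
  qed
  then show ?thesis by blast
qed

text \<open>Multiplying by powers of the peak function \<open>s / (z - e)\<close> trades exponential growth of
  \<open>P n\<close> far from the fibre over \<open>z\<close> against a factor close to one near \<open>z\<close>.\<close>

lemma decay:
  assumes z: "z \<in> F" and P: "\<And>n. P n \<in> hol_polys2"
    and M: "M \<ge> 0" and R: "R \<ge> 1" and \<theta>: "0 < \<theta>" "\<theta> < 1" and \<delta>: "\<delta> > 0"
    and far: "\<And>n y. y \<in> D \<Longrightarrow> norm (P n y) \<le> M * R ^ n"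
    and near: "\<And>n y. y \<in> D \<Longrightarrow> dist (fst y) z < \<delta> \<Longrightarrow> norm (P n y) \<le> M * \<theta> ^ n"
  shows "\<exists>\<epsilon>>0. \<exists>\<tau>. 0 < \<tau> \<and> \<tau> < 1 \<and> (\<forall>\<xi>\<in>Bad \<inter> ball z \<epsilon>. \<forall>d>0. (\<forall>y\<in>D. d \<le> norm (fst y - \<xi>)) \<longrightarrow>
    (\<forall>n. norm (C (P n) \<xi>) \<le> (2 * M / d) * \<tau> ^ n))"
proof -
  obtain sd d0 where sd: "d0 > 0" "ball z d0 \<inter> side (\<not> sd) \<subseteq> Good" using two_sides[OF Bad_ne z] by blast
  have zE: "z \<in> E" using z F_E by blast
  \<comment> \<open>The tangent disc is taken on the side of the resolvent points, as
    \<open>C_peak\<close> requires of its centre.\<close>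
  obtain e where e: "e \<in> ball z d0" "e \<noteq> z" "e \<in> side (\<not> sd)" "\<And>z'. z' \<in> E - {z} \<Longrightarrow> dist z e < dist z' e"
    using side_disc[OF zE sd(1), of "\<not> sd"] by blast
  have eG: "e \<in> Good" using e sd by blast
  define s where "s = dist z e"
  have s: "s > 0" using e(2) by (simp add: s_def)
  have eF: "\<And>z'. z' \<in> F - {z} \<Longrightarrow> dist z e < dist z' e" using e(4) F_E by blast
  obtain k where k: "0 < k" "k < 1" "\<And>y. y \<in> D \<Longrightarrow> \<delta> \<le> dist (fst y) z \<Longrightarrow> s / dist (fst y) e \<le> k"
    using peak[OF eF e(2)[symmetric] \<delta>] unfolding s_def by blast
  \<comment> \<open>\<open>N\<close> peak factors for each step of \<open>n\<close> bring the growth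
    rate \<open>R\<close> away from the fibre down to \<theta>.\<close>
  obtain N where N: "k ^ N < \<theta> / R" using real_arch_pow_inv[of "\<theta> / R" k] k R \<theta> by auto
  have le1: "s / dist (fst y) e \<le> 1" if "y \<in> D" for y
  proof (cases "fst y = z")
    case True then show ?thesis using s by (simp add: s_def)
  next
    case False
    then have "s < dist (fst y) e" using eF[of "fst y"] that by (auto simp: s_def F_def)
    then show ?thesis using s pos_divide_le_eq[of "dist (fst y) e" s 1] by linarith
  qed
  \<comment> \<open>Dividing the peak power off at \<xi> costs the factor
    \<open>(dist \<xi> e / s) ^ N\<close> per step, which is 1 at \<open>z\<close>; a rate between
    \<theta> and 1 absorbs it near \<open>z\<close>.\<close>
  define \<tau> where "\<tau> = (1 + \<theta>) / 2"
  have \<tau>: "0 < \<tau>" "\<tau> < 1" "\<theta> < \<tau>" using \<theta> by (auto simp: \<tau>_def)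
  have "isCont (\<lambda>\<xi>. \<theta> * (dist \<xi> e / s) ^ N) z" by (intro continuous_intros) (use s in auto)
  then have "((\<lambda>\<xi>. \<theta> * (dist \<xi> e / s) ^ N) \<longlongrightarrow> \<theta> * (dist z e / s) ^ N) (nhds z)"
    unfolding isCont_def using tendsto_at_iff_tendsto_nhds[of "\<lambda>\<xi>. \<theta> * (dist \<xi> e / s) ^ N" z] by simp
  moreover have "\<theta> * (dist z e / s) ^ N < \<tau>" using \<tau> s by (simp add: s_def)
  ultimately have "\<forall>\<^sub>F \<xi> in nhds z. \<theta> * (dist \<xi> e / s) ^ N < \<tau>" by (rule order_tendstoD(2))
  then obtain \<epsilon> where \<epsilon>: "\<epsilon> > 0" "\<And>\<xi>. dist \<xi> z < \<epsilon> \<Longrightarrow> \<theta> * (dist \<xi> e / s) ^ N < \<tau>"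
    unfolding eventually_nhds_metric by blast
  have main: "norm (C (P n) \<xi>) \<le> (2 * M / d) * \<tau> ^ n"
    if \<xi>: "\<xi> \<in> Bad" "dist \<xi> z < \<epsilon>" and d: "d > 0" "\<And>y. y \<in> D \<Longrightarrow> d \<le> norm (fst y - \<xi>)" for \<xi> d n
  proof -
    define u where "u y = (of_real s / (fst y - e)) ^ (N * n) * P n y" for y
    have Pc: "continuous_on D (P n)" by (rule continuous_on_hol_polys2[OF P])
    have uc: "continuous_on D u" unfolding u_def using eG Good_F
      by (intro continuous_intros Pc) (auto simp: F_def)
    have ub: "norm (u y) \<le> M * \<theta> ^ n" if y: "y \<in> D" for y
    proof -
      have nu: "norm (u y) = ((s / dist (fst y) e) ^ N) ^ n * norm (P n y)"
        using s by (simp add: u_def norm_mult norm_power norm_divide dist_norm power_mult)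
      have r0: "0 \<le> s / dist (fst y) e" using s by simp
      show ?thesis
      proof (cases "dist (fst y) z < \<delta>")
        case True
        have "((s / dist (fst y) e) ^ N) ^ n \<le> 1" using r0 le1[OF y] by (intro power_le_one zero_le_power)
        then have "norm (u y) \<le> 1 * (M * \<theta> ^ n)"
          unfolding nu using near[OF y True] r0 M by (intro mult_mono) auto
        then show ?thesis by simp
      next
        case False
        have "(s / dist (fst y) e) ^ N \<le> k ^ N" using k(3)[OF y] False r0 by (intro power_mono) auto
        then have "(s / dist (fst y) e) ^ N \<le> \<theta> / R" using N by linarith
        then have "((s / dist (fst y) e) ^ N) ^ n \<le> (\<theta> / R) ^ n" using r0 by (intro power_mono) auto
        then have "norm (u y) \<le> (\<theta> / R) ^ n * (M * R ^ n)"
          unfolding nu using far[OF y, of n] r0 M \<theta> R by (intro mult_mono) auto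
        also have "\<dots> = M * \<theta> ^ n" using R by (simp add: power_divide)
        finally show ?thesis .
      qed
    qed
    have "norm (C u \<xi>) \<le> 2 * (M * \<theta> ^ n / d)"
      using C_bound[OF uc \<xi>(1) d ub] M \<theta> by simp
    moreover have "C u \<xi> = (of_real s / (\<xi> - e)) ^ (N * n) * C (P n) \<xi>"
      unfolding u_def by (rule C_peak[OF eG papprox_poly[OF P] Pc \<xi>(1)])
    ultimately have *: "(s / dist \<xi> e) ^ (N * n) * norm (C (P n) \<xi>) \<le> 2 * (M * \<theta> ^ n / d)"
      using s by (simp add: norm_mult norm_power norm_divide dist_norm)
    have de: "dist \<xi> e > 0" using \<xi>(1) eG by (auto simp: Bad_def)
    have inv: "(dist \<xi> e / s) ^ (N * n) * (s / dist \<xi> e) ^ (N * n) = 1"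
      unfolding power_mult_distrib[symmetric] using s de by simp
    have "norm (C (P n) \<xi>) = (dist \<xi> e / s) ^ (N * n) * ((s / dist \<xi> e) ^ (N * n) * norm (C (P n) \<xi>))"
      unfolding mult.assoc[symmetric] inv by simp
    also have "\<dots> \<le> (dist \<xi> e / s) ^ (N * n) * (2 * (M * \<theta> ^ n / d))"
      using * s by (intro mult_left_mono) auto
    also have "\<dots> = (2 * M / d) * (\<theta> * (dist \<xi> e / s) ^ N) ^ n"
      by (simp add: power_mult power_mult_distrib)
    also have "\<dots> \<le> (2 * M / d) * \<tau> ^ n"
      using \<epsilon>(2)[OF \<xi>(2)] \<theta> s M d(1) by (intro mult_left_mono power_mono) auto
    finally show ?thesis .
  qed
  show ?thesis
    using main \<epsilon>(1) \<tau> by (intro exI[of _ \<epsilon>] conjI exI[of _ \<tau>]) (simp_all add: dist_commute)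
qed

end

section \<open>Sheets of the disc\<close>

context annihilator begin

text \<open>The function \<open>u\<close> matters only near the fibre over \<open>z\<close>, where \<open>C (P n)\<close> converges on \<open>Bad\<close>; the limit
  depends only on \<open>u\<close> and is its contribution to the Cauchy transform.\<close>

definition appr :: "complex \<Rightarrow> (complex \<times> complex \<Rightarrow> complex) \<Rightarrow> (nat \<Rightarrow> complex \<times> complex \<Rightarrow> complex) \<Rightarrow> bool" where
  "appr z u P \<longleftrightarrow> (\<forall>n. P n \<in> hol_polys2) \<and>
    (\<exists>M R \<theta> \<delta>. 0 \<le> M \<and> 1 \<le> R \<and> 0 < \<theta> \<and> \<theta> < 1 \<and> 0 < \<delta> \<and>
      (\<forall>n. \<forall>y\<in>D. norm (P n y) \<le> M * R ^ n) \<and>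
      (\<forall>n. \<forall>y\<in>D. dist (fst y) z < \<delta> \<longrightarrow> norm (P n y - u y) \<le> M * \<theta> ^ n))"

text \<open>One approximating sequence is asked for; by \<open>van_any\<close> the same then holds
  for every other one.\<close>

definition van :: "complex \<Rightarrow> (complex \<times> complex \<Rightarrow> complex) \<Rightarrow> bool" where
  "van z u \<longleftrightarrow> (\<exists>P \<epsilon>. appr z u P \<and> 0 < \<epsilon> \<and> (\<forall>\<xi>\<in>Bad \<inter> ball z \<epsilon>. (\<lambda>n. C (P n) \<xi>) \<longlonglongrightarrow> 0))"

lemma apprI:
  assumes "\<And>n. P n \<in> hol_polys2" "0 \<le> M" "1 \<le> R" "0 < \<theta>" "\<theta> < 1" "0 < \<delta>"
    "\<And>n y. y \<in> D \<Longrightarrow> norm (P n y) \<le> M * R ^ n"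
    "\<And>n y. y \<in> D \<Longrightarrow> dist (fst y) z < \<delta> \<Longrightarrow> norm (P n y - u y) \<le> M * \<theta> ^ n"
  shows "appr z u P"
  unfolding appr_def
  by (intro conjI allI exI[of _ M] exI[of _ R] exI[of _ \<theta>] exI[of _ \<delta>] ballI impI assms)

lemma apprE:
  assumes "appr z u P"
  obtains M R \<theta> \<delta> where "\<And>n. P n \<in> hol_polys2" "0 \<le> M" "1 \<le> R" "0 < \<theta>" "\<theta> < 1" "0 < \<delta>"
    "\<And>n y. y \<in> D \<Longrightarrow> norm (P n y) \<le> M * R ^ n"
    "\<And>n y. y \<in> D \<Longrightarrow> dist (fst y) z < \<delta> \<Longrightarrow> norm (P n y - u y) \<le> M * \<theta> ^ n"
proof -
  obtain M R \<theta> \<delta> where *: "0 \<le> M \<and> 1 \<le> R \<and> 0 < \<theta> \<and> \<theta> < 1 \<and> 0 < \<delta> \<and>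
      (\<forall>n. \<forall>y\<in>D. norm (P n y) \<le> M * R ^ n) \<and>
      (\<forall>n. \<forall>y\<in>D. dist (fst y) z < \<delta> \<longrightarrow> norm (P n y - u y) \<le> M * \<theta> ^ n)"
    using assms unfolding appr_def by (elim conjE exE) blast
  have 0: "\<And>n. P n \<in> hol_polys2" using assms unfolding appr_def by simp
  show ?thesis by (rule that[of M R \<theta> \<delta>, OF 0]) (use * in simp_all)
qed

lemma appr_poly: "appr z u P \<Longrightarrow> P n \<in> hol_polys2" by (simp add: appr_def)

lemma appr_cont: "appr z u P \<Longrightarrow> continuous_on D (P n)"
  by (rule continuous_on_hol_polys2[OF appr_poly])

lemma appr_add:
  assumes "appr z u P" "appr z v Q" shows "appr z (\<lambda>y. u y + v y) (\<lambda>n y. P n y + Q n y)"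
proof -
  from assms(1) obtain M1 R1 t1 d1 where 1: "\<And>n. P n \<in> hol_polys2" "0 \<le> M1" "1 \<le> R1" "0 < t1" "t1 < 1" "0 < d1"
    "\<And>n y. y \<in> D \<Longrightarrow> norm (P n y) \<le> M1 * R1 ^ n"
    "\<And>n y. y \<in> D \<Longrightarrow> dist (fst y) z < d1 \<Longrightarrow> norm (P n y - u y) \<le> M1 * t1 ^ n" by (rule apprE) (rule that)
  from assms(2) obtain M2 R2 t2 d2 where 2: "\<And>n. Q n \<in> hol_polys2" "0 \<le> M2" "1 \<le> R2" "0 < t2" "t2 < 1" "0 < d2"
    "\<And>n y. y \<in> D \<Longrightarrow> norm (Q n y) \<le> M2 * R2 ^ n"
    "\<And>n y. y \<in> D \<Longrightarrow> dist (fst y) z < d2 \<Longrightarrow> norm (Q n y - v y) \<le> M2 * t2 ^ n" by (rule apprE) (rule that)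
  have up: "M * a ^ n \<le> M * max a b ^ n" "M * b ^ n \<le> M * max a b ^ n" if "0 \<le> M" "0 \<le> a" "0 \<le> b" for M a b :: real and n
    using that by (auto intro!: mult_left_mono power_mono)
  show ?thesis
  proof (rule apprI[of _ "M1 + M2" "max R1 R2" "max t1 t2" "min d1 d2"])
    show "(\<lambda>y. P n y + Q n y) \<in> hol_polys2" for n by (intro hol_polys2_add 1 2)
    fix n y assume y: "y \<in> D"
    show "norm (P n y + Q n y) \<le> (M1 + M2) * max R1 R2 ^ n"
      using norm_triangle_ineq[of "P n y" "Q n y"] 1(7)[OF y, of n] 2(7)[OF y, of n] up(1)[of M1 R1 R2 n] up(2)[of M2 R1 R2 n] 1 2
      by (simp add: distrib_right)
    assume d: "dist (fst y) z < min d1 d2"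
    have eq: "P n y + Q n y - (u y + v y) = (P n y - u y) + (Q n y - v y)" by simp
    have "dist (fst y) z < d1" "dist (fst y) z < d2" using d by auto
    then show "norm (P n y + Q n y - (u y + v y)) \<le> (M1 + M2) * max t1 t2 ^ n"
      unfolding eq distrib_right
      using norm_triangle_ineq[of "P n y - u y" "Q n y - v y"] 1(8)[OF y, of n] 2(8)[OF y, of n] up(1)[of M1 t1 t2 n] up(2)[of M2 t1 t2 n] 1(2-5) 2(2-5)
      by linarith
  qed (use 1 2 in auto)
qed

lemma appr_uminus:
  assumes "appr z u P" shows "appr z (\<lambda>y. - u y) (\<lambda>n y. - P n y)"
proof -
  from assms obtain M1 R1 t1 d1 where 1: "\<And>n. P n \<in> hol_polys2" "0 \<le> M1" "1 \<le> R1" "0 < t1" "t1 < 1" "0 < d1"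
    "\<And>n y. y \<in> D \<Longrightarrow> norm (P n y) \<le> M1 * R1 ^ n"
    "\<And>n y. y \<in> D \<Longrightarrow> dist (fst y) z < d1 \<Longrightarrow> norm (P n y - u y) \<le> M1 * t1 ^ n" by (rule apprE) (rule that)
  show ?thesis
  proof (rule apprI[of _ M1 R1 t1 d1])
    show "(\<lambda>y. - P n y) \<in> hol_polys2" for n
      using hol_polys2_mult[OF hol_polys2_const[of "-1"] 1(1)[of n]] by simp
    fix n y assume "y \<in> D"
    then show "norm (- P n y) \<le> M1 * R1 ^ n" "dist (fst y) z < d1 \<Longrightarrow> norm (- P n y - - u y) \<le> M1 * t1 ^ n"
      using 1(7,8)[of y n] by (simp_all add: norm_minus_commute)
  qed (use 1 in auto)
qed

lemma appr_cong:
  assumes "appr z u P" and d: "d > 0" "\<And>y. y \<in> D \<Longrightarrow> dist (fst y) z < d \<Longrightarrow> u y = v y"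
  shows "appr z v P"
proof -
  from assms(1) obtain M1 R1 t1 d1 where 1: "\<And>n. P n \<in> hol_polys2" "0 \<le> M1" "1 \<le> R1" "0 < t1" "t1 < 1" "0 < d1"
    "\<And>n y. y \<in> D \<Longrightarrow> norm (P n y) \<le> M1 * R1 ^ n"
    "\<And>n y. y \<in> D \<Longrightarrow> dist (fst y) z < d1 \<Longrightarrow> norm (P n y - u y) \<le> M1 * t1 ^ n" by (rule apprE) (rule that)
  show ?thesis
    by (rule apprI[of _ M1 R1 t1 "min d d1"]) (use 1 d in \<open>simp_all add: d(2)[symmetric]\<close>)
qed

lemma appr_move:
  assumes "appr z u P"
  shows "\<exists>r>0. \<forall>z'\<in>ball z r. appr z' u P"
proof -
  from assms(1) obtain M1 R1 t1 d1 where 1: "\<And>n. P n \<in> hol_polys2" "0 \<le> M1" "1 \<le> R1" "0 < t1" "t1 < 1" "0 < d1"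
    "\<And>n y. y \<in> D \<Longrightarrow> norm (P n y) \<le> M1 * R1 ^ n"
    "\<And>n y. y \<in> D \<Longrightarrow> dist (fst y) z < d1 \<Longrightarrow> norm (P n y - u y) \<le> M1 * t1 ^ n" by (rule apprE) (rule that)
  have "appr z' u P" if z': "z' \<in> ball z (d1/2)" for z'
  proof (rule apprI[of _ M1 R1 t1 "d1/2"])
    fix n y assume y: "y \<in> D" "dist (fst y) z' < d1 / 2"
    then have "dist (fst y) z < d1" using z' dist_triangle[of "fst y" z z'] by (simp add: dist_commute)
    then show "norm (P n y - u y) \<le> M1 * t1 ^ n" by (rule 1(8)[OF y(1)])
  qed (use 1 in auto)
  then show ?thesis using 1(6) by (intro exI[of _ "d1/2"]) auto
qed

lemma appr_zero_limit:
  assumes "appr z (\<lambda>_. 0) P" "z \<in> F"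
  shows "\<exists>\<epsilon>>0. \<forall>\<xi>\<in>Bad \<inter> ball z \<epsilon>. (\<lambda>n. C (P n) \<xi>) \<longlonglongrightarrow> 0"
proof -
  from assms(1) obtain M R t d where 1: "\<And>n. P n \<in> hol_polys2" "0 \<le> M" "1 \<le> R" "0 < t" "t < 1" "0 < d"
    "\<And>n y. y \<in> D \<Longrightarrow> norm (P n y) \<le> M * R ^ n"
    "\<And>n y. y \<in> D \<Longrightarrow> dist (fst y) z < d \<Longrightarrow> norm (P n y - 0) \<le> M * t ^ n" by (rule apprE) (rule that)
  have near: "\<And>n y. y \<in> D \<Longrightarrow> dist (fst y) z < d \<Longrightarrow> norm (P n y) \<le> M * t ^ n" using 1(8) by simp
  from decay[OF assms(2) 1(1-7) near] obtain \<epsilon> \<tau> where \<epsilon>: "\<epsilon> > 0" "0 < \<tau>" "\<tau> < 1"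
    "\<forall>\<xi>\<in>Bad \<inter> ball z \<epsilon>. \<forall>d>0. (\<forall>y\<in>D. d \<le> norm (fst y - \<xi>)) \<longrightarrow> (\<forall>n. norm (C (P n) \<xi>) \<le> (2 * M / d) * \<tau> ^ n)"
    by blast
  have "(\<lambda>n. C (P n) \<xi>) \<longlonglongrightarrow> 0" if \<xi>: "\<xi> \<in> Bad \<inter> ball z \<epsilon>" for \<xi>
  proof -
    obtain d' where d': "d' > 0" "\<And>y. y \<in> D \<Longrightarrow> d' \<le> norm (fst y - \<xi>)" using dist_Bad[of \<xi>] \<xi> by blast
    have "(\<lambda>n. (2 * M / d') * \<tau> ^ n) \<longlonglongrightarrow> (2 * M / d') * 0"
      using \<epsilon> by (intro tendsto_intros LIMSEQ_power_zero) auto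
    then have lim: "(\<lambda>n. (2 * M / d') * \<tau> ^ n) \<longlonglongrightarrow> 0" by simp
    have "\<forall>n. norm (C (P n) \<xi>) \<le> (2 * M / d') * \<tau> ^ n" using \<epsilon>(4) \<xi> d' by blast
    then show ?thesis by (intro Lim_null_comparison[OF _ lim]) simp
  qed
  then show ?thesis using \<epsilon>(1) by blast
qed

text \<open>The difference of two sequences for \<open>u\<close> is a sequence for the zero
  function, whose transforms tend to 0 by \<open>decay\<close>.\<close>

lemma van_any:
  assumes "van z u" "appr z u Q" "z \<in> F"
  shows "\<exists>\<epsilon>>0. \<forall>\<xi>\<in>Bad \<inter> ball z \<epsilon>. (\<lambda>n. C (Q n) \<xi>) \<longlonglongrightarrow> 0"
proof -
  obtain P \<epsilon>1 where P: "appr z u P" "\<epsilon>1 > 0" "\<And>\<xi>. \<xi> \<in> Bad \<inter> ball z \<epsilon>1 \<Longrightarrow> (\<lambda>n. C (P n) \<xi>) \<longlonglongrightarrow> 0"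
    using assms(1) unfolding van_def by blast
  have "appr z (\<lambda>y. u y + - u y) (\<lambda>n y. Q n y + - P n y)" by (intro appr_add appr_uminus assms P)
  then have "appr z (\<lambda>_. 0) (\<lambda>n y. Q n y - P n y)" by simp
  from appr_zero_limit[OF this assms(3)] obtain \<epsilon>2 where \<epsilon>2: "\<epsilon>2 > 0"
    "\<And>\<xi>. \<xi> \<in> Bad \<inter> ball z \<epsilon>2 \<Longrightarrow> (\<lambda>n. C (\<lambda>y. Q n y - P n y) \<xi>) \<longlonglongrightarrow> 0" by blast
  have "(\<lambda>n. C (Q n) \<xi>) \<longlonglongrightarrow> 0" if "\<xi> \<in> Bad \<inter> ball z (min \<epsilon>1 \<epsilon>2)" for \<xi>
  proof -
    have "(\<lambda>n. C (\<lambda>y. Q n y - P n y) \<xi> + C (P n) \<xi>) \<longlonglongrightarrow> 0 + 0"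
      using that by (intro tendsto_add \<epsilon>2(2) P(3)) auto
    moreover have "C (\<lambda>y. Q n y - P n y) \<xi> + C (P n) \<xi> = C (Q n) \<xi>" for n
      using C_diff[OF appr_cont[OF assms(2)] appr_cont[OF P(1)], of \<xi> n n] that by simp
    ultimately show ?thesis by simp
  qed
  then show ?thesis using P(2) \<epsilon>2(1) by (intro exI[of _ "min \<epsilon>1 \<epsilon>2"]) auto
qed

lemma van_cong:
  assumes "van z u" "d > 0" "\<And>y. y \<in> D \<Longrightarrow> dist (fst y) z < d \<Longrightarrow> u y = v y"
  shows "van z v"
proof -
  obtain P \<epsilon>1 where P: "appr z u P" "\<epsilon>1 > 0" "\<forall>\<xi>\<in>Bad \<inter> ball z \<epsilon>1. (\<lambda>n. C (P n) \<xi>) \<longlonglongrightarrow> 0"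
    using assms(1) unfolding van_def by blast
  show ?thesis unfolding van_def using appr_cong[OF P(1) assms(2,3)] P(2,3) by blast
qed

lemma van_move:
  assumes "van z u" shows "\<exists>r>0. \<forall>z'\<in>ball z r. van z' u"
proof -
  obtain P \<epsilon>1 where P: "appr z u P" "\<epsilon>1 > 0" "\<forall>\<xi>\<in>Bad \<inter> ball z \<epsilon>1. (\<lambda>n. C (P n) \<xi>) \<longlonglongrightarrow> 0"
    using assms(1) unfolding van_def by blast
  obtain r where r: "r > 0" "\<And>z'. z' \<in> ball z r \<Longrightarrow> appr z' u P" using appr_move[OF P(1)] by blast
  have "van z' u" if z': "z' \<in> ball z (min r (\<epsilon>1 / 2))" for z'
  proof -
    have "ball z' (\<epsilon>1 / 2) \<subseteq> ball z \<epsilon>1"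
    proof
      fix x assume "x \<in> ball z' (\<epsilon>1 / 2)"
      then show "x \<in> ball z \<epsilon>1" using z' dist_triangle[of z x z'] by simp
    qed
    then show ?thesis unfolding van_def using r(2)[of z'] z' P(2,3) by (intro exI[of _ P] exI[of _ "\<epsilon>1/2"]) auto
  qed
  then show ?thesis using r(1) P(2) by (intro exI[of _ "min r (\<epsilon>1 / 2)"]) auto
qed

lemma appr_zero: "appr z (\<lambda>_. 0) (\<lambda>_ _. 0)"
  by (rule apprI[of _ 0 1 "1/2" 1]) (auto intro: hol_polys2_const)

lemma C_zero: "C (\<lambda>_. 0) \<xi> = 0"
  unfolding C_def using l_poly[OF hol_polys2_const[of 0]] by simp

lemma van_zero: "van z (\<lambda>_. 0)"
  unfolding van_def using appr_zero[of z] C_zero by (intro exI[of _ "\<lambda>_ _. 0"] exI[of _ 1]) auto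

lemma van_add:
  assumes "van z u" "van z v" shows "van z (\<lambda>y. u y + v y)"
proof -
  obtain P \<epsilon>1 where P: "appr z u P" "\<epsilon>1 > 0" "\<And>\<xi>. \<xi> \<in> Bad \<inter> ball z \<epsilon>1 \<Longrightarrow> (\<lambda>n. C (P n) \<xi>) \<longlonglongrightarrow> 0"
    using assms(1) unfolding van_def by blast
  obtain Q \<epsilon>2 where Q: "appr z v Q" "\<epsilon>2 > 0" "\<And>\<xi>. \<xi> \<in> Bad \<inter> ball z \<epsilon>2 \<Longrightarrow> (\<lambda>n. C (Q n) \<xi>) \<longlonglongrightarrow> 0"
    using assms(2) unfolding van_def by blast
  have "(\<lambda>n. C (\<lambda>y. P n y + Q n y) \<xi>) \<longlonglongrightarrow> 0" if "\<xi> \<in> Bad \<inter> ball z (min \<epsilon>1 \<epsilon>2)" for \<xi>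
  proof -
    have "(\<lambda>n. C (P n) \<xi> + C (Q n) \<xi>) \<longlonglongrightarrow> 0 + 0" using that by (intro tendsto_add P(3) Q(3)) auto
    moreover have "C (\<lambda>y. P n y + Q n y) \<xi> = C (P n) \<xi> + C (Q n) \<xi>" for n
      using C_add[OF appr_cont[OF P(1)] appr_cont[OF Q(1)]] that by simp
    ultimately show ?thesis by simp
  qed
  then show ?thesis unfolding van_def using appr_add[OF P(1) Q(1)] P(2) Q(2)
    by (intro exI[of _ "\<lambda>n y. P n y + Q n y"] exI[of _ "min \<epsilon>1 \<epsilon>2"]) auto
qed

lemma van_sum:
  assumes "finite I" "\<And>i. i \<in> I \<Longrightarrow> van z (u i)" shows "van z (\<lambda>y. \<Sum>i\<in>I. u i y)"
  using assms by (induction I rule: finite_induct) (auto intro: van_zero van_add)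

text \<open>The limit of \<open>C (P n)\<close> is holomorphic on the connected one-sided neighbourhood of \<open>z\<close>
  in \<open>Bad\<close>, so vanishing spreads by the identity theorem.\<close>

lemma van_continue:
  assumes z: "z \<in> F" and P: "appr z u P"
  shows "\<exists>r>0. \<forall>z'\<in>F \<inter> ball z r. van z' u \<longrightarrow> van z u"
proof -
  from P obtain M R t d where 1: "\<And>n. P n \<in> hol_polys2" "0 \<le> M" "1 \<le> R" "0 < t" "t < 1" "0 < d"
    "\<And>n y. y \<in> D \<Longrightarrow> norm (P n y) \<le> M * R ^ n"
    "\<And>n y. y \<in> D \<Longrightarrow> dist (fst y) z < d \<Longrightarrow> norm (P n y - u y) \<le> M * t ^ n" by (rule apprE) (rule that)
  \<comment> \<open>The increments are geometrically small near the fibre, so \<open>decay\<close>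
    applies to them and the telescoping series of their transforms converges locally
    uniformly.\<close>
  define Q where "Q n y = P (Suc n) y - P n y" for n y
  define M' where "M' = M * R + 2 * M"
  have Qp: "Q n \<in> hol_polys2" for n unfolding Q_def by (intro hol_polys2_diff 1)
  have M': "M' \<ge> 0" using 1 by (simp add: M'_def)
  have Q1: "norm (Q n y) \<le> M' * R ^ n" if y: "y \<in> D" for n y
  proof -
    have "norm (Q n y) \<le> norm (P (Suc n) y) + norm (P n y)" unfolding Q_def by (rule norm_triangle_ineq4)
    also have "\<dots> \<le> M * R ^ Suc n + M * R ^ n" by (intro add_mono 1(7) y)
    also have "\<dots> \<le> M' * R ^ n" using 1(2,3) by (simp add: M'_def algebra_simps)
    finally show ?thesis .
  qed
  have Q2: "norm (Q n y) \<le> M' * t ^ n" if y: "y \<in> D" "dist (fst y) z < d" for n y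
  proof -
    have "Q n y = (P (Suc n) y - u y) - (P n y - u y)" by (simp add: Q_def)
    then have "norm (Q n y) \<le> norm (P (Suc n) y - u y) + norm (P n y - u y)" using norm_triangle_ineq4 by metis
    also have "\<dots> \<le> M * t ^ Suc n + M * t ^ n" by (intro add_mono 1(8) y)
    also have "\<dots> \<le> M * t ^ n + M * t ^ n" using 1(2,4,5) by (intro add_mono mult_left_mono) (auto intro: mult_left_le_one_le)
    also have "\<dots> \<le> M' * t ^ n" using 1(2-5) by (simp add: M'_def algebra_simps)
    finally show ?thesis .
  qed
  from decay[OF z Qp M' 1(3-6) Q1 Q2] obtain \<epsilon> \<tau> where \<epsilon>: "\<epsilon> > 0" "0 < \<tau>" "\<tau> < 1"
    "\<forall>\<xi>\<in>Bad \<inter> ball z \<epsilon>. \<forall>d>0. (\<forall>y\<in>D. d \<le> norm (fst y - \<xi>)) \<longrightarrow> (\<forall>n. norm (C (Q n) \<xi>) \<le> (2 * M' / d) * \<tau> ^ n)"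
    by blast
  define W where "W = Bad \<inter> ball z \<epsilon>"
  have oW: "open W" unfolding W_def by (intro open_Int open_Bad open_ball)
  define \<Phi> where "\<Phi> \<xi> = C (P 0) \<xi> + (\<Sum>n. C (Q n) \<xi>)" for \<xi>
  have tele: "C (P n) \<xi> = C (P 0) \<xi> + (\<Sum>i<n. C (Q i) \<xi>)" if "\<xi> \<in> Bad" for n \<xi>
  proof (induction n)
    case (Suc n)
    have "C (Q n) \<xi> = C (P (Suc n)) \<xi> - C (P n) \<xi>"
      unfolding Q_def by (intro C_diff continuous_on_hol_polys2 1 that)
    then show ?case using Suc by simp
  qed simp
  have unif: "\<exists>e>0. cball \<xi> e \<subseteq> W \<and> uniform_limit (cball \<xi> e) (\<lambda>n. C (P n)) \<Phi> sequentially" if \<xi>: "\<xi> \<in> W" for \<xi>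
  proof -
    obtain e1 where e1: "e1 > 0" "cball \<xi> e1 \<subseteq> W" using oW \<xi> open_contains_cball by blast
    have "\<xi> \<in> Bad" using \<xi> by (simp add: W_def)
    then obtain d' where d': "d' > 0" "\<And>y. y \<in> D \<Longrightarrow> d' \<le> norm (fst y - \<xi>)" using dist_Bad by blast
    \<comment> \<open>The whole disc keeps distance at least \<open>d' / 2\<close> from
      \<open>F\<close>, so one majorant serves all its points.\<close>
    define e where "e = min e1 (d' / 2)"
    have sub: "cball \<xi> e \<subseteq> W" using e1 subset_cball[of e e1 \<xi>] by (auto simp: e_def)
    have "uniform_limit (cball \<xi> e) (\<lambda>n x. \<Sum>i<n. C (Q i) x) (\<lambda>x. \<Sum>i. C (Q i) x) sequentially"
    proof (rule Weierstrass_m_test)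
      show "summable (\<lambda>n. (2 * M' / (d' / 2)) * \<tau> ^ n)" using \<epsilon> by (intro summable_mult summable_geometric) auto
      fix n x assume x: "x \<in> cball \<xi> e"
      have "\<forall>y\<in>D. d' / 2 \<le> norm (fst y - x)"
      proof
        fix y assume "y \<in> D"
        then have "d' \<le> norm (fst y - \<xi>)" by (rule d')
        also have "\<dots> \<le> norm (fst y - x) + norm (x - \<xi>)" using norm_triangle_ineq[of "fst y - x" "x - \<xi>"] by simp
        finally show "d' / 2 \<le> norm (fst y - x)" using x by (simp add: e_def dist_norm norm_minus_commute)
      qed
      moreover have "x \<in> Bad \<inter> ball z \<epsilon>" using sub x by (auto simp: W_def)
      moreover have "d' / 2 > 0" using d' by simp
      ultimately show "norm (C (Q n) x) \<le> (2 * M' / (d' / 2)) * \<tau> ^ n" using \<epsilon>(4) by blast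
    qed
    then have "uniform_limit (cball \<xi> e) (\<lambda>n x. C (P 0) x + (\<Sum>i<n. C (Q i) x)) \<Phi> sequentially"
      unfolding \<Phi>_def by (intro uniform_limit_add uniform_limit_const)
    moreover have "C (P 0) x + (\<Sum>i<n. C (Q i) x) = C (P n) x" if "x \<in> cball \<xi> e" for n x
      using tele[of x n] sub that by (auto simp: W_def)
    ultimately have "uniform_limit (cball \<xi> e) (\<lambda>n. C (P n)) \<Phi> sequentially"
      unfolding uniform_limit_iff by simp
    then show ?thesis using sub e1(1) d'(1) by (intro exI[of _ e]) (auto simp: e_def)
  qed
  have hol: "\<Phi> holomorphic_on W"
  proof (rule holomorphic_uniform_sequence[OF oW])
    show "C (P n) holomorphic_on W" for n
      by (rule holomorphic_on_subset[OF C_holomorphic[OF continuous_on_hol_polys2[OF 1(1)]]]) (auto simp: W_def)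
  qed (rule unif)
  have lim: "(\<lambda>n. C (P n) \<xi>) \<longlonglongrightarrow> \<Phi> \<xi>" if \<xi>: "\<xi> \<in> W" for \<xi>
  proof -
    obtain e where e: "e > 0" "uniform_limit (cball \<xi> e) (\<lambda>n. C (P n)) \<Phi> sequentially" using unif[OF \<xi>] by blast
    show ?thesis by (rule tendsto_uniform_limitI[OF e(2)]) (use e(1) in simp)
  qed
  obtain s d0 where sd: "d0 > 0" "ball z d0 \<inter> side s \<subseteq> Bad" "ball z d0 \<inter> side (\<not> s) \<subseteq> Good" "E \<inter> ball z d0 \<subseteq> F"
    using two_sides[OF Bad_ne z] by blast
  have zE: "z \<in> E" using z F_E by blast
  have "min d0 \<epsilon> > 0" using sd \<epsilon> by simp
  from side_nbhd[OF zE this, of s] obtain r0 U where r0: "r0 > 0" "open U" "connected U" "U \<subseteq> ball z (min d0 \<epsilon>) \<inter> side s"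
    "ball z r0 \<inter> side s \<subseteq> U" by blast
  have "ball z (min d0 \<epsilon>) \<subseteq> ball z d0" "ball z (min d0 \<epsilon>) \<subseteq> ball z \<epsilon>" by (intro subset_ball; simp)+
  then have UW: "U \<subseteq> W" unfolding W_def using r0(4) sd(2) by blast
  obtain r1 where r1: "r1 > 0" "\<And>z'. z' \<in> ball z r1 \<Longrightarrow> appr z' u P" using appr_move[OF P] by blast
  define r where "r = min (min r0 r1) d0"
  have r: "r > 0" "r \<le> r0" "r \<le> r1" "r \<le> d0" using r0 r1 sd by (auto simp: r_def)
  have "van z u" if z': "z' \<in> F \<inter> ball z r" "van z' u" for z'
  proof -
    have z'P: "appr z' u P" using r1(2) z'(1) r(3) by auto
    obtain \<epsilon>2 where \<epsilon>2: "\<epsilon>2 > 0" "\<And>\<xi>. \<xi> \<in> Bad \<inter> ball z' \<epsilon>2 \<Longrightarrow> (\<lambda>n. C (P n) \<xi>) \<longlonglongrightarrow> 0"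
      using van_any[OF z'(2) z'P] z'(1) by blast
    \<comment> \<open>The limit vanishes on \<open>Bad\<close> near \<open>z'\<close>; as
      \<open>z'\<close> lies on the curve, that neighbourhood meets \<open>U\<close>.\<close>
    define V where "V = ball z' \<epsilon>2 \<inter> U"
    have "V \<noteq> {}"
    proof -
      have "z' \<in> E" using z'(1) F_E by blast
      then have "ball z' \<epsilon>2 \<inter> ball z r \<inter> side s \<noteq> {}" using z'(1) \<epsilon>2(1) by (intro open_meets_side) auto
      moreover have "ball z r \<inter> side s \<subseteq> U" using r0(5) subset_ball[OF r(2), of z] by blast
      ultimately show ?thesis unfolding V_def by blast
    qed
    moreover have "\<Phi> x = 0" if x: "x \<in> V" for x
    proof -
      have "x \<in> W" using x UW by (auto simp: V_def)
      then show ?thesis using LIMSEQ_unique[OF lim \<epsilon>2(2)] x by (auto simp: V_def W_def)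
    qed
    ultimately have \<Phi>0: "\<Phi> x = 0" if "x \<in> U" for x
      using analytic_continuation_open[of V U \<Phi> "\<lambda>_. 0" x] that r0 holomorphic_on_subset[OF hol UW]
      by (auto simp: V_def open_Int)
    have "(\<lambda>n. C (P n) \<xi>) \<longlonglongrightarrow> 0" if \<xi>: "\<xi> \<in> Bad \<inter> ball z r" for \<xi>
    proof -
      have sub: "ball z r \<subseteq> ball z d0" "ball z r \<subseteq> ball z r0" using r by (auto intro: subset_ball)
      \<comment> \<open>Near \<open>z\<close> a point of \<open>Bad\<close> is neither on the curve,
        which there lies in \<open>F\<close>, nor on the resolvent side; so it lies in
        \<open>U\<close>.\<close>
      have "\<xi> \<notin> E" using \<xi> sd(4) sub by (auto simp: Bad_def)
      moreover have "\<xi> \<notin> side (\<not> s)" using \<xi> sd(3) sub by (auto simp: Bad_def)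
      ultimately have "\<xi> \<in> side s" using side_cases[of \<xi>] by (cases s) auto
      then have "\<xi> \<in> U" using r0(5) \<xi> sub by blast
      then show ?thesis using lim[of \<xi>] \<Phi>0[of \<xi>] UW by auto
    qed
    then show ?thesis unfolding van_def using P r(1) by blast
  qed
  then show ?thesis using r(1) by blast
qed


section \<open>Sheets over a coordinate neighbourhood and their propagation\<close>

definition chart :: "complex \<Rightarrow> real \<Rightarrow> (complex \<Rightarrow> real) \<Rightarrow> real set \<Rightarrow> bool" where
  "chart z r S T \<longleftrightarrow> r > 0 \<and> S z = 0 \<and> continuous_on (E \<inter> ball z r) S \<and>
      (\<forall>e>0. \<exists>z'\<in>E \<inter> ball z e. S z' > 0) \<and> finite T \<and>
      (\<forall>y\<in>D. fst y \<in> ball z r \<longrightarrow> g y - S (fst y) \<in> T)"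

lemma chartD:
  assumes "chart z r S T"
  shows "r > 0" "S z = 0" "continuous_on (E \<inter> ball z r) S" "\<And>e. e > 0 \<Longrightarrow> \<exists>z'\<in>E \<inter> ball z e. S z' > 0" "finite T"
    "\<And>y. y \<in> D \<Longrightarrow> fst y \<in> ball z r \<Longrightarrow> g y - S (fst y) \<in> T"
  using assms unfolding chart_def by simp_all

text \<open>The indicator of one sheet. As \<open>S\<close> vanishes at the base point, the label
  \<open>t\<close> is the value of \<open>g\<close> where the sheet lies over that point.\<close>

definition sheet :: "(complex \<Rightarrow> real) \<Rightarrow> real \<Rightarrow> complex \<times> complex \<Rightarrow> complex" where
  "sheet S t y = (if g y - S (fst y) = t then 1 else 0)"

lemma chart_cont:
  assumes "chart z r S T"
  shows "continuous_on {y \<in> D. dist (fst y) z \<le> r / 2} (\<lambda>y. g y - S (fst y))"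
proof -
  have "continuous_on {y \<in> D. dist (fst y) z \<le> r / 2} (\<lambda>y. S (fst y))"
  proof (rule continuous_on_compose2[OF chartD(3)[OF assms] fst_cont])
    show "fst ` {y \<in> D. dist (fst y) z \<le> r / 2} \<subseteq> E \<inter> ball z r"
      using D_E chartD(1)[OF assms] by (auto simp: dist_commute)
  qed
  then show ?thesis by (intro continuous_on_diff continuous_on_subset[OF g_cont]) auto
qed

lemma compact_level_set:
  assumes ch: "chart z r S T" and T': "T' \<subseteq> T"
  shows "compact {y \<in> D. dist (fst y) z \<le> r / 2 \<and> g y - S (fst y) \<in> T'}"
proof -
  define X where "X = {y \<in> D. dist (fst y) z \<le> r / 2}"
  have "X = D \<inter> {y. dist (fst y) z \<le> r / 2}" by (auto simp: X_def)
  moreover have "closed {y :: complex \<times> complex. dist (fst y) z \<le> r / 2}"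
    by (intro closed_Collect_le continuous_intros)
  ultimately have X: "compact X" using compact_D by (simp add: compact_Int_closed)
  have "closed T'" using finite_subset[OF T' chartD(5)[OF ch]] by (rule finite_imp_closed)
  then have "closedin (top_of_set X) (X \<inter> (\<lambda>y. g y - S (fst y)) -` T')"
    using chart_cont[OF ch] unfolding X_def[symmetric] by (intro continuous_closedin_preimage)
  then have "compact (X \<inter> (\<lambda>y. g y - S (fst y)) -` T')" using closedin_compact[OF X] by blast
  moreover have "X \<inter> (\<lambda>y. g y - S (fst y)) -` T' = {y \<in> D. dist (fst y) z \<le> r / 2 \<and> g y - S (fst y) \<in> T'}"
    by (auto simp: X_def)
  ultimately show ?thesis by simp
qed

text \<open>On the fibre the sheet is the set \<open>g = t\<close>, whose indicator is a uniform
  limit of polynomials by \<open>papprox_indicator\<close>. A single approximant \<open>q\<close>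
  remains near 1 on the sheet and near 0 on the others over a neighbourhood of \<open>z\<close>, and
  \<open>majority n\<close> amplifies it to geometrically fast approximation.\<close>

lemma sheet_appr:
  assumes z: "z \<in> F" and ch: "chart z r S T"
  shows "\<exists>P. appr z (sheet S t) P"
proof -
  note c = chartD[OF ch]
  have zE: "z \<in> E" using z F_E by blast
  define X where "X = {y \<in> D. fst y = z}"
  define A where "A = {y \<in> X. g y = t}"
  have X: "compact X" unfolding X_def by (rule compact_fibre)
  have gT: "g y \<in> T" if "y \<in> X" for y using c(6)[of y] that c(1,2) by (auto simp: X_def)
  have gX: "continuous_on X g" by (rule continuous_on_subset[OF g_cont]) (auto simp: X_def)
  have lev: "compact {y \<in> X. g y \<in> T'}" if "T' \<subseteq> T" for T'
  proof -
    have "closed T'" using finite_subset[OF that c(5)] by (rule finite_imp_closed)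
    then have "closedin (top_of_set X) (X \<inter> g -` T')" using gX by (intro continuous_closedin_preimage)
    then have "compact (X \<inter> g -` T')" using closedin_compact[OF X] by blast
    moreover have "X \<inter> g -` T' = {y \<in> X. g y \<in> T'}" by auto
    ultimately show ?thesis by simp
  qed
  have "A = {y \<in> X. g y \<in> T \<inter> {t}}" "X - A = {y \<in> X. g y \<in> T - {t}}" using gT by (auto simp: A_def)
  then have cA: "compact A" "compact (X - A)" using lev[of "T \<inter> {t}"] lev[of "T - {t}"] by auto
  have "papprox X (\<lambda>y. if y \<in> A then 1 else 0)"
  proof (rule papprox_indicator[OF X snd_cont])
    show "- (snd ` X) \<subseteq> resolv X snd" unfolding X_def by (rule fibre_resolv[OF zE])
    show "A \<subseteq> X" by (auto simp: A_def)
    show "compact (snd ` A)" "compact (snd ` (X - A))" by (intro compact_continuous_image cA snd_cont)+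
    show "snd ` A \<inter> snd ` (X - A) = {}" by (auto simp: A_def X_def)
  qed
  \<comment> \<open>Accuracy \<open>1/32\<close> on the fibre leaves room for \<open>1/16\<close>
    nearby, the threshold of \<open>majority_small\<close>.\<close>
  then obtain q where q: "q \<in> hol_polys2" "\<And>y. y \<in> X \<Longrightarrow> norm (q y - (if y \<in> A then 1 else 0)) < 1/32"
  proof -
    have "(1/32 :: real) > 0" by simp
    from \<open>papprox X (\<lambda>y. if y \<in> A then 1 else 0)\<close>[unfolded papprox_def, THEN spec, THEN mp, OF this]
    show ?thesis using that by blast
  qed
  have sep: "\<exists>d>0. \<forall>y\<in>D. dist (fst y) z \<le> r / 2 \<longrightarrow> g y - S (fst y) \<in> T' \<longrightarrow> dist (fst y) z < d \<longrightarrow> norm (q y - a) < 1/16"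
    if T': "T' \<subseteq> T" and a: "\<And>y. y \<in> X \<Longrightarrow> g y \<in> T' \<Longrightarrow> norm (q y - a) < 1/32" for T' a
  proof -
    \<comment> \<open>The points of the chosen sheets where \<open>q\<close> is off by
      \<open>1/16\<close> or more form a compact set missing the fibre, hence at positive distance
      from it.\<close>
    define K where "K = {y \<in> D. dist (fst y) z \<le> r / 2 \<and> g y - S (fst y) \<in> T'} \<inter> {y. 1/16 \<le> norm (q y - a)}"
    have "closed {y. 1/16 \<le> norm (q y - a)}"
      by (intro closed_Collect_le continuous_on_const continuous_on_norm continuous_on_diff continuous_on_hol_polys2 q)
    then have K: "compact K" unfolding K_def by (intro compact_Int_closed compact_level_set[OF ch T'])
    have "fst y \<noteq> z" if y: "y \<in> K" for y
    proof
      assume "fst y = z"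
      then have "y \<in> X" "g y \<in> T'" using y c(2) by (auto simp: K_def X_def)
      from a[OF this] show False using y by (simp add: K_def)
    qed
    from separated_from_fibre[OF K this] obtain d where d: "d > 0" "\<And>y. y \<in> K \<Longrightarrow> d \<le> dist (fst y) z" by blast
    then show ?thesis by (intro exI[of _ d]) (force simp: K_def)
  qed
  have a1: "norm (q y - 1) < 1/32" if "y \<in> X" "g y \<in> T \<inter> {t}" for y
    using q(2)[OF that(1)] that by (simp add: A_def)
  have a0: "norm (q y - 0) < 1/32" if "y \<in> X" "g y \<in> T - {t}" for y
    using q(2)[OF that(1)] that by (simp add: A_def)
  from sep[OF Int_lower1 a1] obtain d1 where d1: "d1 > 0" "\<And>y. \<lbrakk>y \<in> D; dist (fst y) z \<le> r / 2; g y - S (fst y) \<in> T \<inter> {t}; dist (fst y) z < d1\<rbrakk> \<Longrightarrow> norm (q y - 1) < 1/16"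
    by blast
  from sep[OF Diff_subset a0] obtain d2 where d2: "d2 > 0" "\<And>y. \<lbrakk>y \<in> D; dist (fst y) z \<le> r / 2; g y - S (fst y) \<in> T - {t}; dist (fst y) z < d2\<rbrakk> \<Longrightarrow> norm (q y - 0) < 1/16"
    by blast
  obtain B where B: "B > 0" "\<And>y. y \<in> D \<Longrightarrow> norm (q y) \<le> B"
    using D_bound[OF continuous_on_hol_polys2[OF q(1)]] by blast
  have "appr z (sheet S t) (\<lambda>n y. majority n (q y))"
  \<comment> \<open>\<open>3 + 2 * B\<close> covers both the factor \<open>1 + 2 * B\<close> of
    \<open>majority_bound\<close> and the factor 3 of \<open>majority_small\<close>.\<close>
  proof (rule apprI[of _ "3 + 2 * B" "(1 + 2 * B)\<^sup>2" "1/2" "min (r/2) (min d1 d2)"])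
    show "(\<lambda>y. majority n (q y)) \<in> hol_polys2" for n by (rule majority_poly[OF q(1)])
    show "1 \<le> (1 + 2 * B)\<^sup>2" using B(1) by (intro one_le_power) simp
    show "0 < min (r/2) (min d1 d2)" using c(1) d1 d2 by simp
    fix n y assume y: "y \<in> D"
    have "norm (majority n (q y)) \<le> (1 + 2 * B) * ((1 + 2 * B)\<^sup>2) ^ n" by (rule majority_bound[OF B(2)[OF y]])
    also have "\<dots> \<le> (3 + 2 * B) * ((1 + 2 * B)\<^sup>2) ^ n" using B(1) by (intro mult_right_mono) auto
    finally show "norm (majority n (q y)) \<le> (3 + 2 * B) * ((1 + 2 * B)\<^sup>2) ^ n" .
    assume d: "dist (fst y) z < min (r/2) (min d1 d2)"
    have T: "g y - S (fst y) \<in> T" using c(6)[OF y] d c(1) by (simp add: dist_commute)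
    have "norm (majority n (q y) - sheet S t y) \<le> 3 * (1/2) ^ n"
    proof (cases "g y - S (fst y) = t")
      case True
      then have "norm (q y - 1) < 1/16" using d1(2)[OF y] d T by simp
      then have "norm (1 - q y) \<le> 1/16" by (simp add: norm_minus_commute)
      from majority_small[OF this, of n] have "norm (majority n (1 - q y)) \<le> 3 * (1/2) ^ n" .
      then show ?thesis unfolding majority_compl sheet_def using True by (simp add: norm_minus_commute)
    next
      case False
      then have "norm (q y) \<le> 1/16" using d2(2)[OF y] d T by simp
      from majority_small[OF this, of n] show ?thesis using False by (simp add: sheet_def)
    qed
    also have "\<dots> \<le> (3 + 2 * B) * (1/2) ^ n" using B(1) by (intro mult_right_mono) auto
    finally show "norm (majority n (q y) - sheet S t y) \<le> (3 + 2 * B) * (1/2) ^ n" .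
  qed (use B(1) in auto)
  then show ?thesis by blast
qed

lemma gap:
  assumes "finite (T :: real set)" shows "\<exists>\<eta>>0. \<forall>s\<in>T. \<bar>s - t\<bar> < \<eta> \<longrightarrow> s = t"
proof -
  obtain d where d: "d > 0" "\<forall>x\<in>T. x \<noteq> t \<longrightarrow> d \<le> dist t x" using finite_set_avoid[OF assms, of t] by blast
  have "s = t" if s: "s \<in> T" "\<bar>s - t\<bar> < d" for s
  proof (rule ccontr)
    assume "s \<noteq> t"
    then have "d \<le> dist t s" using d(2) s(1) by blast
    then show False using s(2) by (simp add: dist_real_def)
  qed
  then show ?thesis using d(1) by blast
qed

lemma chart_near:
  assumes ch: "chart z r S T" and z': "z' \<in> E \<inter> ball z r" and e: "\<eta> > 0"
  shows "\<exists>d>0. \<forall>x\<in>E. dist x z' < d \<longrightarrow> x \<in> ball z r \<and> \<bar>S x - S z'\<bar> < \<eta>"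
proof -
  obtain d1 where d1: "d1 > 0" "\<And>x. x \<in> E \<inter> ball z r \<Longrightarrow> dist x z' < d1 \<Longrightarrow> dist (S x) (S z') < \<eta>"
    using chartD(3)[OF ch] z' e unfolding continuous_on_iff by blast
  obtain d2 where d2: "d2 > 0" "ball z' d2 \<subseteq> ball z r" using z' by (meson IntD2 open_ball openE)
  show ?thesis
  proof (intro exI[of _ "min d1 d2"] conjI ballI impI)
    fix x assume x: "x \<in> E" "dist x z' < min d1 d2"
    then have "x \<in> ball z' d2" by (simp add: dist_commute)
    then show "x \<in> ball z r" using d2(2) by blast
    then show "\<bar>S x - S z'\<bar> < \<eta>" using d1(2)[of x] x by (auto simp: dist_real_def)
  qed (use d1 d2 in auto)
qed

text \<open>Changing the base point to \<open>z'\<close> shifts the coordinate by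
  \<open>S z'\<close>, up to an error tending to 0 at \<open>z'\<close>. Labels take finitely many
  values, so a small error is none: the sheet stays and its label becomes
  \<open>t + S z'\<close>.\<close>

lemma sheet_consistent:
  assumes ch: "chart z r S T" and ch': "chart z' r' S' T'" and z': "z' \<in> E \<inter> ball z r"
  shows "\<exists>d>0. \<forall>y\<in>D. dist (fst y) z' < d \<longrightarrow> sheet S t y = sheet S' (t + S z') y"
proof -
  obtain \<eta>1 where \<eta>1: "\<eta>1 > 0" "\<And>s. s \<in> T \<Longrightarrow> \<bar>s - t\<bar> < \<eta>1 \<Longrightarrow> s = t"
    using gap[OF chartD(5)[OF ch], of t] by blast
  obtain \<eta>2 where \<eta>2: "\<eta>2 > 0" "\<And>s. s \<in> T' \<Longrightarrow> \<bar>s - (t + S z')\<bar> < \<eta>2 \<Longrightarrow> s = t + S z'"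
    using gap[OF chartD(5)[OF ch'], of "t + S z'"] by blast
  \<comment> \<open>Half the gap, because the errors of \<open>S\<close> and \<open>S'\<close> add
    up.\<close>
  define \<eta> where "\<eta> = min \<eta>1 \<eta>2 / 2"
  have \<eta>: "\<eta> > 0" using \<eta>1 \<eta>2 by (simp add: \<eta>_def)
  obtain d1 where d1: "d1 > 0" "\<And>x. x \<in> E \<Longrightarrow> dist x z' < d1 \<Longrightarrow> x \<in> ball z r \<and> \<bar>S x - S z'\<bar> < \<eta>"
    using chart_near[OF ch z' \<eta>] by blast
  have z'2: "z' \<in> E \<inter> ball z' r'" using z' chartD(1)[OF ch'] by auto
  obtain d2 where d2: "d2 > 0" "\<And>x. x \<in> E \<Longrightarrow> dist x z' < d2 \<Longrightarrow> x \<in> ball z' r' \<and> \<bar>S' x - S' z'\<bar> < \<eta>"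
    using chart_near[OF ch' z'2 \<eta>] by blast
  show ?thesis
  proof (intro exI[of _ "min d1 d2"] conjI ballI impI)
    fix y assume y: "y \<in> D" "dist (fst y) z' < min d1 d2"
    have yE: "fst y \<in> E" using y(1) D_E by blast
    have 1: "fst y \<in> ball z r" "\<bar>S (fst y) - S z'\<bar> < \<eta>" using d1(2)[OF yE] y(2) by auto
    have 2: "fst y \<in> ball z' r'" "\<bar>S' (fst y)\<bar> < \<eta>" using d2(2)[OF yE] y(2) chartD(2)[OF ch'] by auto
    have T: "g y - S (fst y) \<in> T" "g y - S' (fst y) \<in> T'"
      using chartD(6)[OF ch y(1) 1(1)] chartD(6)[OF ch' y(1) 2(1)] by auto
    have "g y - S (fst y) = t \<longleftrightarrow> g y - S' (fst y) = t + S z'"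
    proof
      assume *: "g y - S (fst y) = t"
      show "g y - S' (fst y) = t + S z'"
      proof (rule \<eta>2(2)[OF T(2)])
        have "2 * \<eta> \<le> \<eta>2" by (simp add: \<eta>_def)
        then show "\<bar>g y - S' (fst y) - (t + S z')\<bar> < \<eta>2" using * 1(2) 2(2) by linarith
      qed
    next
      assume *: "g y - S' (fst y) = t + S z'"
      show "g y - S (fst y) = t"
      proof (rule \<eta>1(2)[OF T(1)])
        have "2 * \<eta> \<le> \<eta>1" by (simp add: \<eta>_def)
        then show "\<bar>g y - S (fst y) - t\<bar> < \<eta>1" using * 1(2) 2(2) by linarith
      qed
    qed
    then show "sheet S t y = sheet S' (t + S z') y" by (simp add: sheet_def)
  qed (use d1 d2 in auto)
qed

text \<open>Over a closed ball the sheet is compact; missing the fibre over \<open>z\<close>, it is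
  empty over a neighbourhood of \<open>z\<close>.\<close>

lemma empty_sheet_van:
  assumes ch: "chart z r S T" and none: "\<And>y. y \<in> D \<Longrightarrow> fst y = z \<Longrightarrow> g y \<noteq> t"
  shows "van z (sheet S t)"
proof -
  define K where "K = {y \<in> D. dist (fst y) z \<le> r / 2 \<and> g y - S (fst y) \<in> T \<inter> {t}}"
  have K: "compact K" unfolding K_def by (rule compact_level_set[OF ch]) auto
  have "fst y \<noteq> z" if y: "y \<in> K" for y
    using none[of y] y chartD(2)[OF ch] by (auto simp: K_def)
  from separated_from_fibre[OF K this] obtain d where d: "d > 0" "\<And>y. y \<in> K \<Longrightarrow> d \<le> dist (fst y) z" by blast
  show ?thesis
  proof (rule van_cong[OF van_zero])
    show "min d (r / 2) > 0" using d(1) chartD(1)[OF ch] by simp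
    fix y assume y: "y \<in> D" "dist (fst y) z < min d (r / 2)"
    then have "g y - S (fst y) \<in> T" using chartD(6)[OF ch y(1)] chartD(1)[OF ch] by (simp add: dist_commute)
    then show "0 = sheet S t y" using d(2)[of y] y by (auto simp: sheet_def K_def)
  qed
qed

text \<open>The pairs with nonvanishing contribution form a compact set, so one of them has the
  largest label. Arbitrarily near its base point the coordinate takes positive values; there the
  same sheet has a larger label, hence contributes nothing, and \<open>van_continue\<close> carries
  this back to the base point.\<close>

lemma all_sheets_van:
  assumes chS: "\<And>z. z \<in> E \<Longrightarrow> chart z (r z) (S z) (T z)" and z: "z \<in> F"
  shows "van z (sheet (S z) t)"
proof (rule ccontr)
  assume nv: "\<not> van z (sheet (S z) t)"
  define \<Lambda> where "\<Lambda> = (\<lambda>y. (fst y, g y)) ` D"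
  define N where "N = {(z, t). z \<in> F \<and> \<not> van z (sheet (S z) t)}"
  have \<Lambda>: "compact \<Lambda>" unfolding \<Lambda>_def
    by (intro compact_continuous_image compact_D continuous_on_Pair fst_cont g_cont)
  have N\<Lambda>: "N \<subseteq> \<Lambda>"
  proof clarify
    fix z t assume "(z, t) \<in> N"
    then have zt: "z \<in> F" "\<not> van z (sheet (S z) t)" by (auto simp: N_def)
    then have "\<not> (\<forall>y. y \<in> D \<longrightarrow> fst y = z \<longrightarrow> g y \<noteq> t)"
      using empty_sheet_van[OF chS] F_E by blast
    then show "(z, t) \<in> \<Lambda>" by (force simp: \<Lambda>_def)
  qed
  \<comment> \<open>A pair of \<Lambda> close to \<open>(z, t)\<close> lies on the sheet labelled
    \<open>t\<close> over \<open>z\<close>, since other labels differ from \<open>t\<close> by at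
    least \<eta>; and vanishing passes to nearby base points by \<open>van_move\<close>.\<close>
  have "openin (top_of_set \<Lambda>) (\<Lambda> - N)"
    unfolding openin_contains_ball
  proof (intro conjI ballI)
    fix p assume p: "p \<in> \<Lambda> - N"
    obtain z t where pzt: "p = (z, t)" by (cases p)
    have zF: "z \<in> F" using p by (auto simp: pzt \<Lambda>_def F_def)
    then have zE: "z \<in> E" using F_E by blast
    have v: "van z (sheet (S z) t)" using p zF by (auto simp: pzt N_def)
    note ch = chS[OF zE]
    obtain r1 where r1: "r1 > 0" "\<And>z'. z' \<in> ball z r1 \<Longrightarrow> van z' (sheet (S z) t)" using van_move[OF v] by blast
    obtain \<eta> where \<eta>: "\<eta> > 0" "\<And>s. s \<in> T z \<Longrightarrow> \<bar>s - t\<bar> < \<eta> \<Longrightarrow> s = t"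
      using gap[OF chartD(5)[OF ch], of t] by blast
    have "z \<in> E \<inter> ball z (r z)" using zE chartD(1)[OF ch] by auto
    moreover have "\<eta> / 2 > 0" using \<eta> by simp
    ultimately obtain d where d: "d > 0" "\<And>x. x \<in> E \<Longrightarrow> dist x z < d \<Longrightarrow> x \<in> ball z (r z) \<and> \<bar>S z x - S z z\<bar> < \<eta> / 2"
      using chart_near[OF ch] by meson
    define e where "e = min (min r1 d) (\<eta> / 2)"
    have "ball p e \<inter> \<Lambda> \<subseteq> \<Lambda> - N"
    proof
      fix q assume q: "q \<in> ball p e \<inter> \<Lambda>"
      then obtain y where y: "y \<in> D" "q = (fst y, g y)" by (auto simp: \<Lambda>_def)
      have "dist z (fst y) < e" "dist t (g y) < e"
        using q dist_fst_le[of p q] dist_snd_le[of p q] by (auto simp: pzt y)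
      then have dd: "dist z (fst y) < r1" "dist (fst y) z < d" "\<bar>g y - t\<bar> < \<eta> / 2"
        by (auto simp: e_def dist_commute dist_real_def abs_minus_commute)
      have yE: "fst y \<in> E" using y(1) D_E by blast
      have 1: "fst y \<in> ball z (r z)" "\<bar>S z (fst y)\<bar> < \<eta> / 2" using d(2)[OF yE dd(2)] chartD(2)[OF ch] by auto
      have "g y - S z (fst y) = t"
        by (rule \<eta>(2)[OF chartD(6)[OF ch y(1) 1(1)]]) (use dd(3) 1(2) in linarith)
      then have gy: "g y = t + S z (fst y)" by simp
      have "fst y \<in> E \<inter> ball z (r z)" using yE 1(1) by blast
      from sheet_consistent[OF ch chS[OF yE] this, of t] obtain d' where d': "d' > 0"
        "\<And>y'. y' \<in> D \<Longrightarrow> dist (fst y') (fst y) < d' \<Longrightarrow> sheet (S z) t y' = sheet (S (fst y)) (g y) y'"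
        unfolding gy by blast
      have "fst y \<in> ball z r1" using dd(1) by simp
      then have "van (fst y) (sheet (S (fst y)) (g y))" using van_cong[OF r1(2) d'] by blast
      then show "q \<in> \<Lambda> - N" using q y(2) by (auto simp: N_def)
    qed
    moreover have "e > 0" using r1(1) d(1) \<eta>(1) by (simp add: e_def)
    ultimately show "\<exists>e>0. ball p e \<inter> \<Lambda> \<subseteq> \<Lambda> - N" by blast
  qed auto
  then have "closedin (top_of_set \<Lambda>) (\<Lambda> - (\<Lambda> - N))" by (simp add: closedin_diff)
  moreover have "\<Lambda> - (\<Lambda> - N) = N" using N\<Lambda> by blast
  ultimately have N: "compact N" using closedin_compact[OF \<Lambda>] by simp
  have Nne: "N \<noteq> {}" using nv z by (auto simp: N_def)
  have "continuous_on N snd" by (intro continuous_intros)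
  from continuous_attains_sup[OF N Nne this] obtain m where m: "m \<in> N" "\<And>n. n \<in> N \<Longrightarrow> snd n \<le> snd m" by blast
  obtain z0 t0 where m0: "m = (z0, t0)" by (cases m)
  have zt: "z0 \<in> F" "\<not> van z0 (sheet (S z0) t0)" using m(1) by (auto simp: m0 N_def)
  have zE: "z0 \<in> E" using zt(1) F_E by blast
  note ch = chS[OF zE]
  obtain P where P: "appr z0 (sheet (S z0) t0) P" using sheet_appr[OF zt(1) ch] by blast
  obtain r1 where r1: "r1 > 0" "\<And>z'. z' \<in> F \<inter> ball z0 r1 \<Longrightarrow> \<not> van z' (sheet (S z0) t0)"
    using van_continue[OF zt(1) P] zt(2) by blast
  \<comment> \<open>Openness of \<open>F\<close> in the curve ensures that the point with positive
    coordinate still belongs to \<open>F\<close>.\<close>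
  obtain s d where sd: "d > 0" "E \<inter> ball z0 d \<subseteq> F" using two_sides[OF Bad_ne zt(1)] by blast
  have "min (min r1 d) (r z0) > 0" using r1 sd chartD(1)[OF ch] by simp
  from chartD(4)[OF ch this] obtain z' where z': "z' \<in> E" "z' \<in> ball z0 r1" "z' \<in> ball z0 d" "z' \<in> ball z0 (r z0)" "S z0 z' > 0"
    by auto
  have z'F: "z' \<in> F" using z' sd(2) by blast
  have "(z', t0 + S z0 z') \<notin> N" using m(2)[of "(z', t0 + S z0 z')"] z'(5) by (auto simp: m0)
  then have v: "van z' (sheet (S z') (t0 + S z0 z'))" using z'F by (auto simp: N_def)
  have "z' \<in> E \<inter> ball z0 (r z0)" using z' by blast
  from sheet_consistent[OF ch chS[OF z'(1)] this, of t0] obtain d' where d': "d' > 0"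
    "\<And>y. y \<in> D \<Longrightarrow> dist (fst y) z' < d' \<Longrightarrow> sheet (S z') (t0 + S z0 z') y = sheet (S z0) t0 y"
    by metis
  have "van z' (sheet (S z0) t0)" by (rule van_cong[OF v d'])
  then show False using r1(2)[of z'] z'F z'(2) by blast
qed

text \<open>Near the fibre every point of \<open>D\<close> lies on exactly one sheet, so the
  indicators add up to 1.\<close>

lemma van_one: 
  assumes z: "z \<in> F" shows "van z (\<lambda>_. 1)"
proof -
  have "\<exists>c. z \<in> E \<longrightarrow> chart z (fst c) (fst (snd c)) (snd (snd c))" for z
  proof (cases "z \<in> E")
    case True
    obtain r S T where "chart z r S T" using sheets[OF True] unfolding chart_def by (elim exE)
    then show ?thesis by (intro exI[of _ "(r, S, T)"]) simp
  qed simp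
  then obtain c where "\<And>z. z \<in> E \<longrightarrow> chart z (fst (c z)) (fst (snd (c z))) (snd (snd (c z)))" by metis
  moreover define r S T where "r z = fst (c z)" and "S z = fst (snd (c z))" and "T z = snd (snd (c z))" for z
  ultimately have chS: "\<And>z. z \<in> E \<Longrightarrow> chart z (r z) (S z) (T z)" by simp
  have zE: "z \<in> E" using z F_E by blast
  note ch = chS[OF zE]
  have "van z (\<lambda>y. \<Sum>t\<in>T z. sheet (S z) t y)"
    by (intro van_sum chartD(5)[OF ch] all_sheets_van[OF chS z])
  then show ?thesis
  proof (rule van_cong[OF _ chartD(1)[OF ch]])
    fix y assume "y \<in> D" "dist (fst y) z < r z"
    then have "g y - S z (fst y) \<in> T z" using chartD(6)[OF ch] by (simp add: dist_commute)
    then show "(\<Sum>t\<in>T z. sheet (S z) t y) = 1" using chartD(5)[OF ch] by (simp add: sheet_def)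
  qed
qed

text \<open>The component of the complement of \<open>F\<close> containing \<open>a0\<close> has a
  boundary point in \<open>F\<close>. Near it the transform of the constant 1 vanishes by
  \<open>van_one\<close>, and analytic continuation within the component contradicts
  \<open>l_a0\<close>.\<close>

lemma no_annihilator: False
proof -
  define U where "U = connected_component_set (- F) a0"
  have a0F: "a0 \<in> - F" using a0 by (auto simp: Bad_def)
  have cF: "closed F" by (rule compact_imp_closed[OF compact_F])
  have oU: "open U" unfolding U_def by (intro open_connected_component open_Compl cF)
  have a0U: "a0 \<in> U" using a0F by (simp add: U_def)
  have UF: "U \<subseteq> - F" unfolding U_def by (rule connected_component_subset)
  have cU: "connected U" unfolding U_def by (rule connected_connected_component)
  have UB: "U \<subseteq> Bad" using Good_or_Bad[OF cU] UF a0U a0 by (auto simp: Bad_def)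
  have "U \<noteq> UNIV" using UF D_nonempty by (auto simp: F_def)
  then have "frontier U \<noteq> {}" using frontier_not_empty[of U] a0U by blast
  then obtain z where z: "z \<in> frontier U" by blast
  have "U \<in> components (- F)" using a0F by (auto simp: components_def U_def)
  then have zF: "z \<in> F" using z cF frontier_of_components_closed_complement by blast
  have "appr z (\<lambda>_. 1) (\<lambda>_ _. 1)"
    by (rule apprI[of _ 1 1 "1/2" 1]) (auto intro: hol_polys2_const)
  from van_any[OF van_one[OF zF] this zF] obtain \<epsilon> where \<epsilon>: "\<epsilon> > 0"
    "\<And>\<xi>. \<xi> \<in> Bad \<inter> ball z \<epsilon> \<Longrightarrow> (\<lambda>n::nat. C (\<lambda>_. 1) \<xi>) \<longlonglongrightarrow> 0" by blast
  have C0: "C (\<lambda>_. 1) \<xi> = 0" if "\<xi> \<in> U \<inter> ball z \<epsilon>" for \<xi>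
  proof -
    have "\<xi> \<in> Bad \<inter> ball z \<epsilon>" using UB that by blast
    from LIMSEQ_unique[OF \<epsilon>(2)[OF this] tendsto_const] show ?thesis by simp
  qed
  have "z \<in> closure U" using z by (simp add: frontier_def)
  then obtain p where "p \<in> U" "dist p z < \<epsilon>" using \<epsilon>(1) by (auto simp: closure_approachable)
  then have ne: "U \<inter> ball z \<epsilon> \<noteq> {}" by (auto simp: dist_commute)
  have "C (\<lambda>_. 1) a0 = 0"
    using analytic_continuation_open[of "U \<inter> ball z \<epsilon>" U "C (\<lambda>_. 1)" "\<lambda>_. 0" a0] oU cU ne C0 a0U
      holomorphic_on_subset[OF C_holomorphic[OF continuous_on_const] UB]
    by (auto simp: open_Int)
  then show False using l_a0 by (simp add: C_def)
qed

end

context sheeted begin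

lemma Bad_empty: "Bad = {}"
proof (rule ccontr)
  assume "Bad \<noteq> {}"
  then obtain a0 where a0: "a0 \<in> Bad" by blast
  then have na: "\<not> papprox D (\<lambda>y. 1 / (fst y - a0))" by (auto simp: Bad_def Good_def resolv_def F_def)
  have ca: "continuous_on D (\<lambda>y. 1 / (fst y - a0))"
    using a0 by (intro continuous_intros) (auto simp: Bad_def F_def)
  show False
  proof (rule papprox_dual[OF compact_D \<psi> ca na])
    fix l :: "(complex \<times> complex \<Rightarrow> complex) \<Rightarrow> complex"
    assume 1: "\<And>v w. continuous_on D v \<Longrightarrow> continuous_on D w \<Longrightarrow> l (\<lambda>y. v y + w y) = l v + l w"
      and 2: "\<And>c v. continuous_on D v \<Longrightarrow> l (\<lambda>y. c * v y) = c * l v"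
      and 3: "\<And>v B. continuous_on D v \<Longrightarrow> (\<And>y. y \<in> D \<Longrightarrow> norm (v y) \<le> B) \<Longrightarrow> norm (l v) \<le> 2 * B"
      and 4: "\<And>p. p \<in> hol_polys2 \<Longrightarrow> l p = 0"
      and 5: "l (\<lambda>y. 1 / (fst y - a0)) \<noteq> 0"
    interpret annihilator h G D g \<psi> l a0
    proof unfold_locales
      show "norm (l v) \<le> 2 * B" if "continuous_on D v" "\<And>y. y \<in> D \<Longrightarrow> norm (v y) \<le> B" for v B
        using that by (rule 3)
    qed (fact 1 2 4 5 a0)+
    show False by (rule no_annihilator)
  qed
qed

lemma poly_hull_eq: "poly_hull D = D"
  by (rule polynomially_convex_if_all_Good[OF Bad_empty])

end

section \<open>Totally real discs\<close>

lemma C2_onD: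
  assumes "C2_on U f" obtains Df where "\<And>x. x \<in> U \<Longrightarrow> (f has_derivative blinfun_apply (Df x)) (at x)"
  using assms unfolding C2_on_def by blast

lemma regular_curve_smooth_plane:
  assumes "smooth_plane h" and reg: "\<forall>z. h z = 0 \<longrightarrow> frechet_derivative h (at z) \<noteq> (\<lambda>v. 0)"
  shows "\<exists>G. regular_curve h G"
proof -
  have "Ck_plane (Suc (Suc 0)) h" using assms(1) unfolding smooth_plane_def by blast
  then obtain fx fy where h: "\<And>z. (h has_derivative (\<lambda>v. Re v * fx z + Im v * fy z)) (at z)"
    and C1: "Ck_plane (Suc 0) fx" "Ck_plane (Suc 0) fy" by auto
  have diff: "f differentiable (at z)" if "Ck_plane (Suc 0) f" for f z
    using that unfolding Ck_plane.simps(2) differentiable_def by blast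
  define G where "G z = Complex (fx z) (fy z)" for z
  have eq: "(\<lambda>v. G z \<bullet> v) = (\<lambda>v. Re v * fx z + Im v * fy z)" for z
    by (auto simp: G_def inner_complex_def mult.commute)
  have "regular_curve h G"
  proof
    show "(h has_derivative (\<lambda>v. G z \<bullet> v)) (at z)" for z unfolding eq by (rule h)
    show "G differentiable (at z)" for z
    proof -
      obtain a b where "(fx has_derivative a) (at z)" "(fy has_derivative b) (at z)"
        using diff[OF C1(1)] diff[OF C1(2)] unfolding differentiable_def by blast
      then have "((\<lambda>z. of_real (fx z) + \<i> * of_real (fy z)) has_derivative (\<lambda>v. of_real (a v) + \<i> * of_real (b v))) (at z)"
        by (auto intro!: derivative_eq_intros)
      moreover have "G = (\<lambda>z. of_real (fx z) + \<i> * of_real (fy z))" by (simp add: G_def fun_eq_iff complex_eq_iff)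
      ultimately show ?thesis unfolding differentiable_def by auto
    qed
    show "G z \<noteq> 0" if "h z = 0" for z
    proof
      assume "G z = 0"
      then have "(\<lambda>v. Re v * fx z + Im v * fy z) = (\<lambda>v. 0)" unfolding eq[symmetric] by (simp add: fun_eq_iff)
      then have "(h has_derivative (\<lambda>v. 0)) (at z)" using h[of z] by simp
      then have "frechet_derivative h (at z) = (\<lambda>v. 0)" by (rule frechet_derivative_at[symmetric])
      then show False using reg that by blast
    qed
  qed
  then show ?thesis by blast
qed

text \<open>Tangent vectors of the disc at its boundary are only one-sided limits within the disc, but
  a chart of \<open>N\<close> turns them into two-sided curves in \<open>N\<close>.\<close>

lemma disc_tangent:
  fixes x :: complex
  assumes N: "C2_submanifold N" and \<phi>: "(\<phi> has_derivative A) (at x)" and x: "x \<in> cball 0 1"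
    and im: "\<phi> ` cball 0 1 \<subseteq> N"
  shows "A v \<in> tangent_space N (\<phi> x)"
proof -
  define p where "p = \<phi> x"
  have pN: "p \<in> N" using im x by (auto simp: p_def)
  from bspec[OF N[unfolded C2_submanifold_def] pN]
  obtain U V L and \<Phi> :: "complex \<times> complex \<Rightarrow> complex \<times> complex" and \<Psi>
    where c: "open U" "p \<in> U" "open V" "subspace L" "C2_on U \<Phi>" "C2_on V \<Psi>"
      "\<Phi> ` U = V" "\<forall>x\<in>U. \<Psi> (\<Phi> x) = x" "\<Phi> ` (U \<inter> N) = V \<inter> L"
    by (elim exE conjE)
  obtain D\<Phi> where "\<And>x. x \<in> U \<Longrightarrow> (\<Phi> has_derivative blinfun_apply (D\<Phi> x)) (at x)" by (rule C2_onD[OF c(5)]) (rule that)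
  then have B: "(\<Phi> has_derivative blinfun_apply (D\<Phi> p)) (at p)" using c(2) by blast
  have pV: "\<Phi> p \<in> V" using c(2,7) by blast
  obtain D\<Psi> where "\<And>x. x \<in> V \<Longrightarrow> (\<Psi> has_derivative blinfun_apply (D\<Psi> x)) (at x)" by (rule C2_onD[OF c(6)]) (rule that)
  then have B': "(\<Psi> has_derivative blinfun_apply (D\<Psi> (\<Phi> p))) (at (\<Phi> p))" using pV by blast
  define B1 where "B1 = blinfun_apply (D\<Phi> p)"
  define B2 where "B2 = blinfun_apply (D\<Psi> (\<Phi> p))"
  have "((\<lambda>x. \<Psi> (\<Phi> x)) has_derivative (\<lambda>v. B2 (B1 v))) (at p)"
    unfolding B1_def B2_def by (rule has_derivative_compose[OF B B'])
  then have "((\<lambda>x. x) has_derivative (\<lambda>v. B2 (B1 v))) (at p)"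
    by (rule has_derivative_transform_within_open[OF _ c(1,2)]) (use c(8) in auto)
  from has_derivative_unique[OF this has_derivative_ident] have inv: "B2 (B1 v) = v" for v
    by (rule fun_cong)
  have \<phi>c: "isCont \<phi> x" using \<phi> by (rule has_derivative_continuous)
  obtain \<rho> where \<rho>: "\<rho> > 0" "ball (\<phi> x) \<rho> \<subseteq> U" using c(1,2) openE unfolding p_def by blast
  obtain r where r0: "r > 0" "\<forall>y. dist y x < r \<longrightarrow> dist (\<phi> y) (\<phi> x) < \<rho>"
    using \<phi>c \<rho>(1) unfolding continuous_at_eps_delta by blast
  then have r: "r > 0" "\<And>y. dist y x < r \<Longrightarrow> \<phi> y \<in> U" using \<rho>(2) by (auto simp: dist_commute)
  have inL: "\<Phi> u \<in> L" if "u \<in> U" "u \<in> N" for u using c(9) that by blast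
  have "((\<lambda>y. \<Phi> (\<phi> y)) has_derivative (\<lambda>v. B1 (A v))) (at x)"
    unfolding B1_def using B unfolding p_def by (rule has_derivative_compose[OF \<phi>])
  then have BA: "B1 (A v) \<in> L"
  proof (rule derivative_in_subspace[OF _ x r(1) c(4)])
    fix y :: complex assume y: "y \<in> cball 0 1" "dist x y < r"
    have "\<phi> y \<in> U" "\<phi> y \<in> N" using r(2)[of y] y im by (auto simp: dist_commute)
    then show "\<Phi> (\<phi> y) - \<Phi> (\<phi> x) \<in> L"
      using inL[of "\<phi> y"] inL[of p] c(2,4) pN by (simp add: p_def subspace_diff)
  qed
  define w where "w = B1 (A v)"
  define \<gamma> where "\<gamma> t = \<Psi> (\<Phi> p + t *\<^sub>R w)" for t :: real
  obtain q where q: "q > 0" "ball (\<Phi> p) q \<subseteq> V" using c(3) pV openE by blast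
  define e where "e = q / (norm w + 1)"
  have nw: "norm w + 1 > 0" by (simp add: add_nonneg_pos)
  have e: "e > 0" using q nw by (simp add: e_def)
  have "\<gamma> t \<in> N" if t: "t \<in> ball 0 e" for t
  proof -
    have "\<bar>t\<bar> * norm w \<le> e * norm w" using t by (intro mult_right_mono) (auto simp: dist_real_def)
    also have "\<dots> < e * (norm w + 1)" using e by simp
    also have "\<dots> = q" using nw by (simp add: e_def)
    finally have "\<Phi> p + t *\<^sub>R w \<in> V" using q(2) by (auto simp: dist_norm)
    moreover have "\<Phi> p + t *\<^sub>R w \<in> L"
      using BA inL[OF c(2) pN] c(4) by (simp add: w_def subspace_add subspace_scale)
    ultimately obtain u where "u \<in> U" "u \<in> N" "\<Phi> p + t *\<^sub>R w = \<Phi> u" using c(9) by blast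
    then show ?thesis using c(8) by (simp add: \<gamma>_def)
  qed
  moreover have "\<gamma> 0 = p" using c(2,8) by (simp add: \<gamma>_def)
  moreover have "(\<gamma> has_vector_derivative A v) (at 0)"
  proof -
    have 1: "((\<lambda>t. \<Phi> p + t *\<^sub>R w) has_derivative (\<lambda>t. t *\<^sub>R w)) (at 0)" by (auto intro!: derivative_eq_intros)
    have "(\<Psi> has_derivative B2) (at (\<Phi> p + 0 *\<^sub>R w))" using B' by (simp add: B2_def)
    from has_derivative_compose[OF 1 this]
    have "(\<gamma> has_derivative (\<lambda>t. B2 (t *\<^sub>R w))) (at 0)" by (simp add: \<gamma>_def[abs_def])
    moreover have "B2 (t *\<^sub>R w) = t *\<^sub>R A v" for t
      unfolding B2_def blinfun.scaleR_right using inv[of "A v"] by (simp add: w_def B2_def)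
    ultimately show ?thesis by (simp add: has_vector_derivative_def)
  qed
  ultimately show ?thesis using e unfolding tangent_space_def p_def by blast
qed

text \<open>If the first component of \<open>A\<close> vanished, \<open>A\<close> would map the
  plane onto \<open>{0} \<times> UNIV\<close>, a complex line inside the tangent space.\<close>

lemma totally_real_transversal:
  assumes "totally_real N" "p \<in> N" and lin: "linear A" "inj A"
    and tan: "\<And>v::complex. A v \<in> tangent_space N p"
  shows "\<exists>v. fst (A v) \<noteq> 0"
proof (rule ccontr)
  assume "\<not> (\<exists>v. fst (A v) \<noteq> 0)"
  then have z: "A v = (0, snd (A v))" for v by (simp add: prod_eq_iff)
  have l: "linear (\<lambda>v. snd (A v))" using linear_compose[OF lin(1) linear_snd] by (simp add: o_def)
  have "inj (\<lambda>v. snd (A v))"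
  proof (rule injI)
    fix x y assume "snd (A x) = snd (A y)"
    then have "A x = A y" using z[of x] z[of y] by simp
    then show "x = y" using lin(2) by (simp add: inj_eq)
  qed
  then have s: "surj (\<lambda>v. snd (A v))" using l by (simp add: linear_injective_imp_surjective)
  from surjD[OF s, of 1] obtain v1 where v1: "1 = snd (A v1)" by (rule exE)
  from surjD[OF s, of \<i>] obtain v2 where v2: "\<i> = snd (A v2)" by (rule exE)
  have "(0, 1) \<in> tangent_space N p" "(0, \<i>) \<in> tangent_space N p"
    unfolding v1 v2 z[symmetric] by (rule tan)+
  moreover have "mult_i (0, 1) = (0, \<i>)" by (simp add: mult_i_def)
  ultimately have "(0, \<i>) \<in> tangent_space N p \<inter> mult_i ` tangent_space N p" by force
  then show False using assms(1,2) unfolding totally_real_def by (auto simp: zero_prod_def)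
qed

theorem theorem1p2:
  fixes h :: "complex \<Rightarrow> real" and D :: "(complex \<times> complex) set"
  assumes "smooth_plane h"
    and "\<forall>z. h z = 0 \<longrightarrow> frechet_derivative h (at z) \<noteq> (\<lambda>v. 0)"
    and "C2_totally_real_disc D"
    and "D \<subseteq> {(z, w). h z = 0}"
  shows "polynomially_convex D"
proof -
  obtain G where "regular_curve h G" using regular_curve_smooth_plane[OF assms(1,2)] by blast
  then interpret curve: regular_curve h G .
  obtain N where N: "C2_submanifold N" "totally_real N" "compact D" "D \<subseteq> N" "C2_disc_image D"
    using assms(3) unfolding C2_totally_real_disc_def by blast
  obtain U and \<phi> :: "complex \<Rightarrow> complex \<times> complex" where \<phi>: "cball 0 1 \<subseteq> U" "C2_on U \<phi>" "inj_on \<phi> (cball 0 1)"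
    "\<forall>x\<in>cball 0 1. inj (frechet_derivative \<phi> (at x))" "\<phi> ` cball 0 1 = D"
    using N(5) unfolding C2_disc_image_def by blast
  obtain D\<phi> where D\<phi>: "\<And>x. x \<in> U \<Longrightarrow> (\<phi> has_derivative blinfun_apply (D\<phi> x)) (at x)" by (rule C2_onD[OF \<phi>(2)]) (rule that)
  have d\<phi>: "(\<phi> has_derivative blinfun_apply (D\<phi> x)) (at x)" if "x \<in> cball 0 1" for x
    using D\<phi> \<phi>(1) that by blast
  have \<phi>c: "continuous_on (cball 0 1) \<phi>"
    using d\<phi> by (meson continuous_at_imp_continuous_on has_derivative_continuous)
  define f where "f x = fst (\<phi> x)" for x
  interpret disc: disc_on_curve h G f "\<lambda>x v. fst (blinfun_apply (D\<phi> x) v)"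
  proof unfold_locales
    fix x :: complex assume x: "x \<in> cball 0 1"
    show "(f has_derivative (\<lambda>v. fst (blinfun_apply (D\<phi> x) v))) (at x)"
      unfolding f_def by (intro has_derivative_fst d\<phi> x)
    show "\<exists>v. fst (blinfun_apply (D\<phi> x) v) \<noteq> 0"
    proof (rule totally_real_transversal[OF N(2)])
      show "\<phi> x \<in> N" using x \<phi>(5) N(4) by blast
      show "linear (blinfun_apply (D\<phi> x))" by (rule bounded_linear.linear[OF blinfun.bounded_linear_right])
      have "frechet_derivative \<phi> (at x) = blinfun_apply (D\<phi> x)" using frechet_derivative_at[OF d\<phi>[OF x]] by simp
      then show "inj (blinfun_apply (D\<phi> x))" using \<phi>(4) x by metis
      show "blinfun_apply (D\<phi> x) v \<in> tangent_space N (\<phi> x)" for v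
        by (rule disc_tangent[OF N(1) d\<phi>[OF x] x]) (use \<phi>(5) N(4) in simp)
    qed
  next
    show "f ` cball 0 1 \<subseteq> curve.E" using assms(4) \<phi>(5) by (auto simp: f_def curve.E_def)
  qed
  define \<theta> where "\<theta> = inv_into (cball 0 1) \<phi>"
  have \<theta>: "\<theta> (\<phi> x) = x" if "x \<in> cball 0 1" for x unfolding \<theta>_def by (rule inv_into_f_f[OF \<phi>(3) that])
  have \<theta>c: "continuous_on D \<theta>" unfolding \<phi>(5)[symmetric]
    by (rule continuous_on_inv[OF \<phi>c compact_cball]) (use \<theta> in blast)
  have \<theta>D: "\<theta> y \<in> cball 0 1 \<and> \<phi> (\<theta> y) = y" if "y \<in> D" for y using that \<theta> \<phi>(5) by force
  have cp: "closest_point (cball 0 1) x = x" if "x \<in> cball 0 1" for x :: complex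
    using closest_point_self[OF that] .
  \<comment> \<open>Composing \<phi> with the nearest-point retraction onto the closed disc gives a
    continuous map of the whole plane onto \<open>D\<close>.\<close>
  interpret sheeted h G D "\<lambda>y. disc.lift (\<theta> y)" "\<lambda>x. \<phi> (closest_point (cball 0 1) x)"
  proof unfold_locales
    show "compact D" by (rule N(3))
    show "connected D" unfolding \<phi>(5)[symmetric]
      by (intro connected_continuous_image \<phi>c convex_connected convex_cball)
    show "fst ` D \<subseteq> curve.E" using assms(4) by (auto simp: curve.E_def)
    show "continuous_on D (\<lambda>y. disc.lift (\<theta> y))"
      by (rule continuous_on_compose2[OF disc.lift_cont \<theta>c]) (use \<theta>D in blast)
    show "continuous_on UNIV (\<lambda>x. \<phi> (closest_point (cball 0 1) x))"
    proof (rule continuous_on_compose2[OF \<phi>c])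
      show "continuous_on UNIV (closest_point (cball (0::complex) 1))"
        by (rule continuous_on_closest_point) auto
      show "range (closest_point (cball (0::complex) 1)) \<subseteq> cball 0 1"
        using closest_point_in_set[of "cball (0::complex) 1"] by auto
    qed
    have "range (closest_point (cball (0::complex) 1)) = cball 0 1"
    proof
      show "range (closest_point (cball (0::complex) 1)) \<subseteq> cball 0 1"
        using closest_point_in_set[of "cball (0::complex) 1"] by auto
      show "cball 0 1 \<subseteq> range (closest_point (cball (0::complex) 1))" using cp by (metis rangeI subsetI)
    qed
    then show "range (\<lambda>x. \<phi> (closest_point (cball 0 1) x)) = D"
      unfolding \<phi>(5)[symmetric] by (metis image_image)
    fix z assume z: "z \<in> curve.E"
    have "snd ` {y \<in> D. fst y = z} = (\<lambda>x. snd (\<phi> x)) ` {x \<in> cball 0 1. f x = z}"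
      unfolding \<phi>(5)[symmetric] f_def by auto
    moreover have "connected (- ((\<lambda>x. snd (\<phi> x)) ` {x \<in> cball 0 1. f x = z}))"
    proof (rule disc.connected_Compl_fibre[OF _ _ z])
      show "continuous_on (cball 0 1) (\<lambda>x. snd (\<phi> x))" by (intro continuous_on_snd \<phi>c)
      show "inj_on (\<lambda>x. (f x, snd (\<phi> x))) (cball 0 1)" using \<phi>(3) by (simp add: f_def)
    qed
    ultimately show "connected (- snd ` {y \<in> D. fst y = z})" by simp
    obtain r S T where S: "r > 0" "S z = 0" "continuous_on (curve.E \<inter> ball z r) S"
      "\<forall>e>0. \<exists>z'\<in>curve.E \<inter> ball z e. S z' > 0" "finite T"
      "\<forall>x\<in>cball 0 1. f x \<in> ball z r \<longrightarrow> disc.lift x - S (f x) \<in> T"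
      using disc.sheets[OF z] by (elim exE conjE)
    have "disc.lift (\<theta> y) - S (fst y) \<in> T" if "y \<in> D" "fst y \<in> ball z r" for y
      using S(6) \<theta>D[OF that(1)] that(2) by (metis f_def)
    then show "\<exists>r S T. r > 0 \<and> S z = 0 \<and> continuous_on (curve.E \<inter> ball z r) S \<and>
      (\<forall>e>0. \<exists>z'\<in>curve.E \<inter> ball z e. S z' > 0) \<and> finite T \<and>
      (\<forall>y\<in>D. fst y \<in> ball z r \<longrightarrow> disc.lift (\<theta> y) - S (fst y) \<in> T)"
      using S(1-5) by (intro exI[of _ r] exI[of _ S] exI[of _ T]) simp
  qed
  show ?thesis unfolding polynomially_convex_def by (rule poly_hull_eq)
qed

end
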